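(* For all sufficiently large $R>0$, the sequence $\{\Theta^{(\nu)}\}_{\nu\ge 0}$ converges in the Banach space $\mathscr{X}$. Moreover, its limit $\Theta$ is piecewise holomorphic in $\zeta$ with jumps along the rays $r,-r$ and continuous on the closed half-planes determined by these rays, and $\Theta$ is $C^\infty$ in $a,\overline{a},\theta_1,\theta_2$.
   Context: Data. $U\subset\mathbb{C}$ is a neighborhood of $0$ with coordinate $a$; $T^2=(S^1)^2$ has angular coordinates $\theta=(\theta_1,\theta_2)$. $\Gamma\cong\mathbb{Z}^2$ is a lattice with an antisymmetric integer-valued pairing $\langle\,,\rangle$ and a basis of primitive elements $\gamma_1,\gamma_2$ with $\langle\gamma_1,\gamma_2\rangle=1$. $Z:\gamma\mapsto Z_\gamma$ is a homomorphism from $\Gamma$ to the holomorphic functions on $U$, with $Z_{\gamma_1}(a),Z_{\gamma_2}(a)\neq 0$ for all $a\in U$. $\Gamma$ carries a positive definite norm with $|\langle\gamma,\gamma'\rangle|\le\|\gamma\|\,\|\gamma'\|$. $\Omega:\Gamma\to\mathbb{Z}$ satisfies $\Omega(\gamma)=\Omega(-\gamma)$, and there is a constant $\kappa>0$ with $|Z_\gamma|/\|\gamma\|>\kappa$ for all $\gamma$ with $\Omega(\gamma)\ne 0$ (support property). Rays and jumps. For $\gamma$ with $\Omega(\gamma)\neq0$ let $\ell_\gamma(a)=\{-tZ_\gamma(a):t>0\}$. A pair $\mathcal{Y}_1,\mathcal{Y}_2$ of nonvanishing functions is extended to $\Gamma$ by $\mathcal{Y}_{c_1\gamma_1+c_2\gamma_2}=\mathcal{Y}_1^{c_1}\mathcal{Y}_2^{c_2}$,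 and $\mathcal{K}_\gamma$ acts by $\mathcal{K}_\gamma\mathcal{Y}_{\gamma'}=\mathcal{Y}_{\gamma'}(1-\mathcal{Y}_\gamma)^{\langle\gamma',\gamma\rangle}$. For a ray $r$ from $0$ to $\infty$ let $\mathbb{H}_r$ be the open half-plane of vectors making an acute angle with $r$. $U$ is assumed small enough that there is a pair of opposite (admissible) rays $r,-r$ such that for all $a\in U$ half of the rays $\ell_\gamma(a)$ lie in $\mathbb{H}_r$ and the other half in $\mathbb{H}_{-r}$. Write $\gamma>0$ if $\ell_\gamma\subset\mathbb{H}_r$ and $\gamma<0$ if $\ell_\gamma\subset\mathbb{H}_{-r}$. Define $S_r=\prod_{\gamma>0}\mathcal{K}_\gamma^{\Omega(\gamma)}$ and $S_{-r}=\prod_{\gamma<0}\mathcal{K}_\gamma^{\Omega(\gamma)}$, factors composed in the counterclockwise order of the rays $\ell_\gamma$. Expand $\log(S_{\pm r}\mathcal{Y}_\gamma/\mathcal{Y}_\gamma)=\sum_{\gamma'}f_\gamma^{\gamma'}\mathcal{Y}_{\gamma'}$ as a power series with rational coefficients $f^{\gamma'}_\gamma$ (sum over $\gamma'>0$ for $S_r$, over $\gamma'<0$ for $S_{-r}$). The $\Omega(\gamma)$ are assumed not to grow too quickly: for constants $c>0$, $\delta$, the sums $\sum_{\gamma'}|f^{\gamma'}_{\gamma_k}|e^{(-cR+\delta)|Z_{\gamma'}(a)|}$ converge for large $R$ and become arbitrarily small, uniformly in $a$, as $R$ grows. Iterations. For $\Phi=(\Phi_1,\Phi_2)$ put $\Phi_{c_1\gamma_1+c_2\gamma_2}=c_1\Phi_1+c_2\Phi_2$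 and, for $R>0$, $$\mathcal{X}^{\mathrm{sf}}_\gamma(a,\zeta,\Phi)=\exp\Big(\pi R\frac{Z_\gamma(a)}{\zeta}+i\Phi_\gamma+\pi R\,\zeta\,\overline{Z_\gamma(a)}\Big).$$ Let $K(\zeta,\zeta')=\frac{d\zeta'}{\zeta'}\frac{\zeta'+\zeta}{\zeta'-\zeta}$. Define $\Theta^{(0)}=\theta$ and, for $\nu\ge0$, $k=1,2$, $$\Theta^{(\nu+1)}_k=\theta_k-\frac{1}{4\pi}\Big\{\sum_{\gamma'>0}f_{\gamma_k}^{\gamma'}\int_r K(\zeta,\zeta')\,\mathcal{X}^{\mathrm{sf}}_{\gamma'}(a,\zeta',\Theta^{(\nu)})+\sum_{\gamma'<0}f_{\gamma_k}^{\gamma'}\int_{-r} K(\zeta,\zeta')\,\mathcal{X}^{\mathrm{sf}}_{\gamma'}(a,\zeta',\Theta^{(\nu)})\Big\},$$ the rays being oriented from $0$ to $\infty$; in the integrals, $\Theta^{(\nu)}$ (which itself has jumps at $r,-r$) denotes the analytic continuation to $r$ (resp. $-r$) along $\mathbb{H}_r$ (resp. $\mathbb{H}_{-r}$). Banach space. $\mathscr{X}$ is the completion of the space of bounded functions $\Phi:U\times T^2\times\mathbb{P}^1\to\mathbb{C}^2$ that are smooth on $U\times T^2$ (no condition besides boundedness in the variable $\zeta\in\mathbb{P}^1$) under the norm $\|\Phi\|=\sup_{\zeta,\theta,a}\|\Phi(\zeta,\theta,a)\|_{\mathbb{C}^2}$, where $\|\cdot\|_{\mathbb{C}^2}$ is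 the maximum of the absolute values of the coordinates.
   Formalization: Admissible rays r, −r are required to make angles with all rays ℓ_γ(a), Ω(γ)≠0, bounded away from π/2 uniformly in a and γ; if the ℓ_γ accumulate at the boundary of the half-planes, Θ^(1)−θ can be unbounded and convergence in the Banach space fails. *)

theory Defs
  imports "HOL-Analysis.Analysis"
begin

section \<open>The charge lattice\<close>

text \<open>The charge \<open>c\<^sub>1\<gamma>\<^sub>1 + c\<^sub>2\<gamma>\<^sub>2\<close> is the pair \<open>(c\<^sub>1, c\<^sub>2)\<close>. An antisymmetric pairing with
  \<open>\<langle>\<gamma>\<^sub>1, \<gamma>\<^sub>2\<rangle> = 1\<close> is necessarily the one below.\<close>

type_synonym charge = "int \<times> int"

definition gamma1 :: charge where "gamma1 = (1, 0)"
definition gamma2 :: charge where "gamma2 = (0, 1)"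

definition pairing :: "charge \<Rightarrow> charge \<Rightarrow> int" where
  "pairing \<gamma> \<gamma>' = fst \<gamma> * snd \<gamma>' - snd \<gamma> * fst \<gamma>'"

section \<open>Rays and half-planes\<close>

text \<open>A ray from \<open>0\<close> to \<open>\<infinity>\<close> is given by a nonzero direction \<open>\<rho>\<close>.\<close>

definition ray :: "complex \<Rightarrow> complex set" where
  "ray \<rho> = {of_real t * \<rho> | t. t > 0}"

definition acute_plane :: "complex \<Rightarrow> complex set" where
  "acute_plane \<rho> = {z. Re (z * cnj \<rho>) > 0}"

text \<open>The two half-planes bounded by the line \<open>ray \<rho> \<union> {0} \<union> ray (- \<rho>)\<close>: the one on the
  counterclockwise side of \<open>ray \<rho>\<close> and the one on its clockwise side.\<close>

definition left_plane :: "complex \<Rightarrow> complex set" where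
  "left_plane \<rho> = {z. Im (z * cnj \<rho>) > 0}"

definition right_plane :: "complex \<Rightarrow> complex set" where
  "right_plane \<rho> = {z. Im (z * cnj \<rho>) < 0}"

definition bps_ray :: "(charge \<Rightarrow> complex \<Rightarrow> complex) \<Rightarrow> charge \<Rightarrow> complex \<Rightarrow> complex set" where
  "bps_ray Z \<gamma> a = {- (of_real t * Z \<gamma> a) | t. t > 0}"

text \<open>The sign of a charge does not depend on \<open>a\<close>. The definition is made for all charges, since the
  expansion coefficients of \<open>S\<^sub>r\<close> also live at sums of charges \<open>\<gamma>\<close> with \<open>\<Omega>(\<gamma>) \<noteq> 0\<close>. Negative charges
  are \<open>positive_charges U Z (- \<rho>)\<close>.\<close>

definition positive_charges ::
  "complex set \<Rightarrow> (charge \<Rightarrow> complex \<Rightarrow> complex) \<Rightarrow> complex \<Rightarrow> charge set" where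
  "positive_charges U Z \<rho> = {\<gamma>. \<forall>a\<in>U. bps_ray Z \<gamma> a \<subseteq> acute_plane \<rho>}"

section \<open>Formal series in the variables Y\<close>

text \<open>A formal series \<open>\<Sum>\<^sub>\<gamma> F(\<gamma>) Y\<^sub>\<gamma>\<close> is its coefficient function. The sums below are meant for series
  for which they are finite coefficientwise; this holds for all series obtained from the monomials
  \<open>Y\<^sub>\<gamma>\<close> by finitely many jumps \<open>K\<^sub>\<alpha>\<close> with all \<open>\<alpha>\<close> in one open half-plane.\<close>

type_synonym fseries = "charge \<Rightarrow> rat"

definition fs_monom :: "charge \<Rightarrow> fseries" where
  "fs_monom \<gamma> = (\<lambda>\<gamma>'. if \<gamma>' = \<gamma> then 1 else 0)"

definition fs_mult :: "fseries \<Rightarrow> fseries \<Rightarrow> fseries" where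
  "fs_mult F G = (\<lambda>\<gamma>. \<Sum>\<alpha> | F \<alpha> \<noteq> 0 \<and> G (\<gamma> - \<alpha>) \<noteq> 0. F \<alpha> * G (\<gamma> - \<alpha>))"

primrec fs_power :: "fseries \<Rightarrow> nat \<Rightarrow> fseries" where
  "fs_power F 0 = fs_monom 0"
| "fs_power F (Suc n) = fs_mult F (fs_power F n)"

definition fs_suminf :: "(nat \<Rightarrow> fseries) \<Rightarrow> fseries" where
  "fs_suminf F = (\<lambda>\<gamma>. \<Sum>n | F n \<gamma> \<noteq> 0. F n \<gamma>)"

text \<open>\<open>(1 - F)\<^sup>m = \<Sum>\<^sub>n (m choose n) (- F)\<^sup>n\<close> for an integer \<open>m\<close>.\<close>

definition fs_one_minus_powi :: "fseries \<Rightarrow> int \<Rightarrow> fseries" where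
  "fs_one_minus_powi F m =
     fs_suminf (\<lambda>n \<gamma>. ((of_int m :: rat) gchoose n) * (- 1) ^ n * fs_power F n \<gamma>)"

text \<open>\<open>log F = \<Sum>\<^sub>n\<^sub>\<ge>\<^sub>1 (-1)\<^sup>n\<^sup>+\<^sup>1 (F - 1)\<^sup>n / n\<close>, for \<open>F\<close> with constant term \<open>1\<close>.\<close>

definition fs_log :: "fseries \<Rightarrow> fseries" where
  "fs_log F = fs_suminf (\<lambda>n \<gamma>. if n = 0 then 0
     else (- 1) ^ (n + 1) / of_nat n * fs_power (\<lambda>\<gamma>'. F \<gamma>' - fs_monom 0 \<gamma>') n \<gamma>)"

section \<open>The jumps\<close>

text \<open>A pair \<open>\<Y>\<^sub>1, \<Y>\<^sub>2\<close> is represented by its multiplicative extension \<open>\<gamma> \<mapsto> \<Y>\<^sub>\<gamma>\<close> to all charges.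
  \<open>K\<^sub>\<alpha>\<close> fixes \<open>\<Y>\<^sub>\<alpha>\<close> because \<open>\<langle>\<alpha>, \<alpha>\<rangle> = 0\<close>, so the power \<open>K\<^sub>\<alpha>\<^sup>m\<close> multiplies the exponent by \<open>m\<close>.\<close>

definition K_jump :: "charge \<Rightarrow> int \<Rightarrow> (charge \<Rightarrow> fseries) \<Rightarrow> (charge \<Rightarrow> fseries)" where
  "K_jump \<alpha> m \<Y> = (\<lambda>\<gamma>. fs_mult (\<Y> \<gamma>) (fs_one_minus_powi (\<Y> \<alpha>) (m * pairing \<gamma> \<alpha>)))"

text \<open>The jumps along a list of charges, the head of the list acting first.\<close>

definition S_list :: "(charge \<Rightarrow> int) \<Rightarrow> charge list \<Rightarrow> (charge \<Rightarrow> fseries) \<Rightarrow> (charge \<Rightarrow> fseries)" where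
  "S_list \<Omega> \<alpha>s = fold (\<lambda>\<alpha>. K_jump \<alpha> (\<Omega> \<alpha>)) \<alpha>s"

text \<open>\<open>Arg\<close> is continuous on the half-plane of vectors making an acute angle with \<open>1\<close>, hence the
  rotation by \<open>\<rho>\<close>.\<close>

definition ccw_ordered ::
  "(charge \<Rightarrow> complex \<Rightarrow> complex) \<Rightarrow> complex \<Rightarrow> complex \<Rightarrow> charge list \<Rightarrow> bool" where
  "ccw_ordered Z a \<rho> \<alpha>s \<longleftrightarrow>
     sorted_wrt (\<lambda>\<alpha> \<beta>. Arg (- Z \<alpha> a / \<rho>) \<le> Arg (- Z \<beta> a / \<rho>)) \<alpha>s"

text \<open>\<open>F\<close> is the expansion of \<open>log (S\<^sub>r Y\<^sub>\<gamma> / Y\<^sub>\<gamma>)\<close>, where \<open>r = ray \<rho>\<close> and \<open>S\<^sub>r\<close> is formed with the order of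
  the rays over the point \<open>a\<close>. The possibly infinite product is the limit of its finite subproducts
  in the topology in which each coefficient is eventually constant. Charges with the same ray may
  come in any order, and the coefficients are required not to depend on that order.\<close>

definition is_log_jump ::
  "complex set \<Rightarrow> (charge \<Rightarrow> complex \<Rightarrow> complex) \<Rightarrow> (charge \<Rightarrow> int) \<Rightarrow> complex \<Rightarrow> complex \<Rightarrow>
   charge \<Rightarrow> fseries \<Rightarrow> bool" where
  "is_log_jump U Z \<Omega> a \<rho> \<gamma> F \<longleftrightarrow>
     (\<forall>\<gamma>'. \<forall>\<^sub>F A in finite_subsets_at_top {\<alpha> \<in> positive_charges U Z \<rho>. \<Omega> \<alpha> \<noteq> 0}.
        \<forall>\<alpha>s. distinct \<alpha>s \<and> set \<alpha>s = A \<and> ccw_ordered Z a \<rho> \<alpha>s \<longrightarrow>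
          fs_log (fs_mult (S_list \<Omega> \<alpha>s fs_monom \<gamma>) (fs_monom (- \<gamma>))) \<gamma>' = F \<gamma>')"

section \<open>Standing assumptions\<close>

text \<open>
  \<^item> \<open>admissible\<close> asks, on top of \<open>half\<close>, that the rays \<open>\<ell>\<^sub>\<gamma>(a)\<close> stay away from the boundary of the
    half-planes \<open>\<bbbH>\<^sub>r\<close>, \<open>\<bbbH>\<^sub>-\<^sub>r\<close>. It is automatic after shrinking \<open>U\<close> if only finitely many \<open>\<Omega>(\<gamma>)\<close> are
    nonzero. In general, if rays accumulate at the boundary, the exponentials of the charges involved
    do not decay along \<open>r\<close>, and the iterates below need not be bounded.
  \<^item> The coefficients \<open>f \<gamma> \<gamma>'\<close> do not depend on \<open>a\<close>. They are those of \<open>S\<^sub>\<plusminus>\<^sub>r\<close> formed with the order of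
    the rays over one arbitrary point \<open>a\<^sub>0\<close> of \<open>U\<close>.\<close>

locale rh_data =
  fixes U :: "complex set"
    and Z :: "charge \<Rightarrow> complex \<Rightarrow> complex"
    and nrm :: "charge \<Rightarrow> real"
    and \<Omega> :: "charge \<Rightarrow> int"
    and \<kappa> :: real
    and \<rho> :: complex
    and a\<^sub>0 :: complex
    and f :: "charge \<Rightarrow> charge \<Rightarrow> rat"
    and c \<delta> :: real
  assumes U: "open U" "0 \<in> U"
    and Z_holomorphic: "Z \<gamma> holomorphic_on U"
    and Z_add: "a \<in> U \<Longrightarrow> Z (\<gamma> + \<gamma>') a = Z \<gamma> a + Z \<gamma>' a"
    and Z_nonzero: "a \<in> U \<Longrightarrow> Z gamma1 a \<noteq> 0" "a \<in> U \<Longrightarrow> Z gamma2 a \<noteq> 0"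
    and nrm_nonneg: "nrm \<gamma> \<ge> 0"
    and nrm_eq_0: "nrm \<gamma> = 0 \<longleftrightarrow> \<gamma> = 0"
    and nrm_triangle: "nrm (\<gamma> + \<gamma>') \<le> nrm \<gamma> + nrm \<gamma>'"
    and nrm_scale: "nrm (m * fst \<gamma>, m * snd \<gamma>) = real_of_int \<bar>m\<bar> * nrm \<gamma>"
    and nrm_pairing: "real_of_int \<bar>pairing \<gamma> \<gamma>'\<bar> \<le> nrm \<gamma> * nrm \<gamma>'"
    and \<Omega>_minus: "\<Omega> (- \<gamma>) = \<Omega> \<gamma>"
    and \<kappa>_pos: "\<kappa> > 0"
    and support_property: "a \<in> U \<Longrightarrow> \<Omega> \<gamma> \<noteq> 0 \<Longrightarrow> cmod (Z \<gamma> a) / nrm \<gamma> > \<kappa>"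
    and \<rho>_nonzero: "\<rho> \<noteq> 0"
    and half: "\<Omega> \<gamma> \<noteq> 0 \<Longrightarrow> \<gamma> \<in> positive_charges U Z \<rho> \<union> positive_charges U Z (- \<rho>)"
    and admissible: "\<exists>\<epsilon>>0. \<forall>a\<in>U. \<forall>\<gamma>. \<Omega> \<gamma> \<noteq> 0 \<longrightarrow>
          \<bar>Re (Z \<gamma> a * cnj \<rho>)\<bar> \<ge> \<epsilon> * cmod (Z \<gamma> a) * cmod \<rho>"
    and a\<^sub>0: "a\<^sub>0 \<in> U"
    and f_plus: "is_log_jump U Z \<Omega> a\<^sub>0 \<rho> \<gamma>
          (\<lambda>\<gamma>'. if \<gamma>' \<in> positive_charges U Z \<rho> then f \<gamma> \<gamma>' else 0)"
    and f_minus: "is_log_jump U Z \<Omega> a\<^sub>0 (- \<rho>) \<gamma>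
          (\<lambda>\<gamma>'. if \<gamma>' \<in> positive_charges U Z (- \<rho>) then f \<gamma> \<gamma>' else 0)"
    and c_pos: "c > 0"
    and growth: "\<gamma> \<in> {gamma1, gamma2} \<Longrightarrow> \<epsilon> > 0 \<Longrightarrow>
          \<exists>R\<^sub>0. \<forall>R\<ge>R\<^sub>0. \<forall>a\<in>U.
            (\<lambda>\<gamma>'. \<bar>real_of_rat (f \<gamma> \<gamma>')\<bar> * exp ((- c * R + \<delta>) * cmod (Z \<gamma>' a)))
              summable_on (positive_charges U Z \<rho> \<union> positive_charges U Z (- \<rho>)) \<and>
            (\<Sum>\<^sub>\<infinity>\<gamma>'\<in>positive_charges U Z \<rho> \<union> positive_charges U Z (- \<rho>).
               \<bar>real_of_rat (f \<gamma> \<gamma>')\<bar> * exp ((- c * R + \<delta>) * cmod (Z \<gamma>' a))) < \<epsilon>"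

section \<open>The iteration\<close>

text \<open>The Riemann sphere is the one-point compactification of the plane; \<open>None\<close> is \<open>\<infinity>\<close>.\<close>

abbreviation riemann_sphere :: "complex option topology" where
  "riemann_sphere \<equiv> Alexandroff_compactification euclidean"

text \<open>A function on \<open>U \<times> T\<^sup>2 \<times> \<bbbP>\<^sup>1\<close> is written \<open>\<Phi> a \<theta> \<zeta>\<close>, where the angles \<open>\<theta>\<close> range over the universal
  cover \<open>\<real>\<^sup>2\<close> of \<open>T\<^sup>2\<close>. Values for \<open>a \<notin> U\<close> are irrelevant.\<close>

type_synonym phi_fun = "complex \<Rightarrow> real \<times> real \<Rightarrow> complex option \<Rightarrow> complex \<times> complex"

definition angles :: phi_fun where
  "angles = (\<lambda>a \<theta> \<zeta>. (of_real (fst \<theta>), of_real (snd \<theta>)))"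

definition Xsf :: "(charge \<Rightarrow> complex \<Rightarrow> complex) \<Rightarrow> real \<Rightarrow> charge \<Rightarrow> complex \<Rightarrow> complex \<Rightarrow>
    complex \<times> complex \<Rightarrow> complex" where
  "Xsf Z R \<gamma> a \<zeta> \<Phi> = exp (of_real (pi * R) * Z \<gamma> a / \<zeta>
     + \<i> * (of_int (fst \<gamma>) * fst \<Phi> + of_int (snd \<gamma>) * snd \<Phi>)
     + of_real (pi * R) * \<zeta> * cnj (Z \<gamma> a))"

primrec kern :: "complex option \<Rightarrow> complex \<Rightarrow> complex" where
  "kern (Some \<zeta>) \<zeta>' = (\<zeta>' + \<zeta>) / (\<zeta>' - \<zeta>)"
| "kern None \<zeta>' = - 1"

text \<open>\<open>\<integral> d\<zeta>'/\<zeta>' (\<zeta>' + \<zeta>)/(\<zeta>' - \<zeta>) h(\<zeta>')\<close> over \<open>ray \<rho>\<close>, oriented from \<open>0\<close> to \<open>\<infinity>\<close>, with the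
  parametrization \<open>\<zeta>' = t \<rho>\<close>, so that \<open>d\<zeta>'/\<zeta>' = dt/t\<close>.\<close>

definition ray_integral :: "complex \<Rightarrow> complex option \<Rightarrow> (complex \<Rightarrow> complex) \<Rightarrow> complex" where
  "ray_integral \<rho> \<zeta> h =
     (LINT t:{0<..}|lborel. kern \<zeta> (of_real t * \<rho>) * h (of_real t * \<rho>) / of_real t)"

definition bracket :: "complex set \<Rightarrow> (charge \<Rightarrow> complex \<Rightarrow> complex) \<Rightarrow> complex \<Rightarrow>
    (charge \<Rightarrow> charge \<Rightarrow> rat) \<Rightarrow> real \<Rightarrow> charge \<Rightarrow> phi_fun \<Rightarrow> complex \<Rightarrow> real \<times> real \<Rightarrow> complex option \<Rightarrow> complex"
  where
  "bracket U Z \<rho> f R \<gamma> \<Phi> a \<theta> \<zeta> =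
     (\<Sum>\<^sub>\<infinity>\<gamma>'\<in>positive_charges U Z \<rho>.
        of_rat (f \<gamma> \<gamma>') * ray_integral \<rho> \<zeta> (\<lambda>\<zeta>'. Xsf Z R \<gamma>' a \<zeta>' (\<Phi> a \<theta> (Some \<zeta>'))))
   + (\<Sum>\<^sub>\<infinity>\<gamma>'\<in>positive_charges U Z (- \<rho>).
        of_rat (f \<gamma> \<gamma>') * ray_integral (- \<rho>) \<zeta> (\<lambda>\<zeta>'. Xsf Z R \<gamma>' a \<zeta>' (\<Phi> a \<theta> (Some \<zeta>'))))"

definition step_off_rays :: "complex set \<Rightarrow> (charge \<Rightarrow> complex \<Rightarrow> complex) \<Rightarrow> complex \<Rightarrow>
    (charge \<Rightarrow> charge \<Rightarrow> rat) \<Rightarrow> real \<Rightarrow> phi_fun \<Rightarrow> phi_fun" where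
  "step_off_rays U Z \<rho> f R \<Phi> a \<theta> \<zeta> =
     (of_real (fst \<theta>) - 1 / (4 * of_real pi) * bracket U Z \<rho> f R gamma1 \<Phi> a \<theta> \<zeta>,
      of_real (snd \<theta>) - 1 / (4 * of_real pi) * bracket U Z \<rho> f R gamma2 \<Phi> a \<theta> \<zeta>)"

text \<open>The integral formula makes sense for \<open>\<zeta>\<close> off the open rays \<open>r\<close> and \<open>-r\<close> (in particular at \<open>0\<close> and
  \<open>\<infinity>\<close>). On \<open>r\<close> the function takes its boundary values from the half-plane \<open>H\<^sub>p\<close>, on \<open>-r\<close> from
  \<open>H\<^sub>m\<close>; each of \<open>H\<^sub>p\<close>, \<open>H\<^sub>m\<close> is one of the two half-planes bounded by \<open>r\<close> and \<open>-r\<close>. These are the values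
  which enter the integrals of the next step.\<close>

definition step :: "complex set \<Rightarrow> (charge \<Rightarrow> complex \<Rightarrow> complex) \<Rightarrow> complex \<Rightarrow>
    (charge \<Rightarrow> charge \<Rightarrow> rat) \<Rightarrow> complex set \<Rightarrow> complex set \<Rightarrow> real \<Rightarrow> phi_fun \<Rightarrow> phi_fun" where
  "step U Z \<rho> f H\<^sub>p H\<^sub>m R \<Phi> a \<theta> \<zeta> =
     (if \<zeta> \<in> Some ` ray \<rho> then
        Lim (at (the \<zeta>) within H\<^sub>p) (\<lambda>z. step_off_rays U Z \<rho> f R \<Phi> a \<theta> (Some z))
      else if \<zeta> \<in> Some ` ray (- \<rho>) then
        Lim (at (the \<zeta>) within H\<^sub>m) (\<lambda>z. step_off_rays U Z \<rho> f R \<Phi> a \<theta> (Some z))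
      else step_off_rays U Z \<rho> f R \<Phi> a \<theta> \<zeta>)"

primrec Theta_iter :: "complex set \<Rightarrow> (charge \<Rightarrow> complex \<Rightarrow> complex) \<Rightarrow> complex \<Rightarrow>
    (charge \<Rightarrow> charge \<Rightarrow> rat) \<Rightarrow> complex set \<Rightarrow> complex set \<Rightarrow> real \<Rightarrow> nat \<Rightarrow> phi_fun" where
  "Theta_iter U Z \<rho> f H\<^sub>p H\<^sub>m R 0 = angles"
| "Theta_iter U Z \<rho> f H\<^sub>p H\<^sub>m R (Suc \<nu>) =
     step U Z \<rho> f H\<^sub>p H\<^sub>m R (Theta_iter U Z \<rho> f H\<^sub>p H\<^sub>m R \<nu>)"

section \<open>The Banach space\<close>

primrec Ck_on :: "nat \<Rightarrow> 'a::real_normed_vector set \<Rightarrow> ('a \<Rightarrow> 'b::real_normed_vector) \<Rightarrow> bool" where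
  "Ck_on 0 S g \<longleftrightarrow> continuous_on S g"
| "Ck_on (Suc k) S g \<longleftrightarrow> (\<forall>x\<in>S. g differentiable (at x)) \<and>
     (\<forall>v. Ck_on k S (\<lambda>x. frechet_derivative g (at x) v))"

text \<open>For an open subset \<open>S\<close> of a Euclidean space; on \<open>\<complex>\<close> this is smoothness in \<open>a\<close> and its conjugate.\<close>

definition smooth_on :: "'a::euclidean_space set \<Rightarrow> ('a \<Rightarrow> 'b::real_normed_vector) \<Rightarrow> bool" where
  "smooth_on S g \<longleftrightarrow> (\<forall>k. Ck_on k S g)"

definition max_norm :: "complex \<times> complex \<Rightarrow> real" where
  "max_norm v = max (cmod (fst v)) (cmod (snd v))"

definition field_bounded :: "complex set \<Rightarrow> phi_fun \<Rightarrow> bool" where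
  "field_bounded U \<Phi> \<longleftrightarrow> (\<exists>B. \<forall>a\<in>U. \<forall>\<theta> \<zeta>. max_norm (\<Phi> a \<theta> \<zeta>) \<le> B)"

definition field_norm :: "complex set \<Rightarrow> phi_fun \<Rightarrow> real" where
  "field_norm U \<Phi> = (SUP (a, \<theta>, \<zeta>) \<in> U \<times> UNIV \<times> UNIV. max_norm (\<Phi> a \<theta> \<zeta>))"

definition field_diff :: "phi_fun \<Rightarrow> phi_fun \<Rightarrow> phi_fun" where
  "field_diff \<Phi> \<Psi> = (\<lambda>a \<theta> \<zeta>. \<Phi> a \<theta> \<zeta> - \<Psi> a \<theta> \<zeta>)"

definition field_periodic :: "complex set \<Rightarrow> phi_fun \<Rightarrow> bool" where
  "field_periodic U \<Phi> \<longleftrightarrow> (\<forall>a\<in>U. \<forall>x y \<zeta>.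
     \<Phi> a (x + 2 * pi, y) \<zeta> = \<Phi> a (x, y) \<zeta> \<and> \<Phi> a (x, y + 2 * pi) \<zeta> = \<Phi> a (x, y) \<zeta>)"

definition field_smooth :: "complex set \<Rightarrow> phi_fun \<Rightarrow> bool" where
  "field_smooth U \<Phi> \<longleftrightarrow> (\<forall>\<zeta>. smooth_on (U \<times> UNIV) (\<lambda>(a, \<theta>). \<Phi> a \<theta> \<zeta>))"

definition pre_X :: "complex set \<Rightarrow> phi_fun set" where
  "pre_X U = {\<Phi>. field_bounded U \<Phi> \<and> field_periodic U \<Phi> \<and> field_smooth U \<Phi>}"

text \<open>The completion is realized as the closure in the complete space of all bounded functions.\<close>

definition banach_X :: "complex set \<Rightarrow> phi_fun set" where
  "banach_X U = {\<Phi>. field_bounded U \<Phi> \<and>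
     (\<forall>\<epsilon>>0. \<exists>\<Psi>\<in>pre_X U. field_norm U (field_diff \<Phi> \<Psi>) < \<epsilon>)}"

text \<open>The angles are multivalued on \<open>T\<^sup>2\<close>, so that it is the single-valued differences to \<open>\<theta>\<close> which
  belong to the Banach space.\<close>

definition converges_in_X :: "complex set \<Rightarrow> (nat \<Rightarrow> phi_fun) \<Rightarrow> phi_fun \<Rightarrow> bool" where
  "converges_in_X U \<Phi> \<Psi> \<longleftrightarrow>
     (\<forall>\<nu>. field_diff (\<Phi> \<nu>) angles \<in> banach_X U) \<and> field_diff \<Psi> angles \<in> banach_X U \<and>
     (\<lambda>\<nu>. field_norm U (field_diff (\<Phi> \<nu>) \<Psi>)) \<longlonglongrightarrow> 0"

text \<open>Holomorphic on the open half-plane \<open>P\<close> with a continuous extension to the closed half-plane in the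
  sphere. On the open rays the extension need not agree with \<open>g\<close>: the extensions from the two sides
  differ by the jump.\<close>

definition holomorphic_up_to_rays :: "complex set \<Rightarrow> (complex option \<Rightarrow> complex \<times> complex) \<Rightarrow> bool" where
  "holomorphic_up_to_rays P g \<longleftrightarrow>
     (\<lambda>z. fst (g (Some z))) holomorphic_on P \<and> (\<lambda>z. snd (g (Some z))) holomorphic_on P \<and>
     (\<exists>G. continuous_map (subtopology riemann_sphere (insert None (Some ` closure P))) euclidean G \<and>
       (\<forall>\<zeta> \<in> insert None (insert (Some 0) (Some ` P)). G \<zeta> = g \<zeta>))"

end

theory Submission
  imports Defs "HOL-Complex_Analysis.Complex_Analysis"
begin

text \<open>
  One step of the iteration replaces \<open>\<Theta>\<close> by a Cauchy integral over \<open>r\<close> and \<open>-r\<close> of the exponentials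
  \<open>X\<^sub>\<gamma>(\<zeta>', \<Theta>)\<close>. These are tiny for large \<open>R\<close>, but the kernel is singular exactly where the next step
  evaluates the function, on the rays, so that the size of the integrand does not by itself bound the
  integral. The remedy is that the boundary values on a ray come from a half-plane in which everything
  is holomorphic. The ray can be rotated by a small angle into this half-plane. For \<open>\<zeta>\<close> close to the
  ray, the integral is then the integral over the rotated ray, plus the residue \<open>4 \<pi> \<i> X\<^sub>\<gamma>(\<zeta>, \<Theta>(\<zeta>))\<close>
  if \<open>\<zeta>\<close> lies on the side of the rotation; for all other \<open>\<zeta>\<close> the ray is left in place. The kernel is
  now bounded by a constant (\<open>sided_integral_bound\<close>), boundary values exist from both sides
  (\<open>sided_integral_continuous\<close>), and the step is a contraction in the supremum norm
  (\<open>rotated_step_contraction\<close>) because the residue has the same size as the integrand.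

  The exponentials are small only for charges whose rays stay away from the boundary of the
  half-plane. This is assumed for \<open>\<Omega>(\<gamma>) \<noteq> 0\<close>, whereas the coefficients \<open>f\<close> also live on sums of such
  charges; but it is a condition defining a convex cone, and the formal series never leave
  the monoid generated by the charges which enter (\<open>log_jump_support\<close>, \<open>active_charge_bounds\<close>).

  Smoothness of the limit costs no estimates of derivatives. The parameter \<open>a\<close> enters through the
  holomorphic functions \<open>Z\<^sub>\<gamma>(a)\<close> and through their conjugates, which are holomorphic in the conjugate of
  \<open>a\<close>; if \<open>a\<close> and its conjugate are made independent and the angles complex, then all iterates are
  holomorphic in four complex variables, on a region where the same contraction estimate
  holds. A uniform limit of such functions is of the same kind, and its restriction to the real
  points is smooth (\<open>line_holo_smooth\<close>). The limit is a fixed point of the step (\<open>limit_fixed\<close>), and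
  therefore inherits the behaviour of Cauchy integrals at the rays, at \<open>0\<close> and at \<open>\<infinity>\<close>.
\<close>

section \<open>Support of the expansion coefficients\<close>

declare split_paired_All [simp del] split_paired_Ex [simp del]

definition supported_in :: "charge set \<Rightarrow> fseries \<Rightarrow> bool" where
  "supported_in S F \<longleftrightarrow> (\<forall>\<gamma>. F \<gamma> \<noteq> 0 \<longrightarrow> \<gamma> \<in> S)"

text \<open>Every operation on formal series that enters \<open>S\<^sub>r\<close> and its logarithm preserves the series supported in
  a submonoid of the charges. Convergence is no issue here: an infinite sum has the value \<open>0\<close>, which only
  makes the support smaller.\<close>

locale charge_monoid =
  fixes S :: "charge set"
  assumes zero: "0 \<in> S" and add: "x \<in> S \<Longrightarrow> y \<in> S \<Longrightarrow> x + y \<in> S"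
begin

lemma fs_mult_nonzeroD:
  assumes "fs_mult F G \<gamma> \<noteq> 0"
  shows "\<exists>\<alpha>. F \<alpha> \<noteq> 0 \<and> G (\<gamma> - \<alpha>) \<noteq> 0"
  using assms unfolding fs_mult_def by (auto elim: sum.not_neutral_contains_not_neutral)

lemma supported_monom: "supported_in S (fs_monom 0)"
  using zero by (auto simp: supported_in_def fs_monom_def)

lemma supported_mult:
  assumes "supported_in S F" "supported_in S G"
  shows "supported_in S (fs_mult F G)"
  unfolding supported_in_def
proof (intro allI impI)
  fix \<gamma> assume "fs_mult F G \<gamma> \<noteq> 0"
  then obtain \<alpha> where "F \<alpha> \<noteq> 0" "G (\<gamma> - \<alpha>) \<noteq> 0" using fs_mult_nonzeroD by blast
  then have "\<alpha> + (\<gamma> - \<alpha>) \<in> S" using assms by (intro add) (auto simp: supported_in_def)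
  then show "\<gamma> \<in> S" by simp
qed

lemma supported_power: "supported_in S F \<Longrightarrow> supported_in S (fs_power F n)"
  by (induction n) (auto intro: supported_monom supported_mult)

lemma supported_suminf:
  assumes "\<And>n. supported_in S (F n)"
  shows "supported_in S (fs_suminf F)"
  using assms unfolding supported_in_def fs_suminf_def
  by (metis (mono_tags, lifting) mem_Collect_eq sum.not_neutral_contains_not_neutral)

lemma supported_one_minus_powi:
  assumes "supported_in S F" shows "supported_in S (fs_one_minus_powi F m)"
  unfolding fs_one_minus_powi_def
  by (rule supported_suminf) (use supported_power[OF assms] in \<open>auto simp: supported_in_def\<close>)

lemma supported_log:
  assumes "supported_in S F" shows "supported_in S (fs_log F)"
proof -
  have "supported_in S (\<lambda>\<gamma>'. F \<gamma>' - fs_monom 0 \<gamma>')"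
    using assms supported_monom by (force simp: supported_in_def)
  from supported_power[OF this] show ?thesis unfolding fs_log_def
    by (intro supported_suminf) (simp add: supported_in_def)
qed

text \<open>A jump multiplies the current series \<open>Y \<gamma>\<close> by a series in \<open>Y \<alpha>\<close>, which is supported in the monoid along with
  \<open>\<alpha>\<close>; so the quotient of \<open>Y \<gamma>\<close> by the monomial of \<open>\<gamma>\<close> keeps its support in the monoid.\<close>

lemma supported_K_jump:
  assumes Y: "\<And>\<gamma> \<gamma>'. Y \<gamma> \<gamma>' \<noteq> 0 \<Longrightarrow> \<gamma>' - \<gamma> \<in> S" and \<alpha>: "\<alpha> \<in> S"
    and nz: "K_jump \<alpha> m Y \<gamma> \<gamma>' \<noteq> 0"
  shows "\<gamma>' - \<gamma> \<in> S"
proof -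
  have "\<gamma>' \<in> S" if "Y \<alpha> \<gamma>' \<noteq> 0" for \<gamma>'
    using add[OF Y[OF that] \<alpha>] by simp
  then have *: "supported_in S (fs_one_minus_powi (Y \<alpha>) n)" for n
    by (intro supported_one_minus_powi) (auto simp: supported_in_def)
  obtain x where x: "Y \<gamma> x \<noteq> 0" "fs_one_minus_powi (Y \<alpha>) (m * pairing \<gamma> \<alpha>) (\<gamma>' - x) \<noteq> 0"
    using fs_mult_nonzeroD nz unfolding K_jump_def by blast
  have "(x - \<gamma>) + (\<gamma>' - x) \<in> S"
    using x * Y by (intro add) (auto simp: supported_in_def)
  then show ?thesis by simp
qed

lemma supported_S_list:
  assumes "set \<alpha>s \<subseteq> S" and "\<And>\<gamma> \<gamma>'. Y \<gamma> \<gamma>' \<noteq> 0 \<Longrightarrow> \<gamma>' - \<gamma> \<in> S"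
    and "S_list \<Omega> \<alpha>s Y \<gamma> \<gamma>' \<noteq> 0"
  shows "\<gamma>' - \<gamma> \<in> S"
  using assms
proof (induction \<alpha>s arbitrary: Y)
  case (Cons \<alpha> \<alpha>s)
  show ?case
  proof (rule Cons.IH)
    show "S_list \<Omega> \<alpha>s (K_jump \<alpha> (\<Omega> \<alpha>) Y) \<gamma> \<gamma>' \<noteq> 0" using Cons.prems by (simp add: S_list_def)
    show "\<gamma>' - \<gamma> \<in> S" if "K_jump \<alpha> (\<Omega> \<alpha>) Y \<gamma> \<gamma>' \<noteq> 0" for \<gamma> \<gamma>'
      using supported_K_jump[OF _ _ that] Cons.prems by auto
  qed (use Cons.prems in auto)
qed (auto simp: S_list_def)

lemma supported_log_jump:
  assumes "set \<alpha>s \<subseteq> S"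
  shows "supported_in S (fs_log (fs_mult (S_list \<Omega> \<alpha>s fs_monom \<gamma>) (fs_monom (- \<gamma>))))"
proof (rule supported_log)
  show "supported_in S (fs_mult (S_list \<Omega> \<alpha>s fs_monom \<gamma>) (fs_monom (- \<gamma>)))"
    unfolding supported_in_def
  proof (intro allI impI)
    fix \<gamma>' assume "fs_mult (S_list \<Omega> \<alpha>s fs_monom \<gamma>) (fs_monom (- \<gamma>)) \<gamma>' \<noteq> 0"
    then obtain x where x: "S_list \<Omega> \<alpha>s fs_monom \<gamma> x \<noteq> 0" "fs_monom (- \<gamma>) (\<gamma>' - x) \<noteq> 0"
      using fs_mult_nonzeroD by blast
    have eq: "\<gamma>' - x = - \<gamma>" using x(2) by (auto simp: fs_monom_def split: if_splits)
    have "\<gamma>' = x - \<gamma>" using arg_cong[OF eq, of "\<lambda>y. y + x"] by simp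
    moreover have "x - \<gamma> \<in> S"
      by (rule supported_S_list[OF assms _ x(1)]) (auto simp: fs_monom_def zero split: if_splits)
    ultimately show "\<gamma>' \<in> S" by simp
  qed
qed

end

text \<open>Each single coefficient is computed by a finite subproduct, and finitely many charges can be listed
  in the order of their rays.\<close>

lemma log_jump_support:
  assumes S: "charge_monoid S" and gen: "{\<alpha> \<in> positive_charges U Z d. \<Omega> \<alpha> \<noteq> 0} \<subseteq> S"
    and jump: "is_log_jump U Z \<Omega> a d \<gamma> F"
    and nz: "F \<gamma>' \<noteq> 0"
  shows "\<gamma>' \<in> S"
proof -
  obtain A where A: "finite A" "A \<subseteq> {\<alpha> \<in> positive_charges U Z d. \<Omega> \<alpha> \<noteq> 0}"
    "\<And>\<alpha>s. distinct \<alpha>s \<Longrightarrow> set \<alpha>s = A \<Longrightarrow> ccw_ordered Z a d \<alpha>s \<Longrightarrow>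
      fs_log (fs_mult (S_list \<Omega> \<alpha>s fs_monom \<gamma>) (fs_monom (- \<gamma>))) \<gamma>' = F \<gamma>'"
    using jump unfolding is_log_jump_def eventually_finite_subsets_at_top
    by (metis (no_types, lifting) order_refl)
  obtain xs where xs: "set xs = A" "distinct xs" using finite_distinct_list[OF A(1)] by blast
  define ys where "ys = sort_key (\<lambda>\<alpha>. Arg (- Z \<alpha> a / d)) xs"
  have ys: "set ys = A" "distinct ys" using xs by (auto simp: ys_def)
  have "sorted (map (\<lambda>\<alpha>. Arg (- Z \<alpha> a / d)) ys)" by (simp add: ys_def)
  then have "ccw_ordered Z a d ys" unfolding ccw_ordered_def by (simp add: sorted_wrt_map)
  then have "fs_log (fs_mult (S_list \<Omega> ys fs_monom \<gamma>) (fs_monom (- \<gamma>))) \<gamma>' \<noteq> 0"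
    using A(3) ys nz by auto
  then show ?thesis
    using charge_monoid.supported_log_jump[OF S, of ys \<Omega> \<gamma>] ys A(2) gen
    by (auto simp: supported_in_def)
qed

context rh_data begin

lemma Z_zero: "a \<in> U \<Longrightarrow> Z 0 a = 0"
  using Z_add[of a 0 0] by simp

lemma Z_uminus: "a \<in> U \<Longrightarrow> Z (- \<gamma>) a = - Z \<gamma> a"
  using Z_add[of a \<gamma> "- \<gamma>"] Z_zero by (simp add: eq_neg_iff_add_eq_0 add.commute)

lemma Z_int_multiple:
  assumes "a \<in> U"
  shows "Z (m * fst \<gamma>, m * snd \<gamma>) a = of_int m * Z \<gamma> a"
proof (induction m rule: int_induct[of _ 0])
  case base then show ?case using Z_zero[OF assms] by (simp add: zero_prod_def)
next
  case (step1 i)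
  have "Z ((i * fst \<gamma>, i * snd \<gamma>) + \<gamma>) a = Z (i * fst \<gamma>, i * snd \<gamma>) a + Z \<gamma> a"
    using Z_add[OF assms] .
  moreover have "(i * fst \<gamma>, i * snd \<gamma>) + \<gamma> = ((i + 1) * fst \<gamma>, (i + 1) * snd \<gamma>)"
    by (simp add: prod_eq_iff algebra_simps)
  ultimately show ?case using step1 by (simp add: algebra_simps)
next
  case (step2 i)
  have "Z ((i * fst \<gamma>, i * snd \<gamma>) + - \<gamma>) a = Z (i * fst \<gamma>, i * snd \<gamma>) a + Z (- \<gamma>) a"
    using Z_add[OF assms] .
  moreover have "(i * fst \<gamma>, i * snd \<gamma>) + - \<gamma> = ((i - 1) * fst \<gamma>, (i - 1) * snd \<gamma>)"
    by (simp add: prod_eq_iff algebra_simps)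
  ultimately show ?case using step2 Z_uminus[OF assms] by (simp add: algebra_simps)
qed

lemma Z_linear:
  assumes "a \<in> U"
  shows "Z \<gamma> a = of_int (fst \<gamma>) * Z gamma1 a + of_int (snd \<gamma>) * Z gamma2 a"
proof -
  have "\<gamma> = (fst \<gamma> * fst gamma1, fst \<gamma> * snd gamma1) + (snd \<gamma> * fst gamma2, snd \<gamma> * snd gamma2)"
    by (simp add: gamma1_def gamma2_def)
  then show ?thesis
    by (metis Z_add[OF assms] Z_int_multiple[OF assms])
qed

text \<open>Pairing with the basis charges reads off the coordinates of a charge.\<close>

lemma charge_size_le_nrm:
  "real_of_int \<bar>fst \<gamma>\<bar> + real_of_int \<bar>snd \<gamma>\<bar> \<le> (nrm gamma1 + nrm gamma2) * nrm \<gamma>"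
proof -
  have "real_of_int \<bar>fst \<gamma>\<bar> \<le> nrm \<gamma> * nrm gamma2"
    using nrm_pairing[of \<gamma> gamma2] by (simp add: pairing_def gamma2_def)
  moreover have "real_of_int \<bar>snd \<gamma>\<bar> \<le> nrm \<gamma> * nrm gamma1"
    using nrm_pairing[of \<gamma> gamma1] by (simp add: pairing_def gamma1_def)
  ultimately show ?thesis by (simp add: algebra_simps)
qed

lemma positive_chargesD:
  assumes "\<gamma> \<in> positive_charges U Z d" "a \<in> U"
  shows "Re (Z \<gamma> a * cnj d) < 0"
proof -
  have "- (of_real 1 * Z \<gamma> a) \<in> bps_ray Z \<gamma> a" unfolding bps_ray_def using zero_less_one by blast
  then have "- Z \<gamma> a \<in> acute_plane d" using assms by (auto simp: positive_charges_def)
  then show ?thesis by (simp add: acute_plane_def)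
qed

lemma zero_not_positive: "0 \<notin> positive_charges U Z d"
  using positive_chargesD[of 0 d 0] U(2) Z_zero by auto

text \<open>The quantity \<open>- Re (Z\<^sub>\<gamma> \<cdot> cnj d)\<close> is additive in \<open>\<gamma>\<close>, while \<open>\<bar>Z\<^sub>\<gamma>\<bar>\<close> and the norm of \<open>\<gamma>\<close> are subadditive.
  That the first dominates multiples of the other two therefore passes from the charges with
  \<open>\<Omega>(\<gamma>) \<noteq> 0\<close> to the monoid generated by them. The bound below by \<open>z\<^sub>0\<close> expresses that the coordinates are integers.\<close>

theorem active_charge_bounds:
  "\<exists>\<epsilon> C z\<^sub>0. 0 < \<epsilon> \<and> 0 < C \<and> 0 < z\<^sub>0 \<and>
     (\<forall>d\<in>{\<rho>, - \<rho>}. \<forall>\<gamma> \<gamma>'. \<forall>a\<in>U. \<gamma>' \<in> positive_charges U Z d \<longrightarrow> f \<gamma> \<gamma>' \<noteq> 0 \<longrightarrow>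
        Re (Z \<gamma>' a * cnj d) \<le> - \<epsilon> * cmod d * cmod (Z \<gamma>' a) \<and>
        real_of_int \<bar>fst \<gamma>'\<bar> + real_of_int \<bar>snd \<gamma>'\<bar> \<le> C * cmod (Z \<gamma>' a) \<and>
        z\<^sub>0 \<le> cmod (Z \<gamma>' a))"
proof -
  obtain \<epsilon> where \<epsilon>: "\<epsilon> > 0"
    "\<And>a \<gamma>. a \<in> U \<Longrightarrow> \<Omega> \<gamma> \<noteq> 0 \<Longrightarrow> \<bar>Re (Z \<gamma> a * cnj \<rho>)\<bar> \<ge> \<epsilon> * cmod (Z \<gamma> a) * cmod \<rho>"
    using admissible by blast
  define N where "N = nrm gamma1 + nrm gamma2"
  have N: "N > 0" using nrm_nonneg nrm_eq_0
    by (simp add: N_def gamma1_def gamma2_def order_less_le add_nonneg_eq_0_iff zero_prod_def)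
  define C where "C = N / (\<epsilon> * \<kappa>)"
  define S where "S d = {\<gamma>. \<forall>a\<in>U. \<epsilon> * cmod d * cmod (Z \<gamma> a) \<le> - Re (Z \<gamma> a * cnj d)
    \<and> \<epsilon> * cmod d * \<kappa> * nrm \<gamma> \<le> - Re (Z \<gamma> a * cnj d)}" for d
  have mono: "charge_monoid (S d)" for d
  proof
    have "nrm 0 = 0" using nrm_eq_0 by blast
    then show "0 \<in> S d" using Z_zero by (simp add: S_def)
  next
    fix x y assume x: "x \<in> S d" and y: "y \<in> S d"
    show "x + y \<in> S d" unfolding S_def
    proof (intro CollectI ballI)
      fix a assume a: "a \<in> U"
      have *: "Re (Z (x + y) a * cnj d) = Re (Z x a * cnj d) + Re (Z y a * cnj d)"
        by (simp add: Z_add[OF a] algebra_simps)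
      have "\<epsilon> * cmod d * cmod (Z (x + y) a) \<le> \<epsilon> * cmod d * (cmod (Z x a) + cmod (Z y a))"
        by (intro mult_left_mono) (use \<epsilon> in \<open>auto simp: Z_add[OF a] norm_triangle_ineq\<close>)
      moreover have "\<epsilon> * cmod d * \<kappa> * nrm (x + y) \<le> \<epsilon> * cmod d * \<kappa> * (nrm x + nrm y)"
        by (intro mult_left_mono nrm_triangle) (use \<epsilon> \<kappa>_pos in auto)
      ultimately show "\<epsilon> * cmod d * cmod (Z (x + y) a) \<le> - Re (Z (x + y) a * cnj d)
        \<and> \<epsilon> * cmod d * \<kappa> * nrm (x + y) \<le> - Re (Z (x + y) a * cnj d)"
        using x y a unfolding S_def * by (force simp: distrib_left)
    qed
  qed
  have gen: "{\<alpha> \<in> positive_charges U Z d. \<Omega> \<alpha> \<noteq> 0} \<subseteq> S d" if d: "d \<in> {\<rho>, - \<rho>}" for d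
  proof
    fix \<alpha> assume \<alpha>: "\<alpha> \<in> {\<alpha> \<in> positive_charges U Z d. \<Omega> \<alpha> \<noteq> 0}"
    show "\<alpha> \<in> S d" unfolding S_def
    proof (intro CollectI ballI)
      fix a assume a: "a \<in> U"
      have neg: "Re (Z \<alpha> a * cnj d) < 0" using positive_chargesD \<alpha> a by blast
      have 1: "\<epsilon> * cmod (Z \<alpha> a) * cmod \<rho> \<le> \<bar>Re (Z \<alpha> a * cnj \<rho>)\<bar>" using \<epsilon> a \<alpha> by blast
      have "\<bar>Re (Z \<alpha> a * cnj \<rho>)\<bar> = - Re (Z \<alpha> a * cnj d)" "cmod \<rho> = cmod d" using neg d by auto
      then have 2: "\<epsilon> * cmod d * cmod (Z \<alpha> a) \<le> - Re (Z \<alpha> a * cnj d)" using 1 by (simp add: mult_ac)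
      have k: "cmod (Z \<alpha> a) / nrm \<alpha> > \<kappa>" using support_property a \<alpha> by blast
      have "nrm \<alpha> \<noteq> 0" using k \<kappa>_pos by auto
      then have "nrm \<alpha> > 0" using nrm_nonneg[of \<alpha>] by simp
      then have "\<kappa> * nrm \<alpha> \<le> cmod (Z \<alpha> a)" using k by (simp add: field_simps)
      then have "\<epsilon> * cmod d * (\<kappa> * nrm \<alpha>) \<le> \<epsilon> * cmod d * cmod (Z \<alpha> a)"
        by (intro mult_left_mono) (use \<epsilon> in auto)
      then show "\<epsilon> * cmod d * cmod (Z \<alpha> a) \<le> - Re (Z \<alpha> a * cnj d)
        \<and> \<epsilon> * cmod d * \<kappa> * nrm \<alpha> \<le> - Re (Z \<alpha> a * cnj d)" using 2 by (simp add: mult_ac)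
    qed
  qed
  show ?thesis
  proof (intro exI conjI ballI allI impI)
    show "0 < \<epsilon>" by fact
    show C: "0 < C" using N \<epsilon> \<kappa>_pos by (simp add: C_def)
    show "0 < 1 / C" using C by simp
    fix d \<gamma> \<gamma>' a
    assume d: "d \<in> {\<rho>, - \<rho>}" and a: "a \<in> U" and pos: "\<gamma>' \<in> positive_charges U Z d"
      and nz: "f \<gamma> \<gamma>' \<noteq> 0"
    have jump: "is_log_jump U Z \<Omega> a\<^sub>0 d \<gamma>
          (\<lambda>\<gamma>'. if \<gamma>' \<in> positive_charges U Z d then f \<gamma> \<gamma>' else 0)"
      using f_plus[of \<gamma>] f_minus[of \<gamma>] d by auto
    have "\<gamma>' \<in> S d" by (rule log_jump_support[OF mono gen[OF d] jump]) (use pos nz in auto)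
    then have S1: "\<epsilon> * cmod d * cmod (Z \<gamma>' a) \<le> - Re (Z \<gamma>' a * cnj d)"
      and S2: "\<epsilon> * cmod d * \<kappa> * nrm \<gamma>' \<le> - Re (Z \<gamma>' a * cnj d)" using a by (auto simp: S_def)
    show "Re (Z \<gamma>' a * cnj d) \<le> - \<epsilon> * cmod d * cmod (Z \<gamma>' a)" using S1 by simp
    have d0: "cmod d > 0" using d \<rho>_nonzero by auto
    have "- Re (Z \<gamma>' a * cnj d) \<le> cmod (Z \<gamma>' a) * cmod d"
      using abs_Re_le_cmod[of "Z \<gamma>' a * cnj d"] by (simp add: norm_mult)
    then have "cmod d * (\<epsilon> * \<kappa> * nrm \<gamma>') \<le> cmod d * cmod (Z \<gamma>' a)" using S2 by (simp add: mult_ac)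
    then have n: "\<epsilon> * \<kappa> * nrm \<gamma>' \<le> cmod (Z \<gamma>' a)" using d0 by simp
    have "real_of_int \<bar>fst \<gamma>'\<bar> + real_of_int \<bar>snd \<gamma>'\<bar> \<le> N * nrm \<gamma>'"
      using charge_size_le_nrm by (simp add: N_def)
    also have "\<dots> = C * (\<epsilon> * \<kappa> * nrm \<gamma>')" using \<epsilon> \<kappa>_pos by (simp add: C_def)
    also have "\<dots> \<le> C * cmod (Z \<gamma>' a)" by (rule mult_left_mono[OF n]) (use C in simp)
    finally show 3: "real_of_int \<bar>fst \<gamma>'\<bar> + real_of_int \<bar>snd \<gamma>'\<bar> \<le> C * cmod (Z \<gamma>' a)" .
    have "\<gamma>' \<noteq> 0" using pos zero_not_positive by metis
    then have "\<bar>fst \<gamma>'\<bar> + \<bar>snd \<gamma>'\<bar> \<ge> 1" by (cases \<gamma>') (auto simp: zero_prod_def)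
    then have "real_of_int \<bar>fst \<gamma>'\<bar> + real_of_int \<bar>snd \<gamma>'\<bar> \<ge> 1" by linarith
    then show "1 / C \<le> cmod (Z \<gamma>' a)" using 3 C by (simp add: field_simps)
  qed
qed

text \<open>The growth hypothesis, with the exponent \<open>L = c R - \<delta>\<close> as the large parameter.\<close>

lemma active_sum_small:
  assumes "\<tau> > 0"
  shows "\<exists>L\<^sub>0. \<forall>L\<ge>L\<^sub>0. \<forall>d\<in>{\<rho>, - \<rho>}. \<forall>\<gamma>\<in>{gamma1, gamma2}. \<forall>a\<in>U.
     (\<lambda>\<gamma>'. \<bar>real_of_rat (f \<gamma> \<gamma>')\<bar> * exp (- L * cmod (Z \<gamma>' a))) summable_on positive_charges U Z d \<and>
     (\<Sum>\<^sub>\<infinity>\<gamma>'\<in>positive_charges U Z d. \<bar>real_of_rat (f \<gamma> \<gamma>')\<bar> * exp (- L * cmod (Z \<gamma>' a))) \<le> \<tau>"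
proof -
  have "\<exists>L\<^sub>0. \<forall>L\<ge>L\<^sub>0. \<forall>d\<in>{\<rho>, - \<rho>}. \<forall>a\<in>U.
     (\<lambda>\<gamma>'. \<bar>real_of_rat (f \<gamma> \<gamma>')\<bar> * exp (- L * cmod (Z \<gamma>' a))) summable_on positive_charges U Z d \<and>
     (\<Sum>\<^sub>\<infinity>\<gamma>'\<in>positive_charges U Z d. \<bar>real_of_rat (f \<gamma> \<gamma>')\<bar> * exp (- L * cmod (Z \<gamma>' a))) \<le> \<tau>"
    if \<gamma>: "\<gamma> \<in> {gamma1, gamma2}" for \<gamma>
  proof -
    define A where "A = positive_charges U Z \<rho> \<union> positive_charges U Z (- \<rho>)"
    obtain R\<^sub>0 where R\<^sub>0: "\<And>R a. R \<ge> R\<^sub>0 \<Longrightarrow> a \<in> U \<Longrightarrow>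
       (\<lambda>\<gamma>'. \<bar>real_of_rat (f \<gamma> \<gamma>')\<bar> * exp ((- c * R + \<delta>) * cmod (Z \<gamma>' a))) summable_on A \<and>
       (\<Sum>\<^sub>\<infinity>\<gamma>'\<in>A. \<bar>real_of_rat (f \<gamma> \<gamma>')\<bar> * exp ((- c * R + \<delta>) * cmod (Z \<gamma>' a))) < \<tau>"
      using growth[OF \<gamma> assms] unfolding A_def by blast
    show ?thesis
    proof (intro exI allI impI ballI)
      fix L d a assume L: "L \<ge> c * R\<^sub>0 - \<delta>" and d: "d \<in> {\<rho>, - \<rho>}" and a: "a \<in> U"
      define g where "g \<gamma>' = \<bar>real_of_rat (f \<gamma> \<gamma>')\<bar> * exp (- L * cmod (Z \<gamma>' a))" for \<gamma>'
      have "- c * ((L + \<delta>) / c) + \<delta> = - L" using c_pos by simp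
      moreover have "(L + \<delta>) / c \<ge> R\<^sub>0" using L c_pos by (simp add: field_simps)
      ultimately have *: "g summable_on A" "infsum g A < \<tau>"
        using R\<^sub>0[of "(L + \<delta>) / c" a] a unfolding g_def by auto
      have sub: "positive_charges U Z d \<subseteq> A" using d by (auto simp: A_def)
      have s: "g summable_on positive_charges U Z d" by (rule summable_on_subset_banach[OF *(1) sub])
      have "infsum g (positive_charges U Z d) \<le> infsum g A"
        by (rule infsum_mono_neutral[OF s *(1)]) (use sub in \<open>auto simp: g_def\<close>)
      then show "g summable_on positive_charges U Z d \<and> infsum g (positive_charges U Z d) \<le> \<tau>"
        using s * by linarith
    qed
  qed
  from this[of gamma1] this[of gamma2] obtain L1 L2 where
    "\<forall>L\<ge>L1. \<forall>d\<in>{\<rho>, - \<rho>}. \<forall>a\<in>U.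
     (\<lambda>\<gamma>'. \<bar>real_of_rat (f gamma1 \<gamma>')\<bar> * exp (- L * cmod (Z \<gamma>' a))) summable_on positive_charges U Z d \<and>
     (\<Sum>\<^sub>\<infinity>\<gamma>'\<in>positive_charges U Z d. \<bar>real_of_rat (f gamma1 \<gamma>')\<bar> * exp (- L * cmod (Z \<gamma>' a))) \<le> \<tau>"
    "\<forall>L\<ge>L2. \<forall>d\<in>{\<rho>, - \<rho>}. \<forall>a\<in>U.
     (\<lambda>\<gamma>'. \<bar>real_of_rat (f gamma2 \<gamma>')\<bar> * exp (- L * cmod (Z \<gamma>' a))) summable_on positive_charges U Z d \<and>
     (\<Sum>\<^sub>\<infinity>\<gamma>'\<in>positive_charges U Z d. \<bar>real_of_rat (f gamma2 \<gamma>')\<bar> * exp (- L * cmod (Z \<gamma>' a))) \<le> \<tau>"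
    by auto
  then show ?thesis by (intro exI[of _ "max L1 L2"]) auto
qed

end

section \<open>Functions holomorphic along complex lines\<close>

lemma norm_cvec_smult: "norm (z *s v) = cmod z * norm v" for v :: "complex ^ 'n"
  by (simp add: norm_vec_def L2_set_right_distrib vector_scalar_mult_def norm_mult)

lemma continuous_on_complex_line [continuous_intros]:
  fixes p v :: "complex ^ 'n"
  assumes "continuous_on S g"
  shows "continuous_on S (\<lambda>x. p + g x *s v)"
  unfolding vector_scalar_mult_def by (intro continuous_intros assms)

lemma open_complex_slice:
  fixes p v :: "complex ^ 'n"
  assumes "open P" shows "open {z. p + z *s v \<in> P}"
proof -
  have "continuous_on UNIV (\<lambda>z. p + z *s v)" by (intro continuous_intros)
  from open_vimage[OF assms this] show ?thesis by (simp add: vimage_def)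
qed

text \<open>Continuity and holomorphy on all complex lines together amount to holomorphy in several variables.
  In this form each closure property is a statement about one complex variable, applied along a line.\<close>

definition line_holo :: "(complex ^ 'n) set \<Rightarrow> (complex ^ 'n \<Rightarrow> complex) \<Rightarrow> bool" where
  "line_holo P G \<longleftrightarrow> continuous_on P G \<and>
     (\<forall>p\<in>P. \<forall>v. (\<lambda>z. G (p + z *s v)) field_differentiable (at 0))"

definition line_deriv :: "(complex ^ 'n \<Rightarrow> complex) \<Rightarrow> complex ^ 'n \<Rightarrow> complex ^ 'n \<Rightarrow> complex" where
  "line_deriv G v p = deriv (\<lambda>z. G (p + z *s v)) 0"

text \<open>Differentiability is required at the base point of each line only, but every point of a line is the
  base point of a parallel parametrization.\<close>

lemma line_holo_slice:
  fixes P :: "(complex ^ 'n) set"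
  assumes "open P" "line_holo P G"
  shows "(\<lambda>z. G (p + z *s v)) holomorphic_on {z. p + z *s v \<in> P}"
proof -
  have "(\<lambda>z. G (p + z *s v)) field_differentiable at w" if "p + w *s v \<in> P" for w
  proof -
    have "(\<lambda>z. G ((p + w *s v) + z *s v)) field_differentiable at (w - w)"
      using assms(2) that by (simp add: line_holo_def)
    moreover have "(\<lambda>z. z - w) field_differentiable at w" by (intro derivative_intros)
    ultimately have "(\<lambda>z. G ((p + w *s v) + z *s v)) \<circ> (\<lambda>z. z - w) field_differentiable at w"
      by (intro field_differentiable_compose)
    moreover have "(p + w *s v) + (z - w) *s v = p + z *s v" for z
      by (simp add: vec_eq_iff algebra_simps)
    ultimately show ?thesis by (simp add: o_def)
  qed
  then show ?thesis
    using open_complex_slice[OF assms(1), of p v] by (auto simp: holomorphic_on_open field_differentiable_def)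
qed

lemma line_holoI:
  fixes P :: "(complex ^ 'n) set"
  assumes "continuous_on P G"
    and "\<And>p v. p \<in> P \<Longrightarrow> \<exists>r>0. (\<lambda>z. G (p + z *s v)) holomorphic_on ball 0 r"
  shows "line_holo P G"
  unfolding line_holo_def
proof (intro conjI ballI allI)
  fix p v assume "p \<in> P"
  then obtain r where r: "r > 0" "(\<lambda>z. G (p + z *s v)) holomorphic_on ball 0 r" using assms by blast
  then show "(\<lambda>z. G (p + z *s v)) field_differentiable (at 0)"
    by (meson centre_in_ball holomorphic_on_imp_differentiable_at open_ball)
qed fact

lemma line_holo_cball:
  fixes P :: "(complex ^ 'n) set"
  assumes "open P" "p \<in> P"
  obtains r where "r > 0" "\<And>z. z \<in> cball 0 r \<Longrightarrow> p + z *s v \<in> P"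
proof -
  have "0 \<in> {z. p + z *s v \<in> P}" using assms by simp
  then obtain r where "r > 0" "cball 0 r \<subseteq> {z. p + z *s v \<in> P}"
    using open_complex_slice[OF assms(1)] open_contains_cball by metis
  then show ?thesis using that by blast
qed

lemma line_holo_subset:
  assumes "line_holo P G" "N \<subseteq> P" shows "line_holo N G"
  using assms continuous_on_subset unfolding line_holo_def by blast

lemma line_holo_uniform_limit:
  fixes P :: "(complex ^ 'n) set"
  assumes "open P" "F \<noteq> bot"
    and loc: "\<And>p. p \<in> P \<Longrightarrow> \<exists>N. open N \<and> p \<in> N \<and> (\<forall>\<^sub>F n in F. line_holo N (H n)) \<and> uniform_limit N H G F"
  shows "line_holo P G"
proof (rule line_holoI)
  show "continuous_on P G"
  proof (rule continuous_at_imp_continuous_on, rule ballI)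
    fix p assume "p \<in> P"
    then obtain N where N: "open N" "p \<in> N" "\<forall>\<^sub>F n in F. line_holo N (H n)" "uniform_limit N H G F"
      using loc by blast
    have "continuous_on N G"
      by (rule uniform_limit_theorem[OF _ N(4) assms(2)])
         (use N(3) in eventually_elim, simp add: line_holo_def)
    then show "isCont G p" using N continuous_on_eq_continuous_at by blast
  qed
next
  fix p v assume "p \<in> P"
  then obtain N where N: "open N" "p \<in> N" "\<forall>\<^sub>F n in F. line_holo N (H n)" "uniform_limit N H G F"
    using loc by blast
  obtain r where r: "r > 0" "\<And>z. z \<in> cball 0 r \<Longrightarrow> p + z *s v \<in> N"
    using line_holo_cball[OF N(1,2)] by metis
  have ul: "uniform_limit (cball 0 r) (\<lambda>n z. H n (p + z *s v)) (\<lambda>z. G (p + z *s v)) F"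
  proof (rule uniform_limitI)
    fix e :: real assume "e > 0"
    from uniform_limitD[OF N(4) this]
    show "\<forall>\<^sub>F n in F. \<forall>z\<in>cball 0 r. dist (H n (p + z *s v)) (G (p + z *s v)) < e"
      by eventually_elim (use r(2) in blast)
  qed
  have ev: "\<forall>\<^sub>F n in F. continuous_on (cball 0 r) (\<lambda>z. H n (p + z *s v)) \<and>
      (\<lambda>z. H n (p + z *s v)) holomorphic_on ball 0 r"
    using N(3)
  proof eventually_elim
    case (elim n)
    have "(\<lambda>z. H n (p + z *s v)) holomorphic_on cball 0 r"
      using line_holo_slice[OF N(1) elim] by (rule holomorphic_on_subset) (use r in auto)
    then show ?case
      by (meson ball_subset_cball holomorphic_on_imp_continuous_on holomorphic_on_subset)
  qed
  have "(\<lambda>z. G (p + z *s v)) holomorphic_on ball 0 r"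
    by (rule holomorphic_uniform_limit[OF ev ul assms(2)])
  then show "\<exists>r>0. (\<lambda>z. G (p + z *s v)) holomorphic_on ball 0 r" using r by blast
qed

lemma line_holo_const: "line_holo P (\<lambda>_. c)"
  by (simp add: line_holo_def)

lemma line_holo_add: "line_holo P F \<Longrightarrow> line_holo P G \<Longrightarrow> line_holo P (\<lambda>p. F p + G p)"
  by (auto simp: line_holo_def intro!: continuous_intros field_differentiable_add)

lemma line_holo_diff: "line_holo P F \<Longrightarrow> line_holo P G \<Longrightarrow> line_holo P (\<lambda>p. F p - G p)"
  by (auto simp: line_holo_def intro!: continuous_intros field_differentiable_diff)

lemma line_holo_mult: "line_holo P F \<Longrightarrow> line_holo P G \<Longrightarrow> line_holo P (\<lambda>p. F p * G p)"
  by (auto simp: line_holo_def intro!: continuous_intros field_differentiable_mult)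

lemma line_holo_sum:
  assumes "\<And>i. i \<in> I \<Longrightarrow> line_holo P (F i)" shows "line_holo P (\<lambda>p. \<Sum>i\<in>I. F i p)"
  using assms by (induction I rule: infinite_finite_induct) (auto intro: line_holo_const line_holo_add)

lemma line_holo_exp:
  assumes "line_holo P F" shows "line_holo P (\<lambda>p. exp (F p))"
  unfolding line_holo_def
proof (intro conjI ballI allI)
  show "continuous_on P (\<lambda>p. exp (F p))" using assms by (auto simp: line_holo_def intro!: continuous_intros)
  fix p v assume "p \<in> P"
  then have "(\<lambda>z. F (p + z *s v)) field_differentiable (at 0)" using assms by (simp add: line_holo_def)
  from field_differentiable_compose[OF this, of exp]
  show "(\<lambda>z. exp (F (p + z *s v))) field_differentiable (at 0)"
    by (simp add: o_def field_differentiable_within_exp)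
qed

lemma line_holo_coord:
  fixes P :: "(complex ^ 'n) set"
  assumes "open U" "h holomorphic_on U" "\<And>p. p \<in> P \<Longrightarrow> p $ i \<in> U"
  shows "line_holo P (\<lambda>p. h (p $ i))"
  unfolding line_holo_def
proof (intro conjI ballI allI)
  show "continuous_on P (\<lambda>p. h (p $ i))"
    by (rule continuous_on_compose2[OF holomorphic_on_imp_continuous_on[OF assms(2)]])
       (use assms in \<open>auto intro!: continuous_intros\<close>)
  fix p v assume "p \<in> P"
  then have "h field_differentiable (at (p $ i))" using assms holomorphic_on_imp_differentiable_at by blast
  moreover have "(\<lambda>z. p $ i + z * v $ i) field_differentiable (at 0)" by (intro derivative_intros)
  ultimately show "(\<lambda>z. h ((p + z *s v) $ i)) field_differentiable (at 0)"
    using field_differentiable_compose[of "\<lambda>z. p $ i + z * v $ i" 0 h] by (simp add: o_def)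
qed

text \<open>By Cauchy's inequality, a majorant of the integrand is up to a factor a majorant of its difference
  quotients, so that dominated convergence differentiates under the integral sign.\<close>

lemma holomorphic_lebesgue_integral:
  fixes h :: "complex \<Rightarrow> 'm \<Rightarrow> complex"
  assumes S: "open S"
    and meas: "\<And>z. z \<in> S \<Longrightarrow> h z \<in> borel_measurable M"
    and holo: "\<And>t. t \<in> space M \<Longrightarrow> (\<lambda>z. h z t) holomorphic_on S"
    and bound: "\<And>z t. z \<in> S \<Longrightarrow> t \<in> space M \<Longrightarrow> norm (h z t) \<le> g t"
    and g: "integrable M g"
  shows "(\<lambda>z. \<integral>t. h z t \<partial>M) holomorphic_on S"
proof -
  have int: "integrable M (h z)" if "z \<in> S" for z
    by (rule Bochner_Integration.integrable_bound[OF g meas[OF that]], rule AE_I2)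
       (use bound[OF that] in force)
  have "\<exists>D. ((\<lambda>z. \<integral>t. h z t \<partial>M) has_field_derivative D) (at z0)" if z0: "z0 \<in> S" for z0
  proof -
    obtain e where "e > 0" "cball z0 e \<subseteq> S" using S z0 open_contains_cball by blast
    then obtain r where r: "r > 0" "cball z0 (2 * r) \<subseteq> S" using that[of "e / 2"] by simp
    define B where "B = ball z0 r"
    have B: "open B" "z0 \<in> B" "B \<subseteq> S" using r by (auto simp: B_def)
    have der_bound: "norm (deriv (\<lambda>z. h z t) w) \<le> g t / r" if "w \<in> B" "t \<in> space M" for w t
    proof -
      have sub: "cball w r \<subseteq> S"
      proof
        fix x assume "x \<in> cball w r"
        then have "dist z0 x \<le> 2 * r" using that dist_triangle[of z0 x w] by (simp add: B_def)
        then show "x \<in> S" using r by auto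
      qed
      have "norm ((deriv ^^ 1) (\<lambda>z. h z t) w) \<le> fact 1 * g t / r ^ 1"
      proof (rule Cauchy_inequality)
        show "(\<lambda>z. h z t) holomorphic_on ball w r"
          by (rule holomorphic_on_subset[OF holo[OF that(2)]]) (use sub in auto)
        show "continuous_on (cball w r) (\<lambda>z. h z t)"
          by (intro holomorphic_on_imp_continuous_on holomorphic_on_subset[OF holo[OF that(2)]] sub)
        show "norm (h x t) \<le> g t" if "norm (w - x) = r" for x
          by (rule bound) (use sub that \<open>t \<in> space M\<close> in \<open>auto simp: dist_norm\<close>)
      qed (use r in auto)
      then show ?thesis by simp
    qed
    have lip: "norm (h z t - h z0 t) \<le> g t / r * norm (z - z0)" if "z \<in> B" "t \<in> space M" for z t
    proof (rule field_differentiable_bound[of B _ "deriv (\<lambda>z. h z t)"])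
      show "convex B" by (simp add: B_def)
      fix w assume "w \<in> B"
      then have "w \<in> S" using B by blast
      then show "((\<lambda>z. h z t) has_field_derivative deriv (\<lambda>z. h z t) w) (at w within B)"
        by (rule holomorphic_derivI[OF holo[OF that(2)] S])
      show "norm (deriv (\<lambda>z. h z t) w) \<le> g t / r" using der_bound \<open>w \<in> B\<close> that by blast
    qed (use that B in auto)
    have "((\<lambda>z. ((\<integral>t. h z t \<partial>M) - (\<integral>t. h z0 t \<partial>M)) / (z - z0)) \<longlongrightarrow>
        (\<integral>t. deriv (\<lambda>z. h z t) z0 \<partial>M)) (at z0 within B)"
      unfolding tendsto_at_iff_sequentially
    proof (intro allI impI)
      fix X :: "nat \<Rightarrow> complex" assume X: "\<forall>i. X i \<in> B - {z0}" "X \<longlonglongrightarrow> z0"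
      have XS: "X i \<in> S" for i using X B by blast
      have eq: "((\<integral>t. h (X i) t \<partial>M) - (\<integral>t. h z0 t \<partial>M)) / (X i - z0)
          = (\<integral>t. (h (X i) t - h z0 t) / (X i - z0) \<partial>M)" for i
        using int[OF XS] int[OF z0] by simp
      have lim: "(\<lambda>i. (h (X i) t - h z0 t) / (X i - z0)) \<longlonglongrightarrow> deriv (\<lambda>z. h z t) z0"
        if "t \<in> space M" for t
      proof -
        have "((\<lambda>z. (h z t - h z0 t) / (z - z0)) \<longlongrightarrow> deriv (\<lambda>z. h z t) z0) (at z0)"
          using holomorphic_derivI[OF holo[OF that] S z0] by (simp add: has_field_derivative_iff)
        moreover have "filterlim X (at z0) sequentially"
          using X by (auto simp: filterlim_at)
        ultimately show ?thesis by (rule filterlim_compose)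
      qed
      have ms: "(\<lambda>t. (h (X i) t - h z0 t) / (X i - z0)) \<in> borel_measurable M" for i
        using meas[OF XS] meas[OF z0] by measurable
      have "(\<lambda>i. \<integral>t. (h (X i) t - h z0 t) / (X i - z0) \<partial>M) \<longlonglongrightarrow> (\<integral>t. deriv (\<lambda>z. h z t) z0 \<partial>M)"
      proof (rule integral_dominated_convergence)
        show "(\<lambda>t. deriv (\<lambda>z. h z t) z0) \<in> borel_measurable M"
          by (rule borel_measurable_LIMSEQ_metric[OF ms lim])
        show "integrable M (\<lambda>t. g t / r)" using g by simp
        show "AE t in M. norm ((h (X i) t - h z0 t) / (X i - z0)) \<le> g t / r" for i
        proof (rule AE_I2)
          fix t assume t: "t \<in> space M"
          have "norm (X i - z0) > 0" using X by simp
          then show "norm ((h (X i) t - h z0 t) / (X i - z0)) \<le> g t / r"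
            using lip[of "X i" t] X t by (simp add: norm_divide field_simps)
        qed
      qed (use ms lim in auto)
      then show "((\<lambda>z. ((\<integral>t. h z t \<partial>M) - (\<integral>t. h z0 t \<partial>M)) / (z - z0)) \<circ> X)
          \<longlonglongrightarrow> (\<integral>t. deriv (\<lambda>z. h z t) z0 \<partial>M)"
        unfolding o_def eq .
    qed
    moreover have "at z0 within B = at z0" using at_within_open[OF B(2,1)] .
    ultimately have "((\<lambda>z. \<integral>t. h z t \<partial>M) has_field_derivative (\<integral>t. deriv (\<lambda>z. h z t) z0 \<partial>M)) (at z0)"
      by (simp only: has_field_derivative_iff)
    then show ?thesis by blast
  qed
  then show ?thesis by (simp add: holomorphic_on_open[OF S])
qed

lemma continuous_on_lebesgue_integral:
  fixes h :: "'a::metric_space \<Rightarrow> 'm \<Rightarrow> 'b::{banach,second_countable_topology}"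
  assumes meas: "\<And>x. x \<in> S \<Longrightarrow> h x \<in> borel_measurable M"
    and cont: "\<And>t. t \<in> space M \<Longrightarrow> continuous_on S (\<lambda>x. h x t)"
    and bound: "\<And>x t. x \<in> S \<Longrightarrow> t \<in> space M \<Longrightarrow> norm (h x t) \<le> g t"
    and g: "integrable M g"
  shows "continuous_on S (\<lambda>x. \<integral>t. h x t \<partial>M)"
  unfolding continuous_on_sequentially
proof (intro allI ballI impI)
  fix X a assume a: "a \<in> S" and X: "(\<forall>n. X n \<in> S) \<and> X \<longlonglongrightarrow> a"
  show "((\<lambda>x. \<integral>t. h x t \<partial>M) \<circ> X) \<longlonglongrightarrow> (\<integral>t. h a t \<partial>M)"
    unfolding o_def
  proof (rule integral_dominated_convergence[OF _ _ g])
    show "AE t in M. (\<lambda>i. h (X i) t) \<longlonglongrightarrow> h a t"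
    proof (rule AE_I2)
      fix t assume "t \<in> space M"
      from cont[OF this] show "(\<lambda>i. h (X i) t) \<longlonglongrightarrow> h a t"
        unfolding continuous_on_sequentially using a X by (auto simp: o_def)
    qed
  qed (use meas bound a X in auto)
qed

lemma line_holo_integral:
  fixes P :: "(complex ^ 'n) set"
  assumes P: "open P"
    and meas: "\<And>p. p \<in> P \<Longrightarrow> h p \<in> borel_measurable M"
    and holo: "\<And>t. t \<in> space M \<Longrightarrow> line_holo P (\<lambda>p. h p t)"
    and bound: "\<And>p t. p \<in> P \<Longrightarrow> t \<in> space M \<Longrightarrow> norm (h p t) \<le> g t"
    and g: "integrable M g"
  shows "line_holo P (\<lambda>p. \<integral>t. h p t \<partial>M)"
proof (rule line_holoI)
  show "continuous_on P (\<lambda>p. \<integral>t. h p t \<partial>M)"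
    by (rule continuous_on_lebesgue_integral[OF meas _ bound g]) (use holo in \<open>auto simp: line_holo_def\<close>)
  fix p v assume "p \<in> P"
  then obtain r where r: "r > 0" "\<And>z. z \<in> cball 0 r \<Longrightarrow> p + z *s v \<in> P"
    using line_holo_cball[OF P] by metis
  have "(\<lambda>z. \<integral>t. h (p + z *s v) t \<partial>M) holomorphic_on ball 0 r"
  proof (rule holomorphic_lebesgue_integral[OF _ _ _ _ g])
    show "(\<lambda>z. h (p + z *s v) t) holomorphic_on ball 0 r" if "t \<in> space M" for t
      by (rule holomorphic_on_subset[OF line_holo_slice[OF P holo[OF that]]]) (use r in auto)
  qed (use r meas bound in auto)
  then show "\<exists>r>0. (\<lambda>z. \<integral>t. h (p + z *s v) t \<partial>M) holomorphic_on ball 0 r" using r by blast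
qed

text \<open>The second derivative at a point of the disc of radius \<open>r / 2\<close> is bounded by Cauchy's inequality on a
  disc of radius \<open>r / 4\<close>, whence the constant \<open>32 = 2 \<cdot> 4\<^sup>2\<close>.\<close>

lemma holomorphic_linear_remainder:
  assumes holo: "\<phi> holomorphic_on ball 0 r" and r: "r > 0"
    and bound: "\<And>z. z \<in> ball 0 r \<Longrightarrow> cmod (\<phi> z) < M"
    and z: "cmod z \<le> r / 2"
  shows "cmod (\<phi> z - \<phi> 0 - z * deriv \<phi> 0) \<le> 32 * M / r\<^sup>2 * (cmod z)\<^sup>2"
proof -
  have d2: "cmod ((deriv ^^ 2) \<phi> w) \<le> 32 * M / r\<^sup>2" if w: "w \<in> cball 0 (r / 2)" for w
  proof -
    have sub: "cball w (r / 4) \<subseteq> ball 0 r"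
    proof
      fix x assume "x \<in> cball w (r / 4)"
      then show "x \<in> ball 0 r" using w r dist_triangle[of 0 x w] by (simp add: dist_commute)
    qed
    have "cmod ((deriv ^^ 2) \<phi> w) \<le> fact 2 * M / (r / 4) ^ 2"
    proof (rule Cauchy_higher_deriv_bound[where y = 0])
      show "\<phi> holomorphic_on ball w (r / 4)"
        by (rule holomorphic_on_subset[OF holo]) (use sub in auto)
      show "continuous_on (cball w (r / 4)) \<phi>"
        by (intro holomorphic_on_imp_continuous_on holomorphic_on_subset[OF holo] sub)
      show "\<phi> x \<in> ball 0 M" if "x \<in> ball w (r / 4)" for x
      proof -
        have "x \<in> ball 0 r" using that sub ball_subset_cball by blast
        then show ?thesis using bound by simp
      qed
    qed (use r in auto)
    then show ?thesis by (simp add: power2_eq_square)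
  qed
  have "cmod ((deriv ^^ 0) \<phi> z - (\<Sum>i\<le>1. (deriv ^^ i) \<phi> 0 * (z - 0) ^ i / fact i))
      \<le> 32 * M / r\<^sup>2 * cmod (z - 0) ^ Suc 1 / fact 1"
  proof (rule complex_Taylor[where f = "\<lambda>i. (deriv ^^ i) \<phi>" and S = "cball 0 (r / 2)" and n = 1])
    fix i x assume "x \<in> cball (0::complex) (r / 2)" 
    then have x: "x \<in> ball 0 r" using r by auto
    have "(deriv ^^ i) \<phi> holomorphic_on ball 0 r" by (intro holomorphic_higher_deriv holo) auto
    from holomorphic_derivI[OF this _ x]
    show "((deriv ^^ i) \<phi> has_field_derivative (deriv ^^ Suc i) \<phi> x) (at x within cball 0 (r / 2))"
      by simp
  qed (use z r d2 in \<open>auto simp: numeral_2_eq_2\<close>)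
  then show ?thesis by (simp add: power2_eq_square algebra_simps)
qed

text \<open>The first-order expansion is uniform in the base point and in the direction. Uniformity in the base
  point makes the derivatives continuous, uniformity in the direction makes them total derivatives.\<close>

lemma line_holo_remainder:
  fixes P :: "(complex ^ 'n) set"
  assumes P: "open P" and G: "line_holo P G" and p: "p \<in> P"
  obtains r C where "r > 0" "ball p (2 * r) \<subseteq> P"
    "\<And>q v z. q \<in> ball p r \<Longrightarrow> cmod z * norm v \<le> r / 2 \<Longrightarrow>
       cmod (G (q + z *s v) - G q - z * line_deriv G v q) \<le> C * (cmod z * norm v)\<^sup>2"
proof -
  obtain e where e: "e > 0" "cball p e \<subseteq> P" using P p open_contains_cball by blast
  define r where "r = e / 2"
  have r: "r > 0" "cball p (2 * r) \<subseteq> P" using e by (auto simp: r_def)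
  have "compact (G ` cball p (2 * r))"
    by (intro compact_continuous_image continuous_on_subset[OF _ r(2)]) (use G in \<open>auto simp: line_holo_def\<close>)
  then have "bounded (G ` cball p (2 * r))" by (rule compact_imp_bounded)
  then obtain B where B: "\<forall>y\<in>G ` cball p (2 * r). cmod y \<le> B" unfolding bounded_iff by blast
  have M: "cmod (G x) < B + 1" if "x \<in> cball p (2 * r)" for x
    using bspec[OF B imageI[OF that]] by simp
  define M where "M = B + 1"
  note M = M[folded M_def]
  show ?thesis
  proof (rule that[of r "32 * M / r\<^sup>2"])
    show "ball p (2 * r) \<subseteq> P" using r by auto
    fix q :: "complex ^ 'n" and v :: "complex ^ 'n" and z :: complex
    assume q: "q \<in> ball p r" and z: "cmod z * norm v \<le> r / 2"
    show "cmod (G (q + z *s v) - G q - z * line_deriv G v q) \<le> 32 * M / r\<^sup>2 * (cmod z * norm v)\<^sup>2"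
    proof (cases "v = 0")
      case True
      then show ?thesis by (simp add: line_deriv_def)
    next
      case False
      define R where "R = r / norm v"
      have R: "R > 0" using False r by (simp add: R_def)
      have in_cball: "q + w *s v \<in> cball p (2 * r)" if "w \<in> ball 0 R" for w
      proof -
        have "cmod w * norm v \<le> r" using that False by (simp add: R_def field_simps)
        then have "dist q (q + w *s v) \<le> r" by (simp add: dist_norm norm_cvec_smult)
        then show ?thesis using q dist_triangle[of p "q + w *s v" q] by simp
      qed
      have "cmod (G (q + z *s v) - G (q + 0 *s v) - z * deriv (\<lambda>z. G (q + z *s v)) 0)
          \<le> 32 * M / R\<^sup>2 * (cmod z)\<^sup>2"
      proof (rule holomorphic_linear_remainder[OF _ R])
        show "(\<lambda>z. G (q + z *s v)) holomorphic_on ball 0 R"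
          by (rule holomorphic_on_subset[OF line_holo_slice[OF P G]]) (use in_cball r in auto)
        show "cmod z \<le> R / 2" using z False by (simp add: R_def field_simps)
      qed (use in_cball M in auto)
      also have "32 * M / R\<^sup>2 * (cmod z)\<^sup>2 = 32 * M / r\<^sup>2 * (cmod z * norm v)\<^sup>2"
        by (simp add: R_def power_mult_distrib power_divide field_simps)
      finally show ?thesis by (simp add: line_deriv_def)
    qed
  qed fact
qed

lemma line_holo_translate:
  fixes P :: "(complex ^ 'n) set"
  assumes "line_holo P G" "\<And>q. q \<in> N \<Longrightarrow> q + u \<in> P"
  shows "line_holo N (\<lambda>q. G (q + u))"
  unfolding line_holo_def
proof (intro conjI ballI allI)
  show "continuous_on N (\<lambda>q. G (q + u))"
    by (rule continuous_on_compose2[of P]) (use assms in \<open>auto simp: line_holo_def intro!: continuous_intros\<close>)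
  fix q v assume "q \<in> N"
  then have "(\<lambda>z. G ((q + u) + z *s v)) field_differentiable (at 0)"
    using assms by (auto simp: line_holo_def)
  moreover have "(q + u) + z *s v = q + z *s v + u" for z by (simp add: add_ac)
  ultimately show "(\<lambda>z. G (q + z *s v + u)) field_differentiable (at 0)" by simp
qed

text \<open>A directional derivative is a locally uniform limit of difference quotients.\<close>

lemma line_holo_line_deriv:
  fixes P :: "(complex ^ 'n) set"
  assumes P: "open P" and G: "line_holo P G"
  shows "line_holo P (line_deriv G v)"
proof (rule line_holo_uniform_limit[OF P, of sequentially
        "\<lambda>n q. of_nat (Suc n) * (G (q + (1 / of_nat (Suc n)) *s v) - G q)"])
  fix p assume "p \<in> P"
  then obtain r C where r: "r > 0" "ball p (2 * r) \<subseteq> P"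
    and rem: "\<And>q v z. q \<in> ball p r \<Longrightarrow> cmod z * norm v \<le> r / 2 \<Longrightarrow>
       cmod (G (q + z *s v) - G q - z * line_deriv G v q) \<le> C * (cmod z * norm v)\<^sup>2"
    using line_holo_remainder[OF P G] by metis
  define \<epsilon> where "\<epsilon> n = 1 / real (Suc n)" for n
  have eps: "cmod (1 / of_nat (Suc n)) = \<epsilon> n" for n
    by (simp add: \<epsilon>_def norm_divide del: of_nat_Suc)
  have e0: "(\<lambda>n. \<epsilon> n * norm v) \<longlonglongrightarrow> 0"
    using tendsto_mult_left_zero[OF LIMSEQ_inverse_real_of_nat, of "norm v"]
    by (simp add: \<epsilon>_def inverse_eq_divide)
  have small: "\<forall>\<^sub>F n in sequentially. \<epsilon> n * norm v < r / 2"
    by (rule order_tendstoD[OF e0]) (use r in simp)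
  have e0': "(\<lambda>n. \<bar>C\<bar> * norm v * (\<epsilon> n * norm v)) \<longlonglongrightarrow> 0"
    using tendsto_mult_left[OF e0, of "\<bar>C\<bar> * norm v"] by simp
  show "\<exists>N. open N \<and> p \<in> N \<and>
      (\<forall>\<^sub>F n in sequentially. line_holo N (\<lambda>q. of_nat (Suc n) * (G (q + (1 / of_nat (Suc n)) *s v) - G q))) \<and>
      uniform_limit N (\<lambda>n q. of_nat (Suc n) * (G (q + (1 / of_nat (Suc n)) *s v) - G q)) (line_deriv G v) sequentially"
  proof (intro exI[of _ "ball p r"] conjI)
    show "\<forall>\<^sub>F n in sequentially. line_holo (ball p r)
        (\<lambda>q. of_nat (Suc n) * (G (q + (1 / of_nat (Suc n)) *s v) - G q))"
      using small
    proof eventually_elim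
      case (elim n)
      have "q + (1 / of_nat (Suc n)) *s v \<in> P" if "q \<in> ball p r" for q
      proof -
        have "dist p (q + (1 / of_nat (Suc n)) *s v) \<le> dist p q + norm ((1 / of_nat (Suc n)) *s v)"
          using dist_triangle[of p "q + (1 / of_nat (Suc n)) *s v" q] by (simp add: dist_norm)
        also have "\<dots> < 2 * r" using elim that r by (simp add: norm_cvec_smult eps del: of_nat_Suc)
        finally show ?thesis using r by auto
      qed
      then show ?case
        by (intro line_holo_mult line_holo_const line_holo_diff line_holo_translate[OF G]
              line_holo_subset[OF G]) (use r in auto)
    qed
    show "uniform_limit (ball p r) (\<lambda>n q. of_nat (Suc n) * (G (q + (1 / of_nat (Suc n)) *s v) - G q))
        (line_deriv G v) sequentially"
    proof (rule uniform_limitI)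
      fix e :: real assume "e > 0"
      then have "\<forall>\<^sub>F n in sequentially. \<bar>C\<bar> * norm v * (\<epsilon> n * norm v) < e"
        by (rule order_tendstoD[OF e0'])
      with small show "\<forall>\<^sub>F n in sequentially. \<forall>q\<in>ball p r.
          dist (of_nat (Suc n) * (G (q + (1 / of_nat (Suc n)) *s v) - G q)) (line_deriv G v q) < e"
      proof eventually_elim
        case (elim n)
        show ?case
        proof
          fix q assume q: "q \<in> ball p r"
          let ?z = "1 / of_nat (Suc n) :: complex"
          have 1: "cmod (G (q + ?z *s v) - G q - ?z * line_deriv G v q) \<le> C * (\<epsilon> n * norm v)\<^sup>2"
            using rem[OF q, of ?z v] elim by (simp add: eps del: of_nat_Suc)
          have "of_nat (Suc n) * (G (q + ?z *s v) - G q) - line_deriv G v q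
             = of_nat (Suc n) * (G (q + ?z *s v) - G q - ?z * line_deriv G v q)"
            by (simp add: field_simps del: of_nat_Suc)
          then have "dist (of_nat (Suc n) * (G (q + ?z *s v) - G q)) (line_deriv G v q)
             = real (Suc n) * cmod (G (q + ?z *s v) - G q - ?z * line_deriv G v q)"
            by (simp add: dist_norm norm_mult del: of_nat_Suc)
          also have "\<dots> \<le> real (Suc n) * (C * (\<epsilon> n * norm v)\<^sup>2)"
            by (rule mult_left_mono[OF 1]) simp
          also have "\<dots> = C * norm v * (\<epsilon> n * norm v)"
            by (simp add: \<epsilon>_def power2_eq_square field_simps del: of_nat_Suc)
          also have "\<dots> \<le> \<bar>C\<bar> * norm v * (\<epsilon> n * norm v)"
            by (intro mult_right_mono) (auto simp: \<epsilon>_def)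
          also have "\<dots> < e" using elim by simp
          finally show "dist (of_nat (Suc n) * (G (q + ?z *s v) - G q)) (line_deriv G v q) < e" .
        qed
      qed
    qed
  qed (use r in auto)
qed simp

lemma line_deriv_scale:
  fixes P :: "(complex ^ 'n) set"
  assumes P: "open P" and G: "line_holo P G" and p: "p \<in> P"
  shows "line_deriv G (w *s v) p = w * line_deriv G v p"
proof -
  have "((\<lambda>z. G (p + z *s v)) has_field_derivative line_deriv G v p) (at (w * 0))"
    unfolding line_deriv_def mult_zero_right using G p
    by (simp add: line_holo_def DERIV_deriv_iff_field_differentiable)
  moreover have "((\<lambda>z. w * z) has_field_derivative w) (at 0)"
    by (auto intro!: derivative_eq_intros)
  ultimately have "((\<lambda>z. G (p + (w * z) *s v)) has_field_derivative line_deriv G v p * w) (at 0)"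
    using DERIV_chain[of "\<lambda>z. G (p + z *s v)" "line_deriv G v p" "\<lambda>z. w * z" 0 w UNIV] by (simp add: o_def)
  moreover have "(w * z) *s v = z *s (w *s v)" for z by (simp add: vec_eq_iff)
  ultimately show ?thesis unfolding line_deriv_def[of G "w *s v"] by (simp add: DERIV_imp_deriv)
qed

text \<open>The increment in direction \<open>u + v\<close> is an increment along \<open>u\<close> followed by one along \<open>v\<close> from a displaced
  base point; continuity of the derivative along \<open>v\<close> removes the displacement in the limit.\<close>

lemma line_deriv_add:
  fixes P :: "(complex ^ 'n) set"
  assumes P: "open P" and G: "line_holo P G" and p: "p \<in> P"
  shows "line_deriv G (u + v) p = line_deriv G u p + line_deriv G v p"
proof -
  obtain r C where r: "r > 0" "ball p (2 * r) \<subseteq> P"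
    and rem: "\<And>q v z. q \<in> ball p r \<Longrightarrow> cmod z * norm v \<le> r / 2 \<Longrightarrow>
       cmod (G (q + z *s v) - G q - z * line_deriv G v q) \<le> C * (cmod z * norm v)\<^sup>2"
    using line_holo_remainder[OF P G p] by metis
  define \<epsilon> where "\<epsilon> n = 1 / real (Suc n)" for n
  define z where "z n = (of_real (\<epsilon> n) :: complex)" for n
  have ep: "\<epsilon> n > 0" for n by (simp add: \<epsilon>_def)
  have e0: "\<epsilon> \<longlonglongrightarrow> 0"
    using LIMSEQ_inverse_real_of_nat by (simp add: \<epsilon>_def[abs_def] inverse_eq_divide)
  define K where "K = norm u + norm v + norm (u + v)"
  define E where "E n = line_deriv G (u + v) p - line_deriv G u p - line_deriv G v (p + z n *s u)" for n
  have "(\<lambda>n. E n) \<longlonglongrightarrow> 0"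
  proof (rule Lim_null_comparison)
    have "(\<lambda>n. \<epsilon> n * K) \<longlonglongrightarrow> 0" using tendsto_mult_left_zero[OF e0] .
    then have "\<forall>\<^sub>F n in sequentially. \<epsilon> n * K < r / 2" by (rule order_tendstoD) (use r in simp)
    then show "\<forall>\<^sub>F n in sequentially. norm (E n) \<le> 3 * \<bar>C\<bar> * K\<^sup>2 * \<epsilon> n"
    proof eventually_elim
      case (elim n)
      have le: "\<epsilon> n * norm x \<le> r / 2" "C * (\<epsilon> n * norm x)\<^sup>2 \<le> \<bar>C\<bar> * (\<epsilon> n * K)\<^sup>2" if "norm x \<le> K" for x :: "complex ^ 'n"
      proof -
        have "\<epsilon> n * norm x \<le> \<epsilon> n * K" using that ep[of n] by simp
        then show "\<epsilon> n * norm x \<le> r / 2" using elim by simp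
        show "C * (\<epsilon> n * norm x)\<^sup>2 \<le> \<bar>C\<bar> * (\<epsilon> n * K)\<^sup>2"
          using \<open>\<epsilon> n * norm x \<le> \<epsilon> n * K\<close> ep[of n]
          by (intro mult_mono power_mono) auto
      qed
      have norms: "norm u \<le> K" "norm v \<le> K" "norm (u + v) \<le> K" by (auto simp: K_def)
      have cz: "cmod (z n) = \<epsilon> n" using ep[of n] by (simp add: z_def)
      define q where "q = p + z n *s u"
      have "dist p q \<le> r / 2" using le(1)[OF norms(1)] by (simp add: q_def dist_norm norm_cvec_smult cz)
      then have q: "q \<in> ball p r" using r by simp
      have pp: "p \<in> ball p r" using r by simp
      have sum: "q + z n *s v = p + z n *s (u + v)" by (simp add: q_def vec_eq_iff algebra_simps)
      have 1: "cmod (G (p + z n *s (u + v)) - G p - z n * line_deriv G (u + v) p) \<le> \<bar>C\<bar> * (\<epsilon> n * K)\<^sup>2"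
        using rem[OF pp, of "z n" "u + v"] le[OF norms(3)] by (simp add: cz)
      have 2: "cmod (G q - G p - z n * line_deriv G u p) \<le> \<bar>C\<bar> * (\<epsilon> n * K)\<^sup>2"
        using rem[OF pp, of "z n" u] le[OF norms(1)] by (simp add: cz q_def)
      have 3: "cmod (G (p + z n *s (u + v)) - G q - z n * line_deriv G v q) \<le> \<bar>C\<bar> * (\<epsilon> n * K)\<^sup>2"
        using rem[OF q, of "z n" v] le[OF norms(2)] by (simp add: cz sum)
      have "z n * E n = (G (p + z n *s (u + v)) - G q - z n * line_deriv G v q)
         + (G q - G p - z n * line_deriv G u p) - (G (p + z n *s (u + v)) - G p - z n * line_deriv G (u + v) p)"
        by (simp add: E_def q_def algebra_simps)
      also have "cmod \<dots> \<le> \<bar>C\<bar> * (\<epsilon> n * K)\<^sup>2 + \<bar>C\<bar> * (\<epsilon> n * K)\<^sup>2 + \<bar>C\<bar> * (\<epsilon> n * K)\<^sup>2"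
        by (intro order_trans[OF norm_triangle_ineq4] add_mono order_trans[OF norm_triangle_ineq] 1 2 3)
      finally have "\<epsilon> n * cmod (E n) \<le> \<epsilon> n * (3 * \<bar>C\<bar> * K\<^sup>2 * \<epsilon> n)"
        by (simp add: norm_mult cz power2_eq_square algebra_simps)
      then show "norm (E n) \<le> 3 * \<bar>C\<bar> * K\<^sup>2 * \<epsilon> n" using ep[of n] by simp
    qed
    show "(\<lambda>n. 3 * \<bar>C\<bar> * K\<^sup>2 * \<epsilon> n) \<longlonglongrightarrow> 0" using tendsto_mult_right_zero[OF e0] .
  qed
  moreover have "(\<lambda>n. E n) \<longlonglongrightarrow> line_deriv G (u + v) p - line_deriv G u p - line_deriv G v p"
  proof -
    have "z \<longlonglongrightarrow> 0" using tendsto_of_real[OF e0] by (simp add: z_def[abs_def])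
    moreover have "continuous_on UNIV (\<lambda>z. p + z *s u)" by (intro continuous_intros)
    ultimately have "(\<lambda>n. p + z n *s u) \<longlonglongrightarrow> p + 0 *s u"
      using continuous_on_tendsto_compose by fastforce
    then have "(\<lambda>n. p + z n *s u) \<longlonglongrightarrow> p" by simp
    moreover have "isCont (line_deriv G v) p"
      using line_holo_line_deriv[OF P G, of v] p continuous_on_eq_continuous_at[OF P]
      unfolding line_holo_def by blast
    ultimately have "(\<lambda>n. line_deriv G v (p + z n *s u)) \<longlonglongrightarrow> line_deriv G v p"
      using isCont_tendsto_compose by blast
    then show ?thesis unfolding E_def by (intro tendsto_intros)
  qed
  ultimately show ?thesis using LIMSEQ_unique by (fastforce simp: algebra_simps)
qed

lemma line_holo_has_derivative:
  fixes P :: "(complex ^ 'n) set"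
  assumes P: "open P" and G: "line_holo P G" and p: "p \<in> P"
  shows "(G has_derivative (\<lambda>v. line_deriv G v p)) (at p)"
proof -
  obtain r C where r: "r > 0" "ball p (2 * r) \<subseteq> P"
    and rem: "\<And>q v z. q \<in> ball p r \<Longrightarrow> cmod z * norm v \<le> r / 2 \<Longrightarrow>
       cmod (G (q + z *s v) - G q - z * line_deriv G v q) \<le> C * (cmod z * norm v)\<^sup>2"
    using line_holo_remainder[OF P G p] by metis
  have "linear (\<lambda>v. line_deriv G v p)"
  proof (rule linearI)
    fix c :: real and v :: "complex ^ 'n"
    have "c *\<^sub>R v = complex_of_real c *s v"
      unfolding vec_eq_iff vector_scaleR_component vector_smult_component
      by (simp add: scaleR_conv_of_real)
    then show "line_deriv G (c *\<^sub>R v) p = c *\<^sub>R line_deriv G v p"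
      using line_deriv_scale[OF P G p] by (simp add: scaleR_conv_of_real)
  qed (rule line_deriv_add[OF P G p])
  then have bl: "bounded_linear (\<lambda>v. line_deriv G v p)" by (simp add: linear_conv_bounded_linear)
  have "((\<lambda>h. norm (G (p + h) - G p - line_deriv G h p) / norm h) \<longlongrightarrow> 0) (at 0)"
  proof (rule Lim_null_comparison)
    have "\<forall>\<^sub>F h in at (0 :: complex ^ 'n). h \<in> ball 0 (r / 2)"
      by (rule eventually_at_in_open') (use r in auto)
    then show "\<forall>\<^sub>F h in at 0. norm (norm (G (p + h) - G p - line_deriv G h p) / norm h) \<le> \<bar>C\<bar> * norm h"
    proof eventually_elim
      case (elim h)
      have "cmod (G (p + 1 *s h) - G p - 1 * line_deriv G h p) \<le> C * (cmod 1 * norm h)\<^sup>2"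
        by (rule rem) (use r elim in auto)
      also have "\<dots> \<le> \<bar>C\<bar> * (norm h)\<^sup>2" by (simp add: mult_right_mono)
      finally show ?case
        by (cases "h = 0") (auto simp: divide_le_eq power2_eq_square mult_ac)
    qed
    have "((\<lambda>h :: complex ^ 'n. \<bar>C\<bar> * norm h) \<longlongrightarrow> \<bar>C\<bar> * norm (0 :: complex ^ 'n)) (at 0)" by (intro tendsto_intros)
    then show "((\<lambda>h :: complex ^ 'n. \<bar>C\<bar> * norm h) \<longlongrightarrow> 0) (at 0)" by simp
  qed
  then show ?thesis using bl by (simp add: has_derivative_at)
qed

lemma Ck_on_cong:
  assumes "open S" "\<And>x. x \<in> S \<Longrightarrow> g x = h x"
  shows "Ck_on k S g = Ck_on k S h"
  using assms(2)
proof (induction k arbitrary: g h)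
  case 0
  then show ?case by (simp cong: continuous_on_cong_simp)
next
  case (Suc k)
  have iff: "(g has_derivative D) (at x) \<longleftrightarrow> (h has_derivative D) (at x)" if "x \<in> S" for x D
    using has_derivative_transform_within_open[OF _ assms(1) that] Suc.prems by metis
  then have "Ck_on k S (\<lambda>x. frechet_derivative g (at x) v) = Ck_on k S (\<lambda>x. frechet_derivative h (at x) v)" for v
    by (intro Suc.IH) (simp add: frechet_derivative_def)
  moreover have "(\<forall>x\<in>S. g differentiable at x) = (\<forall>x\<in>S. h differentiable at x)"
    using iff by (simp add: differentiable_def)
  ultimately show ?case by simp
qed

text \<open>The derivative of the restriction in a real direction \<open>v\<close> is the restriction of the derivative in
  direction \<open>\<iota> v\<close>, so that the class of these restrictions is closed under differentiation.\<close>

lemma line_holo_smooth: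
  fixes P :: "(complex ^ 'n) set" and \<iota> :: "'e::euclidean_space \<Rightarrow> complex ^ 'n"
  assumes "open S" "open P" "bounded_linear \<iota>" "\<iota> ` S \<subseteq> P" "line_holo P F" "line_holo P G"
  shows "smooth_on S (\<lambda>x. (F (\<iota> x), G (\<iota> x)))"
proof -
  have "Ck_on k S (\<lambda>x. (F (\<iota> x), G (\<iota> x)))" for k
    using assms(5,6)
  proof (induction k arbitrary: F G)
    case 0
    then have "continuous_on P F" "continuous_on P G" by (auto simp: line_holo_def)
    moreover have "continuous_on S \<iota>" using assms(3) linear_continuous_on by blast
    ultimately show ?case using assms(4)
      by (auto intro!: continuous_on_Pair intro: continuous_on_compose2)
  next
    case (Suc k)
    have comp: "((\<lambda>x. H (\<iota> x)) has_derivative (\<lambda>v. line_deriv H (\<iota> v) (\<iota> x))) (at x)"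
      if "line_holo P H" "x \<in> S" for H x
    proof -
      have "(H has_derivative (\<lambda>v. line_deriv H v (\<iota> x))) (at (\<iota> x))"
        using that assms by (intro line_holo_has_derivative) auto
      with bounded_linear_imp_has_derivative[OF assms(3), of "at x"] show ?thesis
        using diff_chain_at[of \<iota> \<iota> x H] by (simp add: o_def)
    qed
    have der: "((\<lambda>x. (F (\<iota> x), G (\<iota> x))) has_derivative
        (\<lambda>v. (line_deriv F (\<iota> v) (\<iota> x), line_deriv G (\<iota> v) (\<iota> x)))) (at x)" if "x \<in> S" for x
      by (intro has_derivative_Pair comp Suc.prems that)
    have "Ck_on k S (\<lambda>x. frechet_derivative (\<lambda>x. (F (\<iota> x), G (\<iota> x))) (at x) v)" for v
    proof (subst Ck_on_cong[OF assms(1)])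
      fix x assume "x \<in> S"
      show "frechet_derivative (\<lambda>x. (F (\<iota> x), G (\<iota> x))) (at x) v =
          (line_deriv F (\<iota> v) (\<iota> x), line_deriv G (\<iota> v) (\<iota> x))"
        using frechet_derivative_at[OF der[OF \<open>x \<in> S\<close>]] by metis
    next
      show "Ck_on k S (\<lambda>x. (line_deriv F (\<iota> v) (\<iota> x), line_deriv G (\<iota> v) (\<iota> x)))"
        by (intro Suc.IH line_holo_line_deriv assms Suc.prems)
    qed
    then show ?case using der by (auto simp: differentiable_def)
  qed
  then show ?thesis by (simp add: smooth_on_def)
qed

section \<open>Cauchy integrals over a ray\<close>

text \<open>The size of the exponentials along a ray. The factor \<open>e\<^sup>-\<^sup>1\<^sup>/\<^sup>x\<close> outweighs the singularity of \<open>dt / t\<close> at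
  the origin.\<close>

definition damping :: "real \<Rightarrow> real" where "damping x = exp (- (x + 1 / x))"

lemma damping_pos: "damping x > 0" by (simp add: damping_def)

text \<open>The first majorant is integrable; the second makes the integrand vanish at the origin, through which
  the contours below pass.\<close>

lemma damping_div_le:
  assumes "k > 0" "t > 0"
  shows "damping (k * t) / t \<le> k * exp (- k * t)" "damping (k * t) / t \<le> 2 * k\<^sup>2 * t"
proof -
  define x where "x = 1 / (k * t)"
  have x: "x > 0" "1 / t = k * x" using assms by (auto simp: x_def)
  have eq: "damping (k * t) / t = k * (x * exp (- x)) * exp (- k * t)"
    using assms x by (simp add: damping_def x_def[symmetric] exp_add[symmetric] exp_minus field_simps)
  have "x \<le> exp x" using exp_ge_add_one_self[of x] by linarith
  then have "x * exp (- x) \<le> 1" by (simp add: exp_minus field_simps)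
  then have "k * (x * exp (- x)) * exp (- k * t) \<le> k * 1 * exp (- k * t)"
    by (intro mult_right_mono mult_left_mono) (use assms in auto)
  then show "damping (k * t) / t \<le> k * exp (- k * t)" using eq by simp
  have "1 + x + x\<^sup>2 / 2 \<le> exp x" using exp_lower_Taylor_quadratic x by simp
  then have "x\<^sup>2 \<le> 2 * exp x" using x by simp
  then have "x * exp (- x) \<le> 2 / x" using x by (simp add: exp_minus field_simps power2_eq_square)
  then have "k * (x * exp (- x)) * exp (- k * t) \<le> k * (2 / x) * 1"
    using assms x by (intro mult_mono) auto
  also have "\<dots> = 2 * k\<^sup>2 * t" by (simp add: x_def power2_eq_square)
  finally show "damping (k * t) / t \<le> 2 * k\<^sup>2 * t" using eq by simp
qed

text \<open>The bound does not depend on \<open>k\<close>, so that the lengths of the direction vectors of the rays, tilted or not,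
  leave no trace in the estimates.\<close>

lemma damping_integral:
  assumes k: "k > 0"
  shows "set_integrable lborel {0<..} (\<lambda>t. damping (k * t) / t)"
    and "(LINT t:{0<..}|lborel. damping (k * t) / t) \<le> 1"
proof -
  define e where "e t = k * exp (- k * t)" for t
  have hi: "(e has_integral 1) {0..}"
    using has_integral_mult_right[OF has_integral_exp_minus_to_infinity[OF k, of 0], of k] k
    by (simp add: e_def[abs_def])
  have "e absolutely_integrable_on {0..}"
    using hi k by (intro nonnegative_absolutely_integrable_1) (auto simp: e_def integrable_on_def)
  then have e_int: "set_integrable lborel {0..} e"
    unfolding set_integrable_def by (subst (asm) integrable_completion) (auto simp: e_def)
  have e_val: "(LINT t:{0..}|lborel. e t) = 1"
    using set_borel_integral_eq_integral(2)[OF e_int] integral_unique[OF hi] by simp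
  have le: "indicator {0<..} t *\<^sub>R (damping (k * t) / t) \<le> indicator {0..} t *\<^sub>R e t" for t
    using damping_div_le(1)[OF k, of t] k by (auto simp: e_def indicator_def)
  have nn: "0 \<le> indicator {0<..} t *\<^sub>R (damping (k * t) / t)" for t
    by (auto simp: indicator_def damping_def)
  have int: "integrable lborel (\<lambda>t. indicator {0<..} t *\<^sub>R (damping (k * t) / t))"
  proof (rule Bochner_Integration.integrable_bound[OF e_int[unfolded set_integrable_def]])
    show "(\<lambda>t. indicator {0<..} t *\<^sub>R (damping (k * t) / t)) \<in> borel_measurable lborel"
      unfolding damping_def by measurable
    show "AE t in lborel. norm (indicator {0<..} t *\<^sub>R (damping (k * t) / t)) \<le> norm (indicator {0..} t *\<^sub>R e t)"
    proof (rule AE_I2)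
      fix t show "norm (indicator {0<..} t *\<^sub>R (damping (k * t) / t)) \<le> norm (indicator {0..} t *\<^sub>R e t)"
        using nn[of t] le[of t] by simp
    qed
  qed
  then show "set_integrable lborel {0<..} (\<lambda>t. damping (k * t) / t)" by (simp add: set_integrable_def)
  have "(LINT t:{0<..}|lborel. damping (k * t) / t) \<le> (LINT t:{0..}|lborel. e t)"
    unfolding set_lebesgue_integral_def
    by (rule integral_mono[OF int e_int[unfolded set_integrable_def] le])
  then show "(LINT t:{0<..}|lborel. damping (k * t) / t) \<le> 1" by (simp add: e_val)
qed

lemma damping_majorant:
  assumes "k > 0"
  shows "integrable lborel (\<lambda>t. B * (indicator {0<..} t *\<^sub>R (damping (k * t) / t)))"
  by (intro integrable_mult_right damping_integral(1)[OF assms, unfolded set_integrable_def])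

definition off_ray :: "complex \<Rightarrow> complex option \<Rightarrow> bool" where
  "off_ray q \<zeta> \<longleftrightarrow> (\<forall>t>0. \<zeta> \<noteq> Some (of_real t * q))"

definition damped_on_ray :: "real \<Rightarrow> real \<Rightarrow> complex \<Rightarrow> (complex \<Rightarrow> complex) \<Rightarrow> bool" where
  "damped_on_ray k M q h \<longleftrightarrow> continuous_on {0<..} (\<lambda>t. h (of_real t * q)) \<and>
     (\<forall>t>0. cmod (h (of_real t * q)) \<le> M * damping (k * t))"

definition ray_integrand :: "complex \<Rightarrow> complex option \<Rightarrow> (complex \<Rightarrow> complex) \<Rightarrow> real \<Rightarrow> complex" where
  "ray_integrand q \<zeta> h t = indicator {0<..} t *\<^sub>R (kern \<zeta> (of_real t * q) * h (of_real t * q) / of_real t)"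

lemma ray_integral_eq: "ray_integral q \<zeta> h = (\<integral>t. ray_integrand q \<zeta> h t \<partial>lborel)"
  by (simp add: ray_integral_def set_lebesgue_integral_def ray_integrand_def)

lemma continuous_on_kern_ray:
  assumes "off_ray q \<zeta>"
  shows "continuous_on {0<..} (\<lambda>t. kern \<zeta> (of_real t * q))"
proof (cases \<zeta>)
  case (Some z)
  then have "of_real t * q - z \<noteq> 0" if "t > 0" for t using assms that by (auto simp: off_ray_def)
  then show ?thesis using Some by (auto intro!: continuous_intros)
qed simp

lemma ray_integrand_measurable:
  assumes "off_ray q \<zeta>" "damped_on_ray k M q h"
  shows "ray_integrand q \<zeta> h \<in> borel_measurable lborel"
proof -
  have "(\<lambda>t. indicator {0<..} t *\<^sub>R (kern \<zeta> (of_real t * q) * h (of_real t * q) / of_real t))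
      \<in> borel_measurable borel"
    by (rule borel_measurable_continuous_on_indicator)
       (use assms continuous_on_kern_ray in \<open>auto simp: damped_on_ray_def intro!: continuous_intros\<close>)
  then show ?thesis by (simp add: ray_integrand_def[abs_def])
qed

lemma ray_integrand_bound:
  assumes "damped_on_ray k M q h" "\<And>t. t > 0 \<Longrightarrow> cmod (kern \<zeta> (of_real t * q)) \<le> C"
  shows "cmod (ray_integrand q \<zeta> h t) \<le> C * M * (indicator {0<..} t *\<^sub>R (damping (k * t) / t))"
proof (cases "t > 0")
  case True
  have "cmod (kern \<zeta> (of_real t * q)) * cmod (h (of_real t * q)) \<le> C * (M * damping (k * t))"
    by (rule mult_mono) (use assms True in \<open>auto simp: damped_on_ray_def intro: order_trans[OF norm_ge_zero]\<close>)
  then show ?thesis using True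
    by (simp add: ray_integrand_def norm_mult norm_divide divide_right_mono mult.assoc[symmetric])
qed (auto simp: ray_integrand_def)

lemma ray_integrand_integrable:
  assumes "k > 0" "off_ray q \<zeta>" "damped_on_ray k M q h"
    and "\<And>t. t > 0 \<Longrightarrow> cmod (kern \<zeta> (of_real t * q)) \<le> C"
  shows "integrable lborel (ray_integrand q \<zeta> h)"
proof (rule Bochner_Integration.integrable_bound)
  show "integrable lborel (\<lambda>t. C * M * (indicator {0<..} t *\<^sub>R (damping (k * t) / t)))"
    by (rule damping_majorant[OF assms(1)])
  show "ray_integrand q \<zeta> h \<in> borel_measurable lborel" by (rule ray_integrand_measurable[OF assms(2,3)])
  show "AE t in lborel. norm (ray_integrand q \<zeta> h t) \<le> norm (C * M * (indicator {0<..} t *\<^sub>R (damping (k * t) / t)))"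
    using ray_integrand_bound[OF assms(3,4)] by (intro AE_I2) (smt (verit) real_norm_def)
qed

lemma ray_integral_bound:
  assumes "k > 0" "off_ray q \<zeta>" "damped_on_ray k M q h"
    and C: "\<And>t. t > 0 \<Longrightarrow> cmod (kern \<zeta> (of_real t * q)) \<le> C"
  shows "cmod (ray_integral q \<zeta> h) \<le> C * M"
proof -
  have "C \<ge> 0" by (rule order_trans[OF norm_ge_zero C[of 1]]) simp
  have "\<forall>t>0. cmod (h (of_real t * q)) \<le> M * damping (k * t)" using assms(3) by (simp add: damped_on_ray_def)
  then have "cmod (h (of_real 1 * q)) \<le> M * damping (k * 1)" using zero_less_one by blast
  then have "0 \<le> M * damping (k * 1)" by (rule order_trans[OF norm_ge_zero])
  then have "M \<ge> 0" using damping_pos[of "k * 1"] by (simp add: zero_le_mult_iff)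
  have "cmod (ray_integral q \<zeta> h) \<le> (\<integral>t. C * M * (indicator {0<..} t *\<^sub>R (damping (k * t) / t)) \<partial>lborel)"
    unfolding ray_integral_eq
    by (rule Bochner_Integration.integral_norm_bound_integral[OF ray_integrand_integrable[OF assms(1-3) C] damping_majorant[OF assms(1)]])
       (assumption | rule ray_integrand_bound[OF assms(3) C])+
  also have "\<dots> = C * M * (LINT t:{0<..}|lborel. damping (k * t) / t)"
    unfolding set_lebesgue_integral_def by (rule integral_mult_right_zero)
  also have "\<dots> \<le> C * M * 1"
    by (rule mult_left_mono[OF damping_integral(2)[OF assms(1)]]) (use \<open>C \<ge> 0\<close> \<open>M \<ge> 0\<close> in simp)
  finally show ?thesis by simp
qed

lemma ray_integral_diff:
  assumes "k > 0" "off_ray q \<zeta>" "damped_on_ray k M q h" "damped_on_ray k M' q h'"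
    and C: "\<And>t. t > 0 \<Longrightarrow> cmod (kern \<zeta> (of_real t * q)) \<le> C"
  shows "ray_integral q \<zeta> (\<lambda>x. h x - h' x) = ray_integral q \<zeta> h - ray_integral q \<zeta> h'"
proof -
  have "ray_integrand q \<zeta> (\<lambda>x. h x - h' x) t = ray_integrand q \<zeta> h t - ray_integrand q \<zeta> h' t" for t
    by (simp add: ray_integrand_def algebra_simps diff_divide_distrib)
  then show ?thesis
    using ray_integrand_integrable[OF assms(1,2,3) C] ray_integrand_integrable[OF assms(1,2,4) C]
    by (simp add: ray_integral_eq)
qed

text \<open>The parametrization \<open>\<kappa>\<close> allows for charts of the sphere at finite points and at \<open>\<infinity>\<close>.\<close>

lemma ray_integral_continuous:
  fixes \<kappa> :: "'a::metric_space \<Rightarrow> complex option"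
  assumes k: "k > 0" and h: "damped_on_ray k M q h"
    and off: "\<And>x. x \<in> A \<Longrightarrow> off_ray q (\<kappa> x)"
    and C: "\<And>x t. x \<in> A \<Longrightarrow> t > 0 \<Longrightarrow> cmod (kern (\<kappa> x) (of_real t * q)) \<le> C"
    and cont: "\<And>t. t > 0 \<Longrightarrow> continuous_on A (\<lambda>x. kern (\<kappa> x) (of_real t * q))"
  shows "continuous_on A (\<lambda>x. ray_integral q (\<kappa> x) h)"
  unfolding ray_integral_eq
proof (rule continuous_on_lebesgue_integral)
  show "integrable lborel (\<lambda>t. C * M * (indicator {0<..} t *\<^sub>R (damping (k * t) / t)))"
    by (rule damping_majorant[OF k])
  show "continuous_on A (\<lambda>x. ray_integrand q (\<kappa> x) h t)" for t
    unfolding ray_integrand_def using cont by (cases "t > 0") (auto intro!: continuous_intros)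
qed (use ray_integrand_measurable[OF off h] ray_integrand_bound[OF h C] in auto)

lemma ray_integral_line_holo:
  fixes P :: "(complex ^ 'n) set"
  assumes k: "k > 0" and P: "open P" and h: "\<And>p. p \<in> P \<Longrightarrow> damped_on_ray k M q (h p)"
    and off: "off_ray q \<zeta>"
    and C: "\<And>t. t > 0 \<Longrightarrow> cmod (kern \<zeta> (of_real t * q)) \<le> C"
    and holo: "\<And>t. t > 0 \<Longrightarrow> line_holo P (\<lambda>p. h p (of_real t * q))"
  shows "line_holo P (\<lambda>p. ray_integral q \<zeta> (h p))"
  unfolding ray_integral_eq
proof (rule line_holo_integral[OF P])
  show "integrable lborel (\<lambda>t. C * M * (indicator {0<..} t *\<^sub>R (damping (k * t) / t)))"
    by (rule damping_majorant[OF k])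
  show "line_holo P (\<lambda>p. ray_integrand q \<zeta> (h p) t)" for t
  proof (cases "t > 0")
    case True
    have "line_holo P (\<lambda>p. kern \<zeta> (of_real t * q) / of_real t * h p (of_real t * q))"
      by (intro line_holo_mult line_holo_const holo True)
    then show ?thesis using True by (simp add: ray_integrand_def)
  qed (simp add: ray_integrand_def line_holo_const)
qed (use ray_integrand_measurable[OF off h] ray_integrand_bound[OF h C] in auto)

definition closed_ray :: "complex \<Rightarrow> complex set" where
  "closed_ray q = {z. Im (z * cnj q) = 0 \<and> 0 \<le> Re (z * cnj q)}"

lemma closed_closed_ray: "closed (closed_ray q)"
  unfolding closed_ray_def
  by (intro closed_Collect_conj closed_Collect_eq closed_Collect_le continuous_intros)

lemma ray_in_closed_ray: "t \<ge> 0 \<Longrightarrow> of_real t * q \<in> closed_ray q"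
  by (simp add: closed_ray_def algebra_simps)

lemma off_rayI: "z \<notin> closed_ray q \<Longrightarrow> off_ray q (Some z)"
  using ray_in_closed_ray[of _ q] by (force simp: off_ray_def)

text \<open>The bound comes from \<open>t q + z = (t q - z) + 2 z\<close>, with \<open>\<bar>t q - z\<bar>\<close> bounded below by the distance to the ray.\<close>

lemma kern_locally_bounded:
  assumes "z0 \<notin> closed_ray q"
  obtains \<delta> C where "\<delta> > 0" "ball z0 \<delta> \<inter> closed_ray q = {}"
    "\<And>z t. z \<in> ball z0 \<delta> \<Longrightarrow> t > 0 \<Longrightarrow> cmod (kern (Some z) (of_real t * q)) \<le> C"
proof -
  obtain d where d: "d > 0" "\<And>x. x \<in> closed_ray q \<Longrightarrow> d \<le> dist z0 x"
    using separate_point_closed[OF closed_closed_ray assms] by blast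
  have far: "d / 2 \<le> cmod (of_real t * q - z)" if "z \<in> ball z0 (d / 2)" "t > 0" for z t
    using d(2)[OF ray_in_closed_ray[of t q]] that dist_triangle[of z0 "of_real t * q" z]
    by (simp add: dist_norm norm_minus_commute)
  show ?thesis
  proof (rule that[of "d / 2" "1 + 2 * (cmod z0 + d) / (d / 2)"])
    show "ball z0 (d / 2) \<inter> closed_ray q = {}" using d by force
    fix z :: complex and t :: real assume z: "z \<in> ball z0 (d / 2)" and t: "t > 0"
    define D where "D = cmod (of_real t * q - z)"
    have D: "D \<ge> d / 2" using far[OF z t] by (simp add: D_def)
    have "cmod z \<le> cmod z0 + d" using z d norm_triangle_ineq2[of z z0] by (simp add: dist_norm norm_minus_commute)
    moreover have "cmod (of_real t * q + z) \<le> D + 2 * cmod z"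
      using norm_triangle_ineq[of "of_real t * q - z" "2 * z"] by (simp add: D_def norm_mult add.commute)
    ultimately have "cmod (of_real t * q + z) \<le> D + 2 * (cmod z0 + d)" by simp
    then have "cmod (kern (Some z) (of_real t * q)) \<le> (D + 2 * (cmod z0 + d)) / D"
      by (simp add: norm_divide D_def divide_right_mono)
    also have "\<dots> = 1 + 2 * (cmod z0 + d) / D" using D d by (simp add: field_simps)
    also have "\<dots> \<le> 1 + 2 * (cmod z0 + d) / (d / 2)"
      using D d by (intro add_left_mono divide_left_mono mult_pos_pos) auto
    finally show "cmod (kern (Some z) (of_real t * q)) \<le> 1 + 2 * (cmod z0 + d) / (d / 2)" .
  qed (use d in auto)
qed

lemma ray_integral_holomorphic:
  assumes k: "k > 0" and h: "damped_on_ray k M q h"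
  shows "(\<lambda>z. ray_integral q (Some z) h) holomorphic_on (- closed_ray q)"
proof -
  have "\<exists>D. ((\<lambda>z. ray_integral q (Some z) h) has_field_derivative D) (at z0)" if z0: "z0 \<notin> closed_ray q" for z0
  proof -
    obtain \<delta> C where d: "\<delta> > 0" "ball z0 \<delta> \<inter> closed_ray q = {}"
      "\<And>z t. z \<in> ball z0 \<delta> \<Longrightarrow> t > 0 \<Longrightarrow> cmod (kern (Some z) (of_real t * q)) \<le> C"
      by (rule kern_locally_bounded[OF z0]) (rule that)
    have off: "off_ray q (Some z)" if "z \<in> ball z0 \<delta>" for z using d(2) that by (intro off_rayI) auto
    have "(\<lambda>z. \<integral>t. ray_integrand q (Some z) h t \<partial>lborel) holomorphic_on ball z0 \<delta>"
    proof (rule holomorphic_lebesgue_integral)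
      show "integrable lborel (\<lambda>t. C * M * (indicator {0<..} t *\<^sub>R (damping (k * t) / t)))"
        by (rule damping_majorant[OF k])
      show "(\<lambda>z. ray_integrand q (Some z) h t) holomorphic_on ball z0 \<delta>" for t
      proof (cases "t > 0")
        case True
        then have "of_real t * q - z \<noteq> 0" if "z \<in> ball z0 \<delta>" for z
          using off[OF that] by (auto simp: off_ray_def)
        then show ?thesis using True by (auto simp: ray_integrand_def intro!: holomorphic_intros)
      qed (simp add: ray_integrand_def)
    qed (use ray_integrand_measurable[OF off h] ray_integrand_bound[OF h d(3)] in auto)
    then show ?thesis using d(1) holomorphic_on_open[OF open_ball, of _ z0 \<delta>]
      by (auto simp: ray_integral_eq)
  qed
  then show ?thesis
    using closed_closed_ray[of q] by (auto simp: holomorphic_on_open open_Compl)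
qed

text \<open>In the coordinate \<open>u = 1 / z\<close> the kernel is \<open>(u \<zeta>' + 1) / (u \<zeta>' - 1)\<close>, which is continuous at \<open>u = 0\<close> with
  the value \<open>-1\<close> that \<open>kern\<close> has at \<open>\<infinity>\<close>.\<close>

lemma ray_integral_at_infinity:
  assumes k: "k > 0" and h: "damped_on_ray k M q h"
    and off: "\<And>z. z \<in> A \<Longrightarrow> off_ray q (Some z)"
    and C: "\<And>z t. z \<in> A \<Longrightarrow> t > 0 \<Longrightarrow> cmod (kern (Some z) (of_real t * q)) \<le> C"
  shows "((\<lambda>z. ray_integral q (Some z) h) \<longlongrightarrow> ray_integral q None h) (inf at_infinity (principal A))"
proof -
  define \<kappa> where "\<kappa> u = (if u = 0 then None else Some (inverse u))" for u :: complex
  define A' where "A' = insert 0 {u. u \<noteq> 0 \<and> inverse u \<in> A}"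
  have kern_eq: "kern (\<kappa> u) x = (u * x + 1) / (u * x - 1)" for u x
  proof (cases "u = 0")
    case False
    then have "(x + inverse u) / (x - inverse u) = (u * (x + inverse u)) / (u * (x - inverse u))" by simp
    then show ?thesis using False by (simp add: \<kappa>_def algebra_simps)
  qed (simp add: \<kappa>_def)
  have nz: "u * (of_real t * q) - 1 \<noteq> 0" if "u \<in> A'" "t > 0" for u t
  proof
    assume "u * (of_real t * q) - 1 = 0"
    then have *: "u * (of_real t * q) = 1" by simp
    then have "u \<noteq> 0" by auto
    moreover have "inverse u = of_real t * q" by (rule inverse_unique[OF *])
    ultimately show False using off[of "inverse u"] that by (auto simp: A'_def off_ray_def)
  qed
  have "continuous_on A' (\<lambda>u. ray_integral q (\<kappa> u) h)"
  proof (rule ray_integral_continuous[OF k h])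
    show "off_ray q (\<kappa> x)" if "x \<in> A'" for x
      using off[of "inverse x"] that by (auto simp: A'_def \<kappa>_def off_ray_def)
    show "cmod (kern (\<kappa> x) (of_real t * q)) \<le> max 1 C" if "x \<in> A'" "t > 0" for x t
      using C[of "inverse x" t] that by (auto simp: A'_def \<kappa>_def)
    show "continuous_on A' (\<lambda>x. kern (\<kappa> x) (of_real t * q))" if "t > 0" for t
      unfolding kern_eq using nz that by (auto intro!: continuous_intros)
  qed
  then have "((\<lambda>u. ray_integral q (\<kappa> u) h) \<longlongrightarrow> ray_integral q (\<kappa> 0) h) (at 0 within A')"
    by (auto simp: continuous_on_def A'_def)
  moreover have "filterlim (inverse :: complex \<Rightarrow> complex) (at 0 within A') (inf at_infinity (principal A))"
    unfolding filterlim_at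
  proof
    have "filterlim (inverse :: complex \<Rightarrow> complex) (nhds 0) at_infinity" using tendsto_inverse_0 .
    then show "(inverse \<longlongrightarrow> (0 :: complex)) (inf at_infinity (principal A))"
      by (rule filterlim_mono) auto
    have "\<forall>\<^sub>F x in at_infinity. (x :: complex) \<noteq> 0"
      unfolding eventually_at_infinity by (rule exI[of _ 1]) auto
    then show "\<forall>\<^sub>F x in inf at_infinity (principal A). inverse x \<in> A' \<and> inverse x \<noteq> 0"
      unfolding eventually_inf_principal by eventually_elim (auto simp: A'_def)
  qed
  ultimately have "((\<lambda>z. ray_integral q (\<kappa> (inverse z)) h) \<longlongrightarrow> ray_integral q (\<kappa> 0) h) (inf at_infinity (principal A))"
    using filterlim_compose by blast
  moreover have "\<forall>\<^sub>F z in inf at_infinity (principal A). \<kappa> (inverse z) = Some z"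
    unfolding eventually_inf_principal eventually_at_infinity
    by (rule exI[of _ 1]) (auto simp: \<kappa>_def)
  then have "\<forall>\<^sub>F z in inf at_infinity (principal A). ray_integral q (\<kappa> (inverse z)) h = ray_integral q (Some z) h"
    by eventually_elim simp
  ultimately show ?thesis
    using tendsto_cong by (fastforce simp: \<kappa>_def)
qed

text \<open>The density \<open>F\<close> must vanish at the origin because the segment, unlike the ray, contains it.\<close>

lemma linepath_integral_tendsto_ray:
  assumes int: "set_integrable lborel {0<..} (\<lambda>t. F (of_real t * q) * q)" and F0: "F 0 = 0"
  shows "((\<lambda>N. contour_integral (linepath 0 (of_real N * q)) F) \<longlongrightarrow>
     (LINT t:{0<..}|lborel. F (of_real t * q) * q)) at_top"
proof -
  define G where "G t = F (of_real t * q) * q" for t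
  have ind: "indicator {0..} t *\<^sub>R G t = indicator {0<..} t *\<^sub>R G t" for t :: real
    using F0 by (auto simp: indicator_def G_def)
  have int0: "set_integrable lborel {0..} G"
    using int unfolding set_integrable_def G_def[symmetric] ind .
  have eq: "contour_integral (linepath 0 (of_real N * q)) F = (LINT t:{0..N}|lborel. G t)" if "N > 0" for N
  proof -
    have intN: "set_integrable lborel {0..N} G" by (rule set_integrable_subset[OF int0]) auto
    define I where "I = (LINT t:{0..N}|lborel. G t)"
    have "(G has_integral I) {0..N}"
      using set_borel_integral_eq_integral[OF intN] by (simp add: I_def has_integral_iff)
    then have "((\<lambda>x. G (N * x)) has_integral (1 / \<bar>N\<bar>) *\<^sub>R I) ((\<lambda>x. x / N) ` {0..N})"
      by (rule has_integral_stretch_real) (use that in simp)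
    moreover have "(\<lambda>x. x / N) ` {0..N} = {0..1}"
    proof
      show "{0..1} \<subseteq> (\<lambda>x. x / N) ` {0..N}"
      proof
        fix x :: real assume "x \<in> {0..1}"
        then show "x \<in> (\<lambda>x. x / N) ` {0..N}"
          using that by (intro image_eqI[of _ _ "N * x"]) (auto simp: mult_left_le)
      qed
    qed (use that in \<open>auto simp: divide_le_eq\<close>)
    ultimately have "((\<lambda>x. G (N * x)) has_integral (1 / N) *\<^sub>R I) {0..1}" using that by simp
    from has_integral_mult_right[OF this, of "of_real N"]
    have "((\<lambda>x. of_real N * G (N * x)) has_integral I) {0..1}" using that by (simp add: scaleR_conv_of_real)
    then have "(F has_contour_integral I) (linepath 0 (of_real N * q))"
      unfolding has_contour_integral_linepath
      by (simp add: G_def linepath_def scaleR_conv_of_real mult_ac)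
    then show ?thesis unfolding I_def by (rule contour_integral_unique)
  qed
  have "((\<lambda>N. LINT t:{0..N}|lborel. G t) \<longlongrightarrow> (LINT t:{0..}|lborel. G t)) at_top"
    by (rule tendsto_set_lebesgue_integral_at_top[OF _ int0]) auto
  moreover have "(LINT t:{0..}|lborel. G t) = (LINT t:{0<..}|lborel. G t)"
    unfolding set_lebesgue_integral_def ind ..
  moreover have "\<forall>\<^sub>F N in at_top. (LINT t:{0..N}|lborel. G t) = contour_integral (linepath 0 (of_real N * q)) F"
    using eventually_gt_at_top[of 0] by eventually_elim (simp add: eq)
  ultimately have "((\<lambda>N. contour_integral (linepath 0 (of_real N * q)) F) \<longlongrightarrow> (LINT t:{0<..}|lborel. G t)) at_top"
    using Lim_transform_eventually by force
  then show ?thesis unfolding G_def .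
qed

section \<open>Rotation of the ray\<close>

text \<open>After division by the direction, each ray is the positive real axis. The sign \<open>s\<close> tells on which side the
  integrand is holomorphic, and \<open>m\<close> is the slope of the rotated ray; with slopes instead of angles all
  estimates are linear in the coordinates.\<close>

definition sector :: "real \<Rightarrow> real \<Rightarrow> complex set" where
  "sector s m = {w. 0 \<le> s * Im w \<and> s * Im w \<le> m * Re w}"

definition open_sector :: "real \<Rightarrow> real \<Rightarrow> complex set" where
  "open_sector s m = {w. 0 < s * Im w \<and> s * Im w < m * Re w}"

definition tilt :: "real \<Rightarrow> real \<Rightarrow> complex" where "tilt s m = Complex 1 (s * m)"

definition damped :: "real \<Rightarrow> real \<Rightarrow> real \<Rightarrow> real \<Rightarrow> (complex \<Rightarrow> complex) \<Rightarrow> bool" where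
  "damped s m k M h \<longleftrightarrow> continuous_on (sector s m - {0}) h \<and> h holomorphic_on open_sector s m \<and>
     (\<forall>w\<in>sector s m - {0}. cmod (h w) \<le> M * damping (k * cmod w))"

text \<open>The transition from the rotated to the original ray takes place on the lines of half the slope, which
  are at a positive angle from both.\<close>

definition near_ray :: "real \<Rightarrow> complex \<Rightarrow> bool" where
  "near_ray m w \<longleftrightarrow> w \<noteq> 0 \<and> \<bar>Im w\<bar> \<le> m / 2 * Re w"

text \<open>The Cauchy integral over the positive axis, in a form which is bounded up to the axis. On the axis itself
  it has the boundary values from the side \<open>s\<close> if \<open>b\<close> holds. Without \<open>b\<close> the residue is left out; the formula is
  then meant for the closed other side, with the boundary values from there. The factor \<open>4 \<pi> \<i>\<close> is \<open>2 \<pi> \<i>\<close> times the residue \<open>2\<close> of the kernel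
  \<open>(\<zeta>' + \<zeta>) / (\<zeta>' - \<zeta>) d\<zeta>' / \<zeta>'\<close> at \<open>\<zeta>' = \<zeta>\<close>.\<close>

definition sided_integral :: "bool \<Rightarrow> real \<Rightarrow> real \<Rightarrow> (complex \<Rightarrow> complex) \<Rightarrow> complex option \<Rightarrow> complex" where
  "sided_integral b s m h \<zeta> = (case \<zeta> of None \<Rightarrow> ray_integral 1 None h
     | Some w \<Rightarrow> if near_ray m w
         then ray_integral (tilt s m) (Some w) h
              + (if b \<and> 0 \<le> s * Im w then 4 * of_real pi * \<i> * of_real s * h w else 0)
         else ray_integral 1 (Some w) h)"

text \<open>The value \<open>0\<close> at the origin is the limit there when \<open>h\<close> is damped (\<open>cauchy_form_continuous\<close>); the closed
  triangle with vertex \<open>0\<close> is then a legitimate domain for Cauchy's theorem.\<close>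

definition cauchy_form :: "complex option \<Rightarrow> (complex \<Rightarrow> complex) \<Rightarrow> complex \<Rightarrow> complex" where
  "cauchy_form \<zeta> h w = (if w = 0 then 0 else kern \<zeta> w * h w / w)"

lemma open_open_sector: "open (open_sector s m)"
  unfolding open_sector_def by (intro open_Collect_conj open_Collect_less continuous_intros)

lemma open_sector_subset: "open_sector s m \<subseteq> sector s m - {0}"
  by (auto simp: open_sector_def sector_def)

lemma sector_halfspaces: "sector s m = {w. Complex 0 s \<bullet> w \<ge> 0} \<inter> {w. Complex m (- s) \<bullet> w \<ge> 0}"
  by (auto simp: sector_def inner_complex_def)

lemma convex_sector: "convex (sector s m)"
  unfolding sector_halfspaces by (intro convex_Int convex_halfspace_ge)

lemma damping_le:
  assumes "x > 0" shows "damping x \<le> 1" "damping x \<le> 1 / x"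
proof -
  have "damping x \<le> exp (- x)" using assms by (simp add: damping_def)
  moreover have "exp (- x) \<le> 1" using assms by simp
  moreover have "x \<le> exp x" using exp_ge_add_one_self[of x] by linarith
  then have "exp (- x) \<le> 1 / x" using assms by (simp add: exp_minus field_simps)
  ultimately show "damping x \<le> 1" "damping x \<le> 1 / x" by linarith+
qed

lemma norm_divide_le:
  assumes "cmod a \<le> C * cmod b" "C \<ge> 0" shows "cmod (a / b) \<le> C"
  using assms by (cases "b = 0") (auto simp: norm_divide divide_le_eq)

text \<open>The constant \<open>3\<close>, here and at infinity, is what the triangle inequality gives when
  one of \<open>\<bar>w\<bar>\<close>, \<open>\<bar>z\<bar>\<close> is at most half of the other.\<close>

lemma kern_near_0: "\<exists>\<epsilon>>0. \<forall>w. w \<noteq> 0 \<longrightarrow> cmod w < \<epsilon> \<longrightarrow> cmod (kern \<zeta> w) \<le> 3"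
proof (cases \<zeta>)
  case (Some z)
  show ?thesis
  proof (cases "z = 0")
    case False
    show ?thesis
    proof (intro exI[of _ "cmod z / 2"] conjI allI impI)
      fix w assume "cmod w < cmod z / 2"
      then have "cmod (w + z) \<le> 3 * cmod (w - z)"
        using norm_triangle_ineq[of w z] norm_triangle_ineq2[of z w] by (simp add: norm_minus_commute)
      then show "cmod (kern \<zeta> w) \<le> 3" using Some norm_divide_le[of "w + z" 3 "w - z"] by simp
    qed (use False in simp)
  qed (use Some in \<open>auto intro!: exI[of _ 1]\<close>)
qed (auto intro!: exI[of _ 1])

lemma kern_near_infinity: "\<exists>N>0. \<forall>w. N \<le> cmod w \<longrightarrow> cmod (kern \<zeta> w) \<le> 3"
proof (cases \<zeta>)
  case (Some z)
  show ?thesis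
  proof (intro exI[of _ "2 * cmod z + 1"] conjI allI impI)
    fix w assume "2 * cmod z + 1 \<le> cmod w"
    then have "cmod (w + z) \<le> 3 * cmod (w - z)"
      using norm_triangle_ineq[of w z] norm_triangle_ineq2[of w z] norm_ge_zero[of z] by linarith
    then show "cmod (kern \<zeta> w) \<le> 3" using Some norm_divide_le[of "w + z" 3 "w - z"] by simp
  qed (use norm_ge_zero[of z] in linarith)
qed (auto intro!: exI[of _ 1])

locale tilted_sector =
  fixes s m k :: real
  assumes s: "s = 1 \<or> s = - 1" and m: "0 < m" "m \<le> 1" and k: "0 < k"
begin

lemma tilt_simps [simp]: "Re (tilt s m) = 1" "Im (tilt s m) = s * m" "tilt s m \<noteq> 0"
  by (auto simp: tilt_def complex_eq_iff)

lemma s_sq [simp]: "s * s = 1" "s * (s * x) = x" using s by auto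

lemma ray_in_sector:
  assumes "t > 0" "q = 1 \<or> q = tilt s m" shows "of_real t * q \<in> sector s m - {0}"
  using assms m s by (auto simp: sector_def complex_eq_iff mult.left_commute)

lemma damped_nonneg: "damped s m k M h \<Longrightarrow> 0 \<le> M"
proof -
  assume h: "damped s m k M h"
  have "1 \<in> sector s m - {0}" using m by (simp add: sector_def)
  with h have "cmod (h 1) \<le> M * damping (k * cmod 1)" unfolding damped_def by blast
  then have "0 \<le> M * damping (k * cmod 1)" by (rule order_trans[OF norm_ge_zero])
  then show ?thesis using damping_pos[of "k * cmod 1"] by (simp add: zero_le_mult_iff)
qed

lemma damped_rayD:
  assumes "damped s m k M h" "q = 1 \<or> q = tilt s m"
  shows "damped_on_ray (k * cmod q) M q h"
  unfolding damped_on_ray_def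
proof (intro conjI allI impI)
  show "continuous_on {0<..} (\<lambda>t. h (of_real t * q))"
    by (rule continuous_on_compose2[of "sector s m - {0}"])
       (use assms ray_in_sector in \<open>auto simp: damped_def intro!: continuous_intros\<close>)
  fix t :: real assume t: "t > 0"
  have "cmod (h (of_real t * q)) \<le> M * damping (k * cmod (of_real t * q))"
    using assms ray_in_sector[OF t assms(2)] by (simp add: damped_def)
  also have "k * cmod (of_real t * q) = k * cmod q * t" using t by (simp add: norm_mult)
  finally show "cmod (h (of_real t * q)) \<le> M * damping (k * cmod q * t)" .
qed

lemma ray_scale_pos: "q = 1 \<or> q = tilt s m \<Longrightarrow> k * cmod q > 0" using k by auto

lemma damped_diff:
  assumes "damped s m k M h" "damped s m k M' h'"
  shows "damped s m k (M + M') (\<lambda>w. h w - h' w)"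
  unfolding damped_def
proof (intro conjI ballI)
  fix w assume w: "w \<in> sector s m - {0}"
  have "cmod (h w - h' w) \<le> cmod (h w) + cmod (h' w)" by (rule norm_triangle_ineq4)
  also have "\<dots> \<le> M * damping (k * cmod w) + M' * damping (k * cmod w)"
    using assms w by (intro add_mono) (auto simp: damped_def)
  finally show "cmod (h w - h' w) \<le> (M + M') * damping (k * cmod w)" by (simp add: distrib_right)
qed (use assms in \<open>auto simp: damped_def intro!: continuous_intros holomorphic_intros\<close>)

lemma cauchy_form_bound:
  assumes h: "damped s m k M h" and w: "w \<in> sector s m - {0}" and "cmod (kern \<zeta> w) \<le> 3"
  shows "cmod (cauchy_form \<zeta> h w) \<le> 3 * M * (damping (k * cmod w) / cmod w)"
proof -
  have "cmod (kern \<zeta> w) * cmod (h w) \<le> 3 * (M * damping (k * cmod w))"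
    using assms by (intro mult_mono) (auto simp: damped_def)
  then show ?thesis using w
    by (simp add: cauchy_form_def norm_mult norm_divide divide_right_mono mult.assoc)
qed

lemma cauchy_form_continuous:
  assumes h: "damped s m k M h" and S: "S \<subseteq> sector s m"
    and z: "\<And>z. \<zeta> = Some z \<Longrightarrow> z = 0 \<or> z \<notin> S"
  shows "continuous_on S (cauchy_form \<zeta> h)"
  unfolding continuous_on_eq_continuous_within
proof
  fix x assume x: "x \<in> S"
  show "continuous (at x within S) (cauchy_form \<zeta> h)"
  proof (cases "x = 0")
    case True
    obtain \<epsilon> where e: "\<epsilon> > 0" "\<And>w. w \<noteq> 0 \<Longrightarrow> cmod w < \<epsilon> \<Longrightarrow> cmod (kern \<zeta> w) \<le> 3"
      using kern_near_0 by blast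
    have "(cauchy_form \<zeta> h \<longlongrightarrow> 0) (at 0 within S)"
    proof (rule Lim_null_comparison)
      have "\<forall>\<^sub>F w in at 0 within S. w \<in> S \<and> w \<noteq> 0 \<and> dist w 0 < \<epsilon>"
        using e(1) unfolding eventually_at by auto
      then show "\<forall>\<^sub>F w in at 0 within S. norm (cauchy_form \<zeta> h w) \<le> 3 * M * (2 * k\<^sup>2 * cmod w)"
      proof eventually_elim
        case (elim w)
        have "cmod (cauchy_form \<zeta> h w) \<le> 3 * M * (damping (k * cmod w) / cmod w)"
          by (rule cauchy_form_bound[OF h]) (use elim S e(2)[of w] in auto)
        also have "\<dots> \<le> 3 * M * (2 * k\<^sup>2 * cmod w)"
          by (rule mult_left_mono[OF damping_div_le(2)]) (use damped_nonneg[OF h] elim k in auto)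
        finally show ?case .
      qed
      have "((\<lambda>w. 3 * M * (2 * k\<^sup>2 * cmod w)) \<longlongrightarrow> 3 * M * (2 * k\<^sup>2 * cmod 0)) (at 0 within S)"
        by (intro tendsto_intros)
      then show "((\<lambda>w. 3 * M * (2 * k\<^sup>2 * cmod w)) \<longlongrightarrow> 0) (at 0 within S)" by simp
    qed
    then show ?thesis using True by (simp add: continuous_within cauchy_form_def)
  next
    case False
    have "continuous_on (S - {0}) (\<lambda>w. kern \<zeta> w * h w / w)"
    proof -
      have "continuous_on (S - {0}) (kern \<zeta>)"
      proof (cases \<zeta>)
        case (Some z)
        then have "w - z \<noteq> 0" if "w \<in> S - {0}" for w using z[OF Some] that by auto
        then show ?thesis using Some by (auto intro!: continuous_intros)
      qed simp
      moreover have "continuous_on (S - {0}) h"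
        using h S by (auto simp: damped_def intro: continuous_on_subset)
      ultimately show ?thesis by (auto intro!: continuous_intros)
    qed
    then have "continuous_on (S - {0}) (cauchy_form \<zeta> h)"
      by (rule continuous_on_eq) (auto simp: cauchy_form_def)
    then have "continuous (at x within (S - {0})) (cauchy_form \<zeta> h)"
      using x False by (simp add: continuous_on_eq_continuous_within)
    moreover have "at x within (S - {0}) = at x within S"
      by (rule at_within_nhd[of _ "- {0}"]) (use False in auto)
    ultimately show ?thesis by simp
  qed
qed

lemma ray_integral_cauchy_form:
  assumes "q \<noteq> 0"
  shows "ray_integral q \<zeta> h = (LINT t:{0<..}|lborel. cauchy_form \<zeta> h (of_real t * q) * q)"
  unfolding ray_integral_def
  by (rule set_lebesgue_integral_cong) (use assms in \<open>auto simp: cauchy_form_def\<close>)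

lemma truncated_ray_tendsto:
  assumes h: "damped s m k M h" and q: "q = 1 \<or> q = tilt s m" and off: "off_ray q \<zeta>"
    and C: "\<And>t. t > 0 \<Longrightarrow> cmod (kern \<zeta> (of_real t * q)) \<le> C"
  shows "((\<lambda>N. contour_integral (linepath 0 (of_real N * q)) (cauchy_form \<zeta> h)) \<longlongrightarrow> ray_integral q \<zeta> h) at_top"
proof -
  have q0: "q \<noteq> 0" using q by auto
  have "integrable lborel (ray_integrand q \<zeta> h)"
    by (rule ray_integrand_integrable[OF ray_scale_pos[OF q] off damped_rayD[OF h q] C])
  moreover have "ray_integrand q \<zeta> h = (\<lambda>t. indicator {0<..} t *\<^sub>R (cauchy_form \<zeta> h (of_real t * q) * q))"
    using q0 by (auto simp: ray_integrand_def cauchy_form_def indicator_def)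
  ultimately have "set_integrable lborel {0<..} (\<lambda>t. cauchy_form \<zeta> h (of_real t * q) * q)"
    by (simp add: set_integrable_def)
  moreover have "cauchy_form \<zeta> h 0 = 0" by (simp add: cauchy_form_def)
  ultimately show ?thesis
    unfolding ray_integral_cauchy_form[OF q0] by (rule linepath_integral_tendsto_ray)
qed

lemma hull_in_sector:
  assumes "N \<ge> 0"
  shows "convex hull {0, of_real N, of_real N * tilt s m} \<subseteq> sector s m"
proof (rule hull_minimal)
  show "{0, of_real N, of_real N * tilt s m} \<subseteq> sector s m"
    using assms m s by (auto simp: sector_def mult.left_commute)
qed (rule convex_sector)

text \<open>A point \<open>w\<close> of the truncated sector has barycentric coordinates \<open>\<beta> = s Im w / (N m)\<close> at the tilted vertex
  and \<open>Re w / N - \<beta>\<close> at the real one.\<close>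

lemma open_sector_in_hull:
  assumes "N > 0"
  shows "{w \<in> open_sector s m. Re w < N} \<subseteq> interior (convex hull {0, of_real N, of_real N * tilt s m})"
proof (rule interior_maximal)
  show "open {w \<in> open_sector s m. Re w < N}"
    using open_open_sector by (auto intro!: open_Collect_conj open_Collect_less continuous_intros simp: open_sector_def)
  show "{w \<in> open_sector s m. Re w < N} \<subseteq> convex hull {0, of_real N, of_real N * tilt s m}"
  proof
    fix w assume w: "w \<in> {w \<in> open_sector s m. Re w < N}"
    define \<beta> where "\<beta> = s * Im w / (N * m)"
    define \<alpha> where "\<alpha> = Re w / N - \<beta>"
    have b: "\<beta> \<ge> 0" using w assms m by (simp add: \<beta>_def open_sector_def)
    have "\<beta> \<le> Re w / N" using w assms m by (simp add: \<beta>_def open_sector_def field_simps)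
    then have a: "\<alpha> \<ge> 0" by (simp add: \<alpha>_def)
    have c: "\<alpha> + \<beta> \<le> 1" using w assms by (simp add: \<alpha>_def)
    have "w = 0 + \<alpha> *\<^sub>R (of_real N - 0) + \<beta> *\<^sub>R (of_real N * tilt s m - 0)"
      using assms m by (simp add: complex_eq_iff \<alpha>_def \<beta>_def field_simps)
    then show "w \<in> convex hull {0, of_real N, of_real N * tilt s m}"
      unfolding convex_hull_3_alt using a b c by blast
  qed
qed

lemma interior_hull_in_open_sector:
  assumes "N \<ge> 0"
  shows "interior (convex hull {0, of_real N, of_real N * tilt s m}) \<subseteq> open_sector s m"
proof -
  have "Complex 0 s \<noteq> 0" "Complex m (- s) \<noteq> 0" using s by (auto simp: complex_eq_iff)
  then have "interior (sector s m) = {w. Complex 0 s \<bullet> w > 0} \<inter> {w. Complex m (- s) \<bullet> w > 0}"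
    unfolding sector_halfspaces interior_Int by (metis interior_halfspace_ge)
  also have "\<dots> = open_sector s m" by (auto simp: open_sector_def inner_complex_def)
  finally show ?thesis using interior_mono[OF hull_in_sector[OF assms]] by simp
qed

lemma segments_in_hull:
  "closed_segment 0 (of_real N) \<subseteq> convex hull {0, of_real N, of_real N * tilt s m}"
  "closed_segment (of_real N) (of_real N * tilt s m) \<subseteq> convex hull {0, of_real N, of_real N * tilt s m}"
  "closed_segment 0 (of_real N * tilt s m) \<subseteq> convex hull {0, of_real N, of_real N * tilt s m}"
  unfolding segment_convex_hull by (rule hull_mono; simp)+

text \<open>The triangles with vertices \<open>0\<close>, \<open>N\<close> and \<open>N\<close> times the tilted direction exhaust the sector. Along the side
  opposite to \<open>0\<close> the integrand is exponentially small, while the length of this side grows linearly.\<close>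

lemma ray_rotation:
  assumes h: "damped s m k M h"
    and off: "off_ray 1 \<zeta>" "off_ray (tilt s m) \<zeta>"
    and C: "\<And>t. t > 0 \<Longrightarrow> cmod (kern \<zeta> (of_real t * 1)) \<le> C" "\<And>t. t > 0 \<Longrightarrow> cmod (kern \<zeta> (of_real t * tilt s m)) \<le> C'"
    and seg: "\<And>N. N \<ge> N\<^sub>0 \<Longrightarrow> continuous_on (closed_segment 0 (of_real N * tilt s m)) (cauchy_form \<zeta> h)"
      "\<And>N. N \<ge> N\<^sub>0 \<Longrightarrow> continuous_on (closed_segment (of_real N) (of_real N * tilt s m)) (cauchy_form \<zeta> h)"
    and tri: "\<And>N. N \<ge> N\<^sub>0 \<Longrightarrow> (cauchy_form \<zeta> h has_contour_integral c)
       (linepath 0 (of_real N) +++ linepath (of_real N) (of_real N * tilt s m) +++ linepath (of_real N * tilt s m) 0)"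
  shows "ray_integral 1 \<zeta> h = ray_integral (tilt s m) \<zeta> h + c"
proof -
  let ?F = "cauchy_form \<zeta> h"
  obtain N1 where N1: "N1 > 0" "\<And>w. N1 \<le> cmod w \<Longrightarrow> cmod (kern \<zeta> w) \<le> 3"
    using kern_near_infinity by blast
  define A B T where "A N = contour_integral (linepath 0 (of_real N * 1)) ?F"
    and "B N = contour_integral (linepath 0 (of_real N * tilt s m)) ?F"
    and "T N = contour_integral (linepath (of_real N) (of_real N * tilt s m)) ?F" for N
  have A: "(A \<longlongrightarrow> ray_integral 1 \<zeta> h) at_top"
    unfolding A_def by (rule truncated_ray_tendsto[OF h _ off(1) C(1)]) auto
  have B: "(B \<longlongrightarrow> ray_integral (tilt s m) \<zeta> h) at_top"
    unfolding B_def by (rule truncated_ray_tendsto[OF h _ off(2) C(2)]) auto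
  have T: "(T \<longlongrightarrow> 0) at_top"
  proof (rule Lim_null_comparison)
    show "\<forall>\<^sub>F N in at_top. norm (T N) \<le> 6 * M / k / N"
      using eventually_ge_at_top[of N\<^sub>0] eventually_ge_at_top[of N1]
    proof eventually_elim
      case (elim N)
      have N: "N > 0" using elim N1 by simp
      have "norm (T N) \<le> 3 * M * (k * exp (- k * N)) * norm (of_real N * tilt s m - of_real N)"
        unfolding T_def
      proof (rule contour_integral_bound_linepath)
        show "?F contour_integrable_on linepath (of_real N) (of_real N * tilt s m)"
          by (rule contour_integrable_continuous_linepath[OF seg(2)[OF elim(1)]])
        show "0 \<le> 3 * M * (k * exp (- k * N))" using damped_nonneg[OF h] k by simp
        fix x assume x: "x \<in> closed_segment (of_real N) (of_real N * tilt s m)"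
        then obtain u where u: "0 \<le> u" "u \<le> 1" "x = (1 - u) *\<^sub>R of_real N + u *\<^sub>R (of_real N * tilt s m)"
          by (auto simp: closed_segment_def)
        have "Re x = N" unfolding u(3) by (simp add: algebra_simps)
        then have xN: "N \<le> cmod x" using complex_Re_le_cmod[of x] by simp
        then have x0: "x \<in> sector s m - {0}" 
          using x hull_in_sector[of N] segments_in_hull(2)[of N] N by auto
        have "cmod (?F x) \<le> 3 * M * (damping (k * cmod x) / cmod x)"
          by (rule cauchy_form_bound[OF h x0 N1(2)]) (use xN elim in simp)
        also have "\<dots> \<le> 3 * M * (k * exp (- k * cmod x))"
          by (rule mult_left_mono[OF damping_div_le(1)]) (use k xN N damped_nonneg[OF h] in auto)
        also have "\<dots> \<le> 3 * M * (k * exp (- k * N))"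
          by (intro mult_left_mono) (use k xN damped_nonneg[OF h] in auto)
        finally show "cmod (?F x) \<le> 3 * M * (k * exp (- k * N))" .
      qed
      also have "norm (of_real N * tilt s m - of_real N) = N * m"
      proof -
        have "of_real N * tilt s m - of_real N = Complex 0 (N * (s * m))" by (simp add: complex_eq_iff)
        moreover have "cmod (Complex 0 x) = \<bar>x\<bar>" for x by (simp add: cmod_def)
        ultimately show ?thesis using N m s by (auto simp: abs_mult)
      qed
      also have "3 * M * (k * exp (- k * N)) * (N * m) \<le> 3 * M * (k * (2 / (k * N)\<^sup>2)) * (N * 1)"
      proof (intro mult_mono mult_left_mono)
        have "1 + k * N + (k * N)\<^sup>2 / 2 \<le> exp (k * N)"
          by (rule exp_lower_Taylor_quadratic) (use k N in simp)
        moreover have "k * N > 0" using k N by simp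
        ultimately have "(k * N)\<^sup>2 \<le> 2 * exp (k * N)" by linarith
        then show "exp (- k * N) \<le> 2 / (k * N)\<^sup>2" using k N by (simp add: exp_minus field_simps)
      qed (use damped_nonneg[OF h] k N m in auto)
      also have "\<dots> = 6 * M / k / N" using k N by (simp add: field_simps power2_eq_square)
      finally show ?case .
    qed
    show "((\<lambda>N. 6 * M / k / N) \<longlongrightarrow> 0) at_top"
      by (rule tendsto_divide_0[OF tendsto_const filterlim_at_top_imp_at_infinity[OF filterlim_ident]])
  qed
  have "\<forall>\<^sub>F N in at_top. A N + T N - B N = c"
    using eventually_ge_at_top[of N\<^sub>0]
  proof eventually_elim
    case (elim N)
    have "contour_integral (linepath (of_real N * tilt s m) 0) ?F = - B N"
      using contour_integral_reverse_linepath[OF seg(1)[OF elim]] by (simp add: B_def)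
    then show ?case using has_chain_integral_chain_integral3[OF tri[OF elim]] by (simp add: A_def T_def)
  qed
  then have "((\<lambda>N. A N + T N - B N) \<longlongrightarrow> c) at_top" by (rule tendsto_eventually)
  moreover have "((\<lambda>N. A N + T N - B N) \<longlongrightarrow> ray_integral 1 \<zeta> h + 0 - ray_integral (tilt s m) \<zeta> h) at_top"
    by (intro tendsto_intros A B T)
  ultimately have "ray_integral 1 \<zeta> h + 0 - ray_integral (tilt s m) \<zeta> h = c"
    using tendsto_unique trivial_limit_at_top_linorder by blast
  then show ?thesis by (simp add: algebra_simps)
qed

lemma closed_rays_in_sector:
  assumes "q = 1 \<or> q = tilt s m" "z \<in> closed_ray q"
  shows "z \<in> sector s m" "z \<notin> open_sector s m"
proof -
  have "(z \<in> sector s m \<and> z \<notin> open_sector s m)"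
  proof (cases "q = 1")
    case True
    then show ?thesis using assms m by (auto simp: closed_ray_def sector_def open_sector_def)
  next
    case False
    then have q: "q = tilt s m" using assms by simp
    have 1: "Im z = s * m * Re z" using assms(2) by (simp add: q closed_ray_def)
    then have "Re (z * cnj q) = Re z * (1 + m * m)"
      by (simp add: q algebra_simps)
    then have "0 \<le> Re z" using assms(2) m by (simp add: closed_ray_def zero_le_mult_iff add_pos_pos)
         (smt (verit) mult_pos_pos)
    then show ?thesis using 1 m by (simp add: sector_def open_sector_def mult.assoc)
  qed
  then show "z \<in> sector s m" "z \<notin> open_sector s m" by auto
qed

lemma kern_bounded_outside:
  assumes "\<And>z. \<zeta> = Some z \<Longrightarrow> z = 0 \<or> z \<notin> closed_ray q" and q: "q \<noteq> 0"
  shows "off_ray q \<zeta>" "\<exists>C. \<forall>t>0. cmod (kern \<zeta> (of_real t * q)) \<le> C"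
proof -
  have "off_ray q \<zeta> \<and> (\<exists>C. \<forall>t>0. cmod (kern \<zeta> (of_real t * q)) \<le> C)"
  proof (cases \<zeta>)
    case (Some z)
    show ?thesis
    proof (cases "z = 0")
      case True
      then show ?thesis using Some q by (auto simp: off_ray_def intro!: exI[of _ 1])
    next
      case False
      then have z: "z \<notin> closed_ray q" using assms Some by auto
      obtain \<delta> C where *: "\<delta> > 0" "\<And>x t. x \<in> ball z \<delta> \<Longrightarrow> t > 0 \<Longrightarrow> cmod (kern (Some x) (of_real t * q)) \<le> C"
        by (rule kern_locally_bounded[OF z]) (rule that)
      then have "\<forall>t>0. cmod (kern \<zeta> (of_real t * q)) \<le> C" using Some by auto
      then show ?thesis using off_rayI[OF z] Some by auto
    qed
  qed (auto simp: off_ray_def intro!: exI[of _ 1])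
  then show "off_ray q \<zeta>" "\<exists>C. \<forall>t>0. cmod (kern \<zeta> (of_real t * q)) \<le> C" by auto
qed

text \<open>Without a singularity in the sector the contour integrals vanish. The points \<open>0\<close> and \<open>\<infinity>\<close> belong here, since
  the kernel is constant for them.\<close>

lemma ray_rotation_outside:
  assumes h: "damped s m k M h" and out: "\<And>z. \<zeta> = Some z \<Longrightarrow> z = 0 \<or> z \<notin> sector s m"
  shows "ray_integral 1 \<zeta> h = ray_integral (tilt s m) \<zeta> h"
proof -
  have out': "z = 0 \<or> z \<notin> closed_ray q" if "\<zeta> = Some z" "q = 1 \<or> q = tilt s m" for z q
    using out[OF that(1)] closed_rays_in_sector[OF that(2)] by blast
  have off: "off_ray 1 \<zeta>" "off_ray (tilt s m) \<zeta>"
    by (rule kern_bounded_outside(1)[OF out'], auto)+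
  obtain C where C: "\<And>t. t > 0 \<Longrightarrow> cmod (kern \<zeta> (of_real t * 1)) \<le> C"
    using kern_bounded_outside(2)[of \<zeta> 1] out' by auto
  obtain C' where C': "\<And>t. t > 0 \<Longrightarrow> cmod (kern \<zeta> (of_real t * tilt s m)) \<le> C'"
    using kern_bounded_outside(2)[of \<zeta> "tilt s m"] out' by auto
  have cont: "continuous_on S (cauchy_form \<zeta> h)" if "S \<subseteq> sector s m" for S
    by (rule cauchy_form_continuous[OF h that]) (use out that in blast)
  have "ray_integral 1 \<zeta> h = ray_integral (tilt s m) \<zeta> h + 0"
  proof (rule ray_rotation[OF h off C C'])
    fix N :: real assume N: "0 \<le> N"
    show "continuous_on (closed_segment 0 (of_real N * tilt s m)) (cauchy_form \<zeta> h)"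
      "continuous_on (closed_segment (of_real N) (of_real N * tilt s m)) (cauchy_form \<zeta> h)"
      using hull_in_sector[OF N] segments_in_hull[of N] by (blast intro: cont)+
    show "(cauchy_form \<zeta> h has_contour_integral 0)
       (linepath 0 (of_real N) +++ linepath (of_real N) (of_real N * tilt s m) +++ linepath (of_real N * tilt s m) 0)"
    proof (rule Cauchy_theorem_triangle_interior[OF cont[OF hull_in_sector[OF N]]])
      have "(\<lambda>w. kern \<zeta> w * h w / w) holomorphic_on open_sector s m"
      proof -
        have "kern \<zeta> holomorphic_on open_sector s m"
        proof (cases \<zeta>)
          case (Some z)
          then have "w - z \<noteq> 0" if "w \<in> open_sector s m" for w
            using out[OF Some] that open_sector_subset[of s m] by auto
          moreover have "kern \<zeta> = (\<lambda>w. (w + z) / (w - z))" using Some by auto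
          ultimately show ?thesis by (auto intro!: holomorphic_intros)
        next
          case None
          then have "kern \<zeta> = (\<lambda>w. - 1)" by auto
          then show ?thesis by simp
        qed
        then show ?thesis using h open_sector_subset[of s m]
          by (auto simp: damped_def intro!: holomorphic_intros)
      qed
      then have "cauchy_form \<zeta> h holomorphic_on open_sector s m"
        by (rule holomorphic_transform) (use open_sector_subset[of s m] in \<open>auto simp: cauchy_form_def\<close>)
      then show "cauchy_form \<zeta> h holomorphic_on interior (convex hull {0, of_real N, of_real N * tilt s m})"
        using interior_hull_in_open_sector[OF N] by (rule holomorphic_on_subset)
    qed
  qed
  then show ?thesis by simp
qed

text \<open>Cauchy's integral formula for the triangle; the sign \<open>s\<close> is its orientation.\<close>

lemma ray_rotation_inside:
  assumes h: "damped s m k M h" and z: "z \<in> open_sector s m"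
  shows "ray_integral 1 (Some z) h = ray_integral (tilt s m) (Some z) h + 4 * of_real pi * \<i> * of_real s * h z"
proof -
  let ?\<zeta> = "Some z"
  have out': "z \<notin> closed_ray q" if "q = 1 \<or> q = tilt s m" for q
    using z closed_rays_in_sector[OF that] by blast
  have off: "off_ray 1 ?\<zeta>" "off_ray (tilt s m) ?\<zeta>" by (rule off_rayI[OF out'], simp)+
  obtain C where C: "\<And>t. t > 0 \<Longrightarrow> cmod (kern ?\<zeta> (of_real t * 1)) \<le> C"
    using kern_bounded_outside(2)[of ?\<zeta> 1] out' by auto
  obtain C' where C': "\<And>t. t > 0 \<Longrightarrow> cmod (kern ?\<zeta> (of_real t * tilt s m)) \<le> C'"
    using kern_bounded_outside(2)[of ?\<zeta> "tilt s m"] out' by auto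
  have z0: "z \<noteq> 0" using z open_sector_subset[of s m] by auto
  show ?thesis
  proof (rule ray_rotation[OF h off C C'])
    fix N :: real assume "Re z + 1 \<le> N"
    moreover have "Re z > 0" using z m by (auto simp: open_sector_def intro: zero_less_mult_pos[of m])
    ultimately have N: "0 \<le> N" "0 < N" "Re z < N" by linarith+
    define \<Delta> where "\<Delta> = convex hull {0, of_real N, of_real N * tilt s m}"
    have zin: "z \<in> interior \<Delta>" using open_sector_in_hull[OF N(2)] z N(3) by (auto simp: \<Delta>_def)
    have not_seg: "z \<notin> closed_segment 0 (of_real N)" "z \<notin> closed_segment (of_real N) (of_real N * tilt s m)"
       "z \<notin> closed_segment 0 (of_real N * tilt s m)"
      using zin interior_of_triangle[of 0 "of_real N" "of_real N * tilt s m"] unfolding \<Delta>_def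
      by (auto simp: closed_segment_commute)
    show "continuous_on (closed_segment 0 (of_real N * tilt s m)) (cauchy_form ?\<zeta> h)"
      "continuous_on (closed_segment (of_real N) (of_real N * tilt s m)) (cauchy_form ?\<zeta> h)"
      using hull_in_sector[OF N(1)] segments_in_hull[of N] not_seg
      by (auto intro!: cauchy_form_continuous[OF h])
    \<comment> \<open>The integrand is \<open>g w / (w - z)\<close>; as \<open>g z = 2 * h z\<close>, the residue is \<open>4 \<pi> \<i> h z\<close>.\<close>
    define g where "g w = (w + z) * (- cauchy_form None h w)" for w
    have form: "cauchy_form ?\<zeta> h = (\<lambda>w. g w / (w - z))"
      by (rule ext) (auto simp: cauchy_form_def g_def mult_ac)
    have gz: "g z = 2 * h z" using z0 by (simp add: g_def cauchy_form_def)
    have cont: "continuous_on \<Delta> g" unfolding g_def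
      by (intro continuous_intros cauchy_form_continuous[OF h]) (use hull_in_sector[OF N(1)] in \<open>auto simp: \<Delta>_def\<close>)
    have holo: "g holomorphic_on open_sector s m"
    proof -
      have "(\<lambda>w. (w + z) * (h w / w)) holomorphic_on open_sector s m"
        using h open_sector_subset[of s m] by (auto simp: damped_def intro!: holomorphic_intros)
      then show ?thesis
        by (rule holomorphic_transform) (use open_sector_subset[of s m] in \<open>auto simp: cauchy_form_def g_def\<close>)
    qed
    have wn: "winding_number (linepath 0 (of_real N) +++ linepath (of_real N) (of_real N * tilt s m)
        +++ linepath (of_real N * tilt s m) 0) z = of_real s"
    proof -
      have "(0 < Im ((of_real N - 0) * cnj (0 - z))) = (0 < Im z)" using N by (simp add: zero_less_mult_iff)
      moreover have "Im z > 0 \<longleftrightarrow> s = 1" using z s by (auto simp: open_sector_def)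
      ultimately show ?thesis using winding_number_triangle[OF zin[unfolded \<Delta>_def]] s by auto
    qed
    have "((\<lambda>w. g w / (w - z)) has_contour_integral (2 * pi * \<i> * of_real s * g z))
       (linepath 0 (of_real N) +++ linepath (of_real N) (of_real N * tilt s m) +++ linepath (of_real N * tilt s m) 0)"
      unfolding wn[symmetric]
    proof (rule Cauchy_integral_formula_weak[where S = \<Delta> and k = "{}"])
      show "g field_differentiable at x" if "x \<in> interior \<Delta> - {}" for x
        using that interior_hull_in_open_sector[OF N(1)] holo open_open_sector
        by (auto simp: \<Delta>_def intro: holomorphic_on_imp_differentiable_at)
      show "path_image (linepath 0 (of_real N) +++ linepath (of_real N) (of_real N * tilt s m)
         +++ linepath (of_real N * tilt s m) 0) \<subseteq> \<Delta> - {z}"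
        using not_seg segments_in_hull[of N]
        by (auto simp: path_image_join \<Delta>_def closed_segment_commute)
    qed (use zin cont in \<open>auto simp: \<Delta>_def\<close>)
    then show "(cauchy_form ?\<zeta> h has_contour_integral 4 * of_real pi * \<i> * of_real s * h z)
       (linepath 0 (of_real N) +++ linepath (of_real N) (of_real N * tilt s m) +++ linepath (of_real N * tilt s m) 0)"
      by (simp add: form gz mult_ac)
  qed
qed

text \<open>Off the double sector of slope \<open>m / 2\<close> around the axis, \<open>t + \<bar>w\<bar>\<close> is at most a multiple of \<open>\<bar>t - w\<bar>\<close>.\<close>

lemma kern_bound_straight:
  assumes t: "t > 0" and w: "\<not> \<bar>Im w\<bar> < m / 2 * Re w"
  shows "cmod (kern (Some w) (of_real t * 1)) \<le> 20 / m"
proof -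
  define D where "D = cmod (of_real t - w)"
  have im: "\<bar>Im w\<bar> \<le> D" using abs_Im_le_cmod[of "of_real t - w"] by (simp add: D_def)
  have re: "\<bar>t - Re w\<bar> \<le> D" using abs_Re_le_cmod[of "of_real t - w"] by (simp add: D_def)
  have tri: "cmod (of_real t + w) \<le> t + (\<bar>Re w\<bar> + \<bar>Im w\<bar>)"
    using norm_triangle_ineq[of "of_real t" w] cmod_le[of w] t by simp
  have D0: "D \<ge> 0" by (simp add: D_def)
  have Dm: "D \<le> D / m" using D0 m by (simp add: le_divide_eq mult_left_le)
  have "cmod (of_real t + w) \<le> 20 * (D / m)"
  proof (cases "Re w \<le> 0")
    case True
    then show ?thesis using tri im re t Dm D0 by linarith
  next
    case False
    have "m / 2 * Re w \<le> D" using w im by linarith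
    then have "Re w \<le> 2 * (D / m)" using m by (simp add: field_simps)
    then show ?thesis using tri im re t Dm D0 False by linarith
  qed
  then show ?thesis using norm_divide_le[of "of_real t + w" "20 / m" "of_real t - w"] m by (simp add: D_def)
qed

text \<open>In the double sector of slope \<open>m / 2\<close>, the tilted ray of slope \<open>m\<close> is far away in the same relative sense.\<close>

lemma kern_bound_tilted:
  assumes t: "t > 0" and w: "\<bar>Im w\<bar> \<le> m / 2 * Re w"
  shows "cmod (kern (Some w) (of_real t * tilt s m)) \<le> 20 / m"
proof -
  define x where "x = of_real t * tilt s m"
  define D where "D = cmod (x - w)"
  have x: "Re x = t" "\<bar>Im x\<bar> = m * t" using t m s by (auto simp: x_def abs_mult)
  have re: "\<bar>t - Re w\<bar> \<le> D" using abs_Re_le_cmod[of "x - w"] by (simp add: D_def x)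
  have "\<bar>Im x - Im w\<bar> \<le> D" using abs_Im_le_cmod[of "x - w"] by (simp add: D_def)
  then have 1: "m * t \<le> D + m / 2 * Re w" using x(2) w by linarith
  have "m / 2 * Re w \<le> m / 2 * (t + D)" by (rule mult_left_mono) (use re m in auto)
  then have "m * t \<le> D + (m * t / 2 + m * D / 2)" using 1 by (simp add: algebra_simps)
  moreover have D0: "D \<ge> 0" by (simp add: D_def)
  moreover have "m * D \<le> D" using m D0 by (simp add: mult_left_le_one_le)
  ultimately have "m * t \<le> 3 * D" by linarith
  then have t3: "t \<le> 3 * (D / m)" using m by (simp add: field_simps)
  have Dm: "D \<le> D / m" using D0 m by (simp add: le_divide_eq mult_left_le)
  have mt: "m * t \<le> t" using m t by simp
  have Re0: "0 \<le> Re w" using w m by (smt (verit) mult_neg_pos zero_less_divide_iff mult_pos_neg)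
  have "m / 2 * Re w \<le> 1 * Re w" by (rule mult_right_mono) (use m Re0 in auto)
  then have "\<bar>Im w\<bar> \<le> Re w" using w by simp
  moreover have "cmod (x + w) \<le> (t + m * t) + (\<bar>Re w\<bar> + \<bar>Im w\<bar>)"
    using norm_triangle_ineq[of x w] cmod_le[of w] cmod_le[of x] t x by simp
  ultimately have "cmod (x + w) \<le> 20 * (D / m)" using t3 Dm mt re Re0 D0 by linarith
  then have "cmod (x + w) \<le> 20 / m * D" by simp
  then show ?thesis using norm_divide_le[of "x + w" "20 / m" "x - w"] m by (simp add: D_def x_def)
qed

lemma kern_bound_None: "cmod (kern None w) \<le> 20 / m" using m by (simp add: le_divide_eq)

lemma off_straight: "\<not> \<bar>Im w\<bar> < m / 2 * Re w \<Longrightarrow> off_ray 1 (Some w)"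
  using m by (auto simp: off_ray_def)

lemma off_tilted: "\<bar>Im w\<bar> \<le> m / 2 * Re w \<Longrightarrow> off_ray (tilt s m) (Some w)"
proof -
  assume w: "\<bar>Im w\<bar> \<le> m / 2 * Re w"
  have False if "t > 0" "w = of_real t * tilt s m" for t
  proof -
    have "Re w = t" "Im w = s * (t * m)" using that(2) by (simp_all add: mult_ac)
    then show False using w that(1) m s by (auto simp: abs_mult)
  qed
  then show ?thesis by (auto simp: off_ray_def)
qed

lemma straight_kernel:
  assumes "\<And>w. \<zeta> = Some w \<Longrightarrow> \<not> near_ray m w"
  shows "off_ray 1 \<zeta>" and "t > 0 \<Longrightarrow> cmod (kern \<zeta> (of_real t * 1)) \<le> 20 / m"
proof -
  have c: "\<not> \<bar>Im w\<bar> < m / 2 * Re w" if "\<zeta> = Some w" for w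
    using assms[OF that] by (auto simp: near_ray_def)
  show "off_ray 1 \<zeta>" using off_straight c by (cases \<zeta>) (auto simp: off_ray_def)
  show "cmod (kern \<zeta> (of_real t * 1)) \<le> 20 / m" if "t > 0"
    using kern_bound_straight[OF that] kern_bound_None c by (cases \<zeta>) auto
qed

lemma near_ray_in_sector:
  assumes "near_ray m w" "0 \<le> s * Im w" shows "w \<in> sector s m - {0}"
proof -
  have "s * Im w \<le> m / 2 * Re w" using assms s by (auto simp: near_ray_def)
  moreover have "0 \<le> m / 2 * Re w"
    using assms abs_ge_zero[of "Im w"] unfolding near_ray_def by linarith
  ultimately show ?thesis using assms by (auto simp: sector_def near_ray_def)
qed

lemma near_ray_open_sector:
  assumes "\<bar>Im w\<bar> \<le> m / 2 * Re w" "0 < s * Im w" shows "w \<in> open_sector s m"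
proof -
  have "s * Im w \<le> m / 2 * Re w" using assms s by auto
  then show ?thesis using assms by (auto simp: open_sector_def)
qed

text \<open>Off the axis the rotation has only changed the expression of the integral.\<close>

lemma sided_integral_off_ray:
  assumes h: "damped s m k M h" and off: "off_ray 1 \<zeta>"
  shows "sided_integral True s m h \<zeta> = ray_integral 1 \<zeta> h"
proof (cases \<zeta>)
  case (Some w)
  show ?thesis
  proof (cases "near_ray m w")
    case True
    have "Im w \<noteq> 0"
    proof
      assume *: "Im w = 0"
      then have "0 \<le> Re w" using True m by (auto simp: near_ray_def zero_le_mult_iff)
      then have "Re w > 0" using True * by (auto simp: near_ray_def complex_eq_iff)
      moreover have "w = of_real (Re w) * 1" using * by (simp add: complex_eq_iff)
      ultimately show False using off Some unfolding off_ray_def by blast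
    qed
    then consider "0 < s * Im w" | "s * Im w < 0" using s by fastforce
    then show ?thesis
    proof cases
      case 1
      then show ?thesis
        using ray_rotation_inside[OF h near_ray_open_sector[of w]] True Some
        by (simp add: sided_integral_def near_ray_def)
    next
      case 2
      then show ?thesis using ray_rotation_outside[OF h, of \<zeta>] True Some
        by (simp add: sided_integral_def sector_def)
    qed
  qed (simp add: sided_integral_def Some)
qed (simp add: sided_integral_def)

lemma sided_integral_other_side:
  assumes h: "damped s m k M h" and "\<And>w. \<zeta> = Some w \<Longrightarrow> w = 0 \<or> s * Im w < 0"
  shows "sided_integral False s m h \<zeta> = ray_integral 1 \<zeta> h"
proof (cases \<zeta>)
  case (Some w)
  then show ?thesis using ray_rotation_outside[OF h, of \<zeta>] assms(2)
    by (auto simp: sided_integral_def sector_def near_ray_def)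
qed (simp add: sided_integral_def)

lemma sided_integral_bound:
  assumes h: "damped s m k M h"
  shows "cmod (sided_integral b s m h \<zeta>) \<le> (20 / m + 4 * pi) * M"
proof -
  note M = damped_nonneg[OF h]
  have straight: "cmod (ray_integral 1 \<zeta> h) \<le> (20 / m + 4 * pi) * M"
    if "\<And>w. \<zeta> = Some w \<Longrightarrow> \<not> near_ray m w"
  proof -
    have "cmod (ray_integral 1 \<zeta> h) \<le> 20 / m * M"
      by (rule ray_integral_bound[OF ray_scale_pos straight_kernel(1) damped_rayD[OF h] straight_kernel(2)])
         (simp_all add: that)
    also have "\<dots> \<le> (20 / m + 4 * pi) * M" by (rule mult_right_mono) (use M in auto)
    finally show ?thesis .
  qed
  show ?thesis
  proof (cases \<zeta>)
    case None
    then show ?thesis using straight by (simp add: sided_integral_def)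
  next
    case (Some w)
    show ?thesis
    proof (cases "near_ray m w")
      case True
      then have w: "\<bar>Im w\<bar> \<le> m / 2 * Re w" by (simp add: near_ray_def)
      have 1: "cmod (ray_integral (tilt s m) (Some w) h) \<le> 20 / m * M"
        by (rule ray_integral_bound[OF ray_scale_pos off_tilted[OF w] damped_rayD[OF h] kern_bound_tilted[OF _ w]]) auto
      have 2: "cmod (if b \<and> 0 \<le> s * Im w then 4 * of_real pi * \<i> * of_real s * h w else 0) \<le> 4 * pi * M"
      proof (cases "0 \<le> s * Im w")
        case pos: True
        have w': "w \<in> sector s m - {0}" by (rule near_ray_in_sector[OF True pos])
        then have "cmod (h w) \<le> M * damping (k * cmod w)" using h unfolding damped_def by blast
        also have "\<dots> \<le> M * 1" using M w' k by (intro mult_left_mono damping_le(1)) auto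
        finally have "cmod (h w) \<le> M" by simp
        then have "4 * pi * cmod (h w) \<le> 4 * pi * M" by simp
        moreover have "cmod (4 * of_real pi * \<i> * of_real s * h w) = 4 * pi * cmod (h w)"
          using s by (auto simp: norm_mult)
        ultimately show ?thesis using M by simp
      qed (use M in simp)
      show ?thesis using True norm_triangle_mono[OF 1 2] Some by (simp add: sided_integral_def distrib_right)
    next
      case False
      then show ?thesis using straight Some by (simp add: sided_integral_def)
    qed
  qed
qed

lemma sided_integral_diff:
  assumes h: "damped s m k M h" and h': "damped s m k M' h'"
  shows "sided_integral b s m (\<lambda>w. h w - h' w) \<zeta> = sided_integral b s m h \<zeta> - sided_integral b s m h' \<zeta>"
proof -
  have straight: "ray_integral 1 \<zeta> (\<lambda>w. h w - h' w) = ray_integral 1 \<zeta> h - ray_integral 1 \<zeta> h'"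
    if "\<And>w. \<zeta> = Some w \<Longrightarrow> \<not> near_ray m w"
  proof -
    show ?thesis
      by (rule ray_integral_diff[OF ray_scale_pos straight_kernel(1) damped_rayD[OF h] damped_rayD[OF h']
            straight_kernel(2)]) (simp_all add: that)
  qed
  show ?thesis
  proof (cases \<zeta>)
    case None
    then show ?thesis using straight by (simp add: sided_integral_def)
  next
    case (Some w)
    show ?thesis
    proof (cases "near_ray m w")
      case True
      then have w: "\<bar>Im w\<bar> \<le> m / 2 * Re w" by (simp add: near_ray_def)
      have "ray_integral (tilt s m) (Some w) (\<lambda>w. h w - h' w)
          = ray_integral (tilt s m) (Some w) h - ray_integral (tilt s m) (Some w) h'"
        by (rule ray_integral_diff[OF ray_scale_pos off_tilted[OF w] damped_rayD[OF h] damped_rayD[OF h'] kern_bound_tilted[OF _ w]]) auto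
      then show ?thesis using True Some by (simp add: sided_integral_def algebra_simps)
    next
      case False
      then show ?thesis using straight Some by (simp add: sided_integral_def)
    qed
  qed
qed

lemma sided_integral_line_holo:
  fixes P :: "(complex ^ 'n) set"
  assumes P: "open P" and h: "\<And>p. p \<in> P \<Longrightarrow> damped s m k M (h p)"
    and holo: "\<And>w. w \<in> sector s m - {0} \<Longrightarrow> line_holo P (\<lambda>p. h p w)"
  shows "line_holo P (\<lambda>p. sided_integral b s m (h p) \<zeta>)"
proof -
  have straight: "line_holo P (\<lambda>p. ray_integral 1 \<zeta> (h p))"
    if "\<And>w. \<zeta> = Some w \<Longrightarrow> \<not> near_ray m w"
  proof -
    show ?thesis
      by (rule ray_integral_line_holo[OF ray_scale_pos P damped_rayD[OF h] straight_kernel(1)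
            straight_kernel(2) holo[OF ray_in_sector]]) (simp_all add: that)
  qed
  show ?thesis
  proof (cases \<zeta>)
    case None
    then show ?thesis using straight by (simp add: sided_integral_def)
  next
    case (Some w)
    show ?thesis
    proof (cases "near_ray m w")
      case True
      then have w: "\<bar>Im w\<bar> \<le> m / 2 * Re w" by (simp add: near_ray_def)
      have "line_holo P (\<lambda>p. ray_integral (tilt s m) (Some w) (h p))"
        by (rule ray_integral_line_holo[OF ray_scale_pos P damped_rayD[OF h] off_tilted[OF w] kern_bound_tilted[OF _ w] holo[OF ray_in_sector]]) auto
      moreover have "line_holo P (\<lambda>p. if b \<and> 0 \<le> s * Im w then 4 * of_real pi * \<i> * of_real s * h p w else 0)"
        using holo[OF near_ray_in_sector[OF True]]
        by (cases "b \<and> 0 \<le> s * Im w") (auto intro: line_holo_const line_holo_mult)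
      ultimately show ?thesis using True Some by (simp add: sided_integral_def line_holo_add)
    next
      case False
      then show ?thesis using straight Some by (simp add: sided_integral_def)
    qed
  qed
qed

lemma sided_integral_holomorphic:
  assumes h: "damped s m k M h"
  shows "(\<lambda>w. sided_integral True s m h (Some w)) holomorphic_on - closed_ray 1"
proof (rule holomorphic_transform[OF ray_integral_holomorphic[OF ray_scale_pos damped_rayD[OF h]]])
  show "ray_integral 1 (Some w) h = sided_integral True s m h (Some w)" if "w \<in> - closed_ray 1" for w
    using sided_integral_off_ray[OF h off_rayI] that by simp
qed auto

lemma straight_continuous:
  assumes h: "damped s m k M h"
  shows "continuous_on {w. \<not> \<bar>Im w\<bar> < m / 2 * Re w} (\<lambda>w. ray_integral 1 (Some w) h)"
proof (rule ray_integral_continuous[OF ray_scale_pos damped_rayD[OF h]])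
  show "continuous_on {w. \<not> \<bar>Im w\<bar> < m / 2 * Re w} (\<lambda>x. kern (Some x) (of_real t * 1))" if "t > 0" for t
    using off_straight that by (force simp: off_ray_def intro!: continuous_intros)
qed (use off_straight kern_bound_straight in auto)

lemma tilted_continuous:
  assumes h: "damped s m k M h"
  shows "continuous_on {w. \<bar>Im w\<bar> \<le> m / 2 * Re w} (\<lambda>w. ray_integral (tilt s m) (Some w) h)"
proof (rule ray_integral_continuous[OF ray_scale_pos damped_rayD[OF h]])
  show "continuous_on {w. \<bar>Im w\<bar> \<le> m / 2 * Re w} (\<lambda>x. kern (Some x) (of_real t * tilt s m))" if "t > 0" for t
    using off_tilted that by (force simp: off_ray_def intro!: continuous_intros)
qed (use off_tilted kern_bound_tilted in auto)

lemma residue_continuous: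
  assumes h: "damped s m k M h"
  shows "continuous_on (sector s m) (\<lambda>w. if w = 0 then 0 else h w)"
proof -
  have "continuous_on (sector s m) (\<lambda>w. - w * cauchy_form None h w)"
    by (intro continuous_intros cauchy_form_continuous[OF h]) auto
  then show ?thesis by (rule continuous_on_eq) (auto simp: cauchy_form_def)
qed

lemma closed_near: "closed {w. \<bar>Im w\<bar> \<le> m / 2 * Re w}" "closed {w. \<not> \<bar>Im w\<bar> < m / 2 * Re w}"
  unfolding not_less by (intro closed_Collect_le continuous_intros)+

lemma closed_side: "closed {w. 0 \<le> s * Im w}" "closed {w. s * Im w \<le> 0}"
  by (intro closed_Collect_le continuous_intros)+

text \<open>Two closed pieces, the double sector around the axis and its complement, are glued along the lines of
  slope \<open>m / 2\<close>, where the rotation formulas identify the two expressions.\<close>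

lemma sided_integral_continuous:
  assumes h: "damped s m k M h" and C: "C = (if b then {w. 0 \<le> s * Im w} else {w. s * Im w \<le> 0})"
  shows "continuous_on C (\<lambda>w. sided_integral b s m h (Some w))"
proof -
  define A where "A = C \<inter> {w. \<bar>Im w\<bar> \<le> m / 2 * Re w}"
  define B where "B = C \<inter> {w. \<not> \<bar>Im w\<bar> < m / 2 * Re w}"
  define j where "j w = ray_integral (tilt s m) (Some w) h
    + (if b then 4 * of_real pi * \<i> * of_real s * (if w = 0 then 0 else h w) else 0)" for w
  have C': "closed C" using C closed_side by (cases b) auto
  have AB: "closed A" "closed B" "C = A \<union> B" using C' closed_near by (auto simp: A_def B_def closed_Int)
  have jA: "continuous_on A j"
  proof -
    have 1: "continuous_on A (\<lambda>w. ray_integral (tilt s m) (Some w) h)"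
      by (rule continuous_on_subset[OF tilted_continuous[OF h]]) (auto simp: A_def)
    show ?thesis
    proof (cases b)
      case True
      have "A \<subseteq> sector s m"
      proof
        fix w assume "w \<in> A"
        then show "w \<in> sector s m" using near_ray_in_sector[of w] True m
          by (cases "w = 0") (auto simp: A_def C near_ray_def sector_def)
      qed
      then have "continuous_on A (\<lambda>w. if w = 0 then 0 else h w)"
        using residue_continuous[OF h] continuous_on_subset by blast
      then show ?thesis unfolding j_def using 1 True by (auto intro!: continuous_intros)
    qed (use 1 in \<open>simp add: j_def\<close>)
  qed
  have zero: "ray_integral 1 (Some 0) h = ray_integral (tilt s m) (Some 0) h"
    by (rule ray_rotation_outside[OF h]) simp
  have "continuous_on (A \<union> B) (\<lambda>w. if \<bar>Im w\<bar> \<le> m / 2 * Re w then j w else ray_integral 1 (Some w) h)"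
  proof (rule continuous_on_cases[OF AB(1,2) jA])
    show "continuous_on B (\<lambda>w. ray_integral 1 (Some w) h)"
      by (rule continuous_on_subset[OF straight_continuous[OF h]]) (auto simp: B_def)
    show "\<forall>w. w \<in> A \<and> \<not> \<bar>Im w\<bar> \<le> m / 2 * Re w \<or> w \<in> B \<and> \<bar>Im w\<bar> \<le> m / 2 * Re w \<longrightarrow>
        j w = ray_integral 1 (Some w) h"
    proof (intro allI impI)
      fix w assume "w \<in> A \<and> \<not> \<bar>Im w\<bar> \<le> m / 2 * Re w \<or> w \<in> B \<and> \<bar>Im w\<bar> \<le> m / 2 * Re w"
      then have w: "w \<in> B" "\<bar>Im w\<bar> \<le> m / 2 * Re w" by (auto simp: A_def)
      show "j w = ray_integral 1 (Some w) h"
      proof (cases "w = 0")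
        case False
        have eq: "\<bar>Im w\<bar> = m / 2 * Re w" using w by (simp add: B_def)
        have nz: "Im w \<noteq> 0" using eq m False by (auto simp: complex_eq_iff)
        show ?thesis
        proof (cases b)
          case True
          then have "0 < s * Im w" using w nz s by (auto simp: B_def C order_less_le)
          then show ?thesis using ray_rotation_inside[OF h near_ray_open_sector[OF w(2)]] True False
            by (simp add: j_def)
        next
          case bF: False
          then have "s * Im w < 0" using w nz s by (auto simp: B_def C order_less_le)
          then show ?thesis using ray_rotation_outside[OF h, of "Some w"] bF
            by (simp add: j_def sector_def)
        qed
      qed (simp add: j_def zero)
    qed
  qed
  then show ?thesis unfolding AB(3)[symmetric]
  proof (rule continuous_on_eq)
    fix w assume "w \<in> C"
    then show "(if \<bar>Im w\<bar> \<le> m / 2 * Re w then j w else ray_integral 1 (Some w) h) = sided_integral b s m h (Some w)"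
      using C by (cases "w = 0") (auto simp: j_def sided_integral_def near_ray_def zero)
  qed
qed

lemma sided_integral_at_infinity:
  assumes h: "damped s m k M h" and C: "C = (if b then {w. 0 \<le> s * Im w} else {w. s * Im w \<le> 0})"
  shows "((\<lambda>w. sided_integral b s m h (Some w)) \<longlongrightarrow> sided_integral b s m h None) (inf at_infinity (principal C))"
proof -
  have val: "sided_integral b s m h None = ray_integral (tilt s m) None h + 0"
    using ray_rotation_outside[OF h, of None] by (simp add: sided_integral_def)
  let ?N = "{w. near_ray m w}"
  have "filterlim (\<lambda>w. if near_ray m w then ray_integral (tilt s m) (Some w) h
      + (if b \<and> 0 \<le> s * Im w then 4 * of_real pi * \<i> * of_real s * h w else 0) else ray_integral 1 (Some w) h)
    (nhds (sided_integral b s m h None)) (inf at_infinity (principal C))"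
  proof (rule filterlim_If)
    have val1: "sided_integral b s m h None = ray_integral 1 None h" by (simp add: sided_integral_def)
    have lim: "((\<lambda>w. ray_integral 1 (Some w) h) \<longlongrightarrow> ray_integral 1 None h)
        (inf at_infinity (principal {w. \<not> \<bar>Im w\<bar> < m / 2 * Re w}))"
      by (rule ray_integral_at_infinity[OF ray_scale_pos damped_rayD[OF h]]) (use off_straight kern_bound_straight in auto)
    have le: "inf (inf at_infinity (principal C)) (principal {w. \<not> near_ray m w})
       \<le> inf at_infinity (principal {w. \<not> \<bar>Im w\<bar> < m / 2 * Re w})"
      unfolding inf_assoc inf_principal by (intro inf_mono order_refl) (auto simp: near_ray_def)
    show "((\<lambda>w. ray_integral 1 (Some w) h) \<longlongrightarrow> sided_integral b s m h None)
        (inf (inf at_infinity (principal C)) (principal {w. \<not> near_ray m w}))"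
      unfolding val1 by (rule tendsto_mono[OF le lim])
  next
    let ?F = "inf at_infinity (principal (C \<inter> ?N))"
    have t: "((\<lambda>w. ray_integral (tilt s m) (Some w) h) \<longlongrightarrow> ray_integral (tilt s m) None h)
        (inf at_infinity (principal {w. \<bar>Im w\<bar> \<le> m / 2 * Re w}))"
      by (rule ray_integral_at_infinity[OF ray_scale_pos damped_rayD[OF h]]) (use off_tilted kern_bound_tilted in auto)
    have t': "((\<lambda>w. ray_integral (tilt s m) (Some w) h) \<longlongrightarrow> ray_integral (tilt s m) None h) ?F"
      by (rule tendsto_mono[OF _ t]) (intro inf_mono order_refl, auto simp: near_ray_def)
    have r: "((\<lambda>w. if b \<and> 0 \<le> s * Im w then 4 * of_real pi * \<i> * of_real s * h w else 0) \<longlongrightarrow> 0) ?F"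
    proof (rule Lim_null_comparison)
      show "\<forall>\<^sub>F w in ?F. norm (if b \<and> 0 \<le> s * Im w then 4 * of_real pi * \<i> * of_real s * h w else 0)
          \<le> 4 * pi * M / k * inverse (cmod w)"
        unfolding eventually_inf_principal
      proof (rule always_eventually, intro allI impI)
        fix w assume "w \<in> C \<inter> ?N"
        then have w: "near_ray m w" by simp
        show "norm (if b \<and> 0 \<le> s * Im w then 4 * of_real pi * \<i> * of_real s * h w else 0)
          \<le> 4 * pi * M / k * inverse (cmod w)"
        proof (cases "b \<and> 0 \<le> s * Im w")
          case True
          then have w': "w \<in> sector s m - {0}" using near_ray_in_sector[OF w] by blast
          then have "cmod (h w) \<le> M * damping (k * cmod w)" using h unfolding damped_def by blast
          also have "\<dots> \<le> M * (1 / (k * cmod w))"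
            using w' k damped_nonneg[OF h] by (intro mult_left_mono damping_le(2)) auto
          finally have "cmod (h w) \<le> M * (1 / (k * cmod w))" .
          then have "4 * pi * cmod (h w) \<le> 4 * pi * (M * (1 / (k * cmod w)))"
            by (rule mult_left_mono) simp
          moreover have "cmod (4 * of_real pi * \<i> * of_real s * h w) = 4 * pi * cmod (h w)"
            using s by (auto simp: norm_mult)
          ultimately show ?thesis using True by (simp add: field_simps)
        qed (use damped_nonneg[OF h] k in auto)
      qed
      have "((\<lambda>w::complex. inverse (cmod w)) \<longlongrightarrow> 0) at_infinity"
        using tendsto_norm[OF tendsto_inverse_0, where 'a1 = complex] by (simp add: norm_inverse)
      then have "((\<lambda>w::complex. 4 * pi * M / k * inverse (cmod w)) \<longlongrightarrow> 0) at_infinity"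
        by (rule tendsto_mult_right_zero)
      then show "((\<lambda>w. 4 * pi * M / k * inverse (cmod w)) \<longlongrightarrow> 0) ?F"
        by (rule tendsto_mono[rotated]) simp
    qed
    show "((\<lambda>w. ray_integral (tilt s m) (Some w) h
        + (if b \<and> 0 \<le> s * Im w then 4 * of_real pi * \<i> * of_real s * h w else 0)) \<longlongrightarrow> sided_integral b s m h None)
      (inf (inf at_infinity (principal C)) (principal ?N))"
      unfolding val inf_assoc inf_principal by (rule tendsto_add[OF t' r])
  qed
  then show ?thesis by (simp add: sided_integral_def)
qed

end

section \<open>Sums over charges\<close>

lemma cmod_of_rat: "cmod (of_rat q) = \<bar>real_of_rat q\<bar>"
  by (cases q) (simp add: of_rat_rat norm_divide)

text \<open>The half-plane on which \<open>\<bar>exp\<bar> \<le> B\<close> is convex, so the mean value inequality applies in it.\<close>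

lemma exp_lipschitz:
  assumes "cmod (exp a) \<le> B" "cmod (exp b) \<le> B"
  shows "cmod (exp a - exp b) \<le> B * cmod (a - b)"
proof -
  define S where "S = {z :: complex. Re z \<le> ln B}"
  have "0 < cmod (exp a)" by simp
  then have B: "B > 0" using assms(1) by linarith
  have S: "z \<in> S \<longleftrightarrow> cmod (exp z) \<le> B" for z
    using B by (simp add: S_def norm_exp_eq_Re ln_ge_iff)
  show ?thesis
  proof (rule field_differentiable_bound[of S exp exp])
    show "convex S" unfolding S_def by (rule convex_halfspace_Re_le)
    show "cmod (exp z) \<le> B" if "z \<in> S" for z using that S by blast
    show "(exp has_field_derivative exp z) (at z within S)" for z
      by (rule has_field_derivative_at_within[OF DERIV_exp])
    show "a \<in> S" "b \<in> S" using assms S by blast+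
  qed
qed

lemma norm_infsum_majorant:
  fixes g :: "'i \<Rightarrow> 'b::banach"
  assumes "M summable_on A" "\<And>i. i \<in> A \<Longrightarrow> norm (g i) \<le> M i"
  shows "g summable_on A" "norm (infsum g A) \<le> infsum M A"
proof -
  have "(\<lambda>i. norm (g i)) summable_on A"
    by (rule Infinite_Sum.summable_on_comparison_test[OF assms]) auto
  then show s: "g summable_on A" by (rule abs_summable_summable)
  show "norm (infsum g A) \<le> infsum M A"
    by (rule norm_infsum_le[OF has_sum_infsum[OF s] has_sum_infsum[OF assms(1)] assms(2)])
qed

lemma continuous_on_infsum:
  fixes g :: "'i \<Rightarrow> 'a::topological_space \<Rightarrow> 'b::banach"
  assumes "\<And>i. i \<in> A \<Longrightarrow> continuous_on S (g i)"
    and "\<And>i x. i \<in> A \<Longrightarrow> x \<in> S \<Longrightarrow> norm (g i x) \<le> M i" "M summable_on A"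
  shows "continuous_on S (\<lambda>x. \<Sum>\<^sub>\<infinity>i\<in>A. g i x)"
proof (rule uniform_limit_theorem[OF _ Weierstrass_m_test_general[OF assms(2,3)]])
  show "\<forall>\<^sub>F F in finite_subsets_at_top A. continuous_on S (\<lambda>x. \<Sum>i\<in>F. g i x)"
    using assms(1) by (intro eventually_finite_subsets_at_top_weakI continuous_on_sum) auto
qed auto

lemma holomorphic_on_infsum:
  fixes g :: "'i \<Rightarrow> complex \<Rightarrow> complex"
  assumes S: "open S" and holo: "\<And>i. i \<in> A \<Longrightarrow> g i holomorphic_on S"
    and bound: "\<And>i x. i \<in> A \<Longrightarrow> x \<in> S \<Longrightarrow> norm (g i x) \<le> M i" and M: "M summable_on A"
  shows "(\<lambda>x. \<Sum>\<^sub>\<infinity>i\<in>A. g i x) holomorphic_on S"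
proof -
  have "\<exists>D. ((\<lambda>x. \<Sum>\<^sub>\<infinity>i\<in>A. g i x) has_field_derivative D) (at x)" if x: "x \<in> S" for x
  proof -
    obtain r where r: "r > 0" "cball x r \<subseteq> S" using S x open_contains_cball by blast
    have ev: "\<forall>\<^sub>F F in finite_subsets_at_top A. continuous_on (cball x r) (\<lambda>y. \<Sum>i\<in>F. g i y) \<and>
        (\<lambda>y. \<Sum>i\<in>F. g i y) holomorphic_on ball x r"
    proof (rule eventually_finite_subsets_at_top_weakI)
      fix F assume "finite F" "F \<subseteq> A"
      then have "(\<lambda>y. \<Sum>i\<in>F. g i y) holomorphic_on S" using holo by (intro holomorphic_intros) auto
      then show "continuous_on (cball x r) (\<lambda>y. \<Sum>i\<in>F. g i y) \<and> (\<lambda>y. \<Sum>i\<in>F. g i y) holomorphic_on ball x r"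
        using r(2) by (meson ball_subset_cball holomorphic_on_imp_continuous_on holomorphic_on_subset)
    qed
    have "uniform_limit (cball x r) (\<lambda>F y. \<Sum>i\<in>F. g i y) (\<lambda>y. \<Sum>\<^sub>\<infinity>i\<in>A. g i y) (finite_subsets_at_top A)"
      by (rule Weierstrass_m_test_general[OF _ M]) (use bound r in auto)
    from holomorphic_uniform_limit[OF ev this]
    have "(\<lambda>y. \<Sum>\<^sub>\<infinity>i\<in>A. g i y) holomorphic_on ball x r" by auto
    then show ?thesis using r(1) by (auto simp: holomorphic_on_open)
  qed
  then show ?thesis by (simp add: holomorphic_on_open[OF S])
qed

lemma line_holo_infsum:
  fixes P :: "(complex ^ 'n) set"
  assumes P: "open P" and holo: "\<And>i. i \<in> A \<Longrightarrow> line_holo P (g i)"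
    and loc: "\<And>p. p \<in> P \<Longrightarrow> \<exists>N M. open N \<and> p \<in> N \<and> N \<subseteq> P \<and> M summable_on A \<and>
        (\<forall>i\<in>A. \<forall>q\<in>N. norm (g i q) \<le> M i)"
  shows "line_holo P (\<lambda>p. \<Sum>\<^sub>\<infinity>i\<in>A. g i p)"
proof (rule line_holo_uniform_limit[OF P, of "finite_subsets_at_top A" "\<lambda>F p. \<Sum>i\<in>F. g i p"])
  fix p assume "p \<in> P"
  from loc[OF this] obtain N M where N: "open N" "p \<in> N" "N \<subseteq> P" "M summable_on A"
    and NM: "\<forall>i\<in>A. \<forall>q\<in>N. norm (g i q) \<le> M i" by blast
  have "\<forall>\<^sub>F F in finite_subsets_at_top A. line_holo N (\<lambda>p. \<Sum>i\<in>F. g i p)"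
    using line_holo_subset[OF holo N(3)]
    by (intro eventually_finite_subsets_at_top_weakI line_holo_sum) auto
  moreover have "uniform_limit N (\<lambda>F p. \<Sum>i\<in>F. g i p) (\<lambda>p. \<Sum>\<^sub>\<infinity>i\<in>A. g i p) (finite_subsets_at_top A)"
    by (rule Weierstrass_m_test_general[OF _ N(4)]) (use NM in auto)
  ultimately show "\<exists>N. open N \<and> p \<in> N \<and> (\<forall>\<^sub>F F in finite_subsets_at_top A. line_holo N (\<lambda>p. \<Sum>i\<in>F. g i p)) \<and>
      uniform_limit N (\<lambda>F p. \<Sum>i\<in>F. g i p) (\<lambda>p. \<Sum>\<^sub>\<infinity>i\<in>A. g i p) (finite_subsets_at_top A)"
    by (intro exI[of _ N] conjI N(1,2))
qed auto

lemma ray_integral_scale: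
  assumes "d \<noteq> 0"
  shows "ray_integral d \<zeta> h = ray_integral 1 (map_option (\<lambda>z. z / d) \<zeta>) (\<lambda>w. h (d * w))"
proof -
  have "kern \<zeta> (of_real t * d) = kern (map_option (\<lambda>z. z / d) \<zeta>) (of_real t * 1)" for t
  proof (cases \<zeta>)
    case (Some z)
    have "of_real t * d + z = d * (of_real t + z / d)" "of_real t * d - z = d * (of_real t - z / d)"
      using assms by (simp_all add: distrib_left right_diff_distrib mult.commute)
    then have "(of_real t * d + z) / (of_real t * d - z) = (d * (of_real t + z / d)) / (d * (of_real t - z / d))"
      by simp
    also have "\<dots> = (of_real t + z / d) / (of_real t - z / d)" using assms by simp
    finally show ?thesis using Some by simp
  qed simp
  then show ?thesis by (simp add: ray_integral_def mult.commute)
qed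

lemma ray_integral_cmult: "ray_integral q \<zeta> (\<lambda>x. c * h x) = c * ray_integral q \<zeta> h"
proof -
  have "ray_integrand q \<zeta> (\<lambda>x. c * h x) = (\<lambda>t. c * ray_integrand q \<zeta> h t)"
    by (rule ext) (simp add: ray_integrand_def)
  then show ?thesis by (simp add: ray_integral_eq)
qed

text \<open>Sum and integral are exchanged by estimating the tails: the sum of the densities outside a finite set is
  damped with the tail of \<open>M\<close> as constant.\<close>

lemma ray_integral_infsum:
  assumes k: "k > 0" and off: "off_ray q \<zeta>"
    and C: "\<And>t. t > 0 \<Longrightarrow> cmod (kern \<zeta> (of_real t * q)) \<le> C"
    and h: "\<And>i. i \<in> A \<Longrightarrow> damped_on_ray k (M i) q (h i)" and M: "M summable_on A"
  shows "((\<lambda>i. ray_integral q \<zeta> (h i)) has_sum ray_integral q \<zeta> (\<lambda>x. \<Sum>\<^sub>\<infinity>i\<in>A. h i x)) A"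
proof -
  define H where "H x = (\<Sum>\<^sub>\<infinity>i\<in>A. h i x)" for x
  have M0: "0 \<le> M i" if "i \<in> A" for i
  proof -
    have "cmod (h i (of_real 1 * q)) \<le> M i * damping (k * 1)"
      using h[OF that] zero_less_one unfolding damped_on_ray_def by blast
    then have "0 \<le> M i * damping (k * 1)" by (rule order_trans[OF norm_ge_zero])
    then show ?thesis using damping_pos[of "k * 1"] by (simp add: zero_le_mult_iff)
  qed
  have bound: "cmod (h i (of_real t * q)) \<le> M i * damping (k * t)" if "i \<in> A" "t > 0" for i t
    using h that by (simp add: damped_on_ray_def)
  have summ: "(\<lambda>i. h i (of_real t * q)) summable_on A" if "t > 0" for t
    by (rule norm_infsum_majorant(1)[OF summable_on_cmult_left[OF M] bound]) (use that in auto)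
  have tail: "damped_on_ray k (infsum M (A - F)) q (\<lambda>x. H x - (\<Sum>i\<in>F. h i x))" if F: "finite F" "F \<subseteq> A" for F
    unfolding damped_on_ray_def
  proof (intro conjI allI impI)
    have "continuous_on {0<..} (\<lambda>t. H (of_real t * q))" unfolding H_def
    proof (rule continuous_on_infsum[OF _ _ M])
      show "continuous_on {0<..} (\<lambda>t. h i (of_real t * q))" if "i \<in> A" for i
        using h[OF that] by (simp add: damped_on_ray_def)
      fix i t assume i: "i \<in> A" and t: "t \<in> {0::real<..}"
      have "cmod (h i (of_real t * q)) \<le> M i * damping (k * t)" using bound i t by simp
      also have "\<dots> \<le> M i * 1" using M0[OF i] t k by (intro mult_left_mono damping_le(1)) auto
      finally show "cmod (h i (of_real t * q)) \<le> M i" by simp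
    qed
    moreover have "continuous_on {0<..} (\<lambda>t. \<Sum>i\<in>F. h i (of_real t * q))"
      using h F by (intro continuous_on_sum) (auto simp: damped_on_ray_def)
    ultimately show "continuous_on {0<..} (\<lambda>t. H (of_real t * q) - (\<Sum>i\<in>F. h i (of_real t * q)))"
      by (rule continuous_on_diff)
    fix t :: real assume t: "t > 0"
    have "H (of_real t * q) - (\<Sum>i\<in>F. h i (of_real t * q)) = (\<Sum>\<^sub>\<infinity>i\<in>A - F. h i (of_real t * q))"
      unfolding H_def using F by (subst infsum_Diff[OF summ[OF t]]) auto
    also have "cmod \<dots> \<le> (\<Sum>\<^sub>\<infinity>i\<in>A - F. M i * damping (k * t))"
    proof (rule norm_infsum_majorant(2))
      show "(\<lambda>i. M i * damping (k * t)) summable_on A - F"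
        by (rule summable_on_subset_banach[OF summable_on_cmult_left[OF M]]) auto
    qed (use bound t in auto)
    also have "\<dots> = infsum M (A - F) * damping (k * t)" by (rule infsum_cmult_left')
    finally show "cmod (H (of_real t * q) - (\<Sum>i\<in>F. h i (of_real t * q))) \<le> infsum M (A - F) * damping (k * t)" .
  qed
  have diff: "ray_integral q \<zeta> (\<lambda>x. H x - (\<Sum>i\<in>F. h i x)) = ray_integral q \<zeta> H - (\<Sum>i\<in>F. ray_integral q \<zeta> (h i))"
    if "finite F" "F \<subseteq> A" for F
    using that
  proof (induction F rule: finite_induct)
    case (insert i F)
    have "(\<lambda>x. H x - (\<Sum>i\<in>insert i F. h i x)) = (\<lambda>x. (H x - (\<Sum>i\<in>F. h i x)) - h i x)"
      using insert by (simp add: algebra_simps)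
    moreover have "ray_integral q \<zeta> (\<lambda>x. (H x - (\<Sum>i\<in>F. h i x)) - h i x) = ray_integral q \<zeta> (\<lambda>x. H x - (\<Sum>i\<in>F. h i x)) - ray_integral q \<zeta> (h i)"
      using insert by (intro ray_integral_diff[OF k off tail h C]) auto
    ultimately show ?case using insert by simp
  qed simp
  have lim0: "((\<lambda>F. C * (infsum M A - sum M F)) \<longlongrightarrow> C * (infsum M A - infsum M A)) (finite_subsets_at_top A)"
    using has_sum_infsum[OF M] unfolding has_sum_def by (intro tendsto_intros)
  have "((\<lambda>F. ray_integral q \<zeta> H - (\<Sum>i\<in>F. ray_integral q \<zeta> (h i))) \<longlongrightarrow> 0) (finite_subsets_at_top A)"
  proof (rule Lim_null_comparison)
    show "\<forall>\<^sub>F F in finite_subsets_at_top A. norm (ray_integral q \<zeta> H - (\<Sum>i\<in>F. ray_integral q \<zeta> (h i)))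
        \<le> C * (infsum M A - sum M F)"
    proof (rule eventually_finite_subsets_at_top_weakI)
      fix F assume F: "finite F" "F \<subseteq> A"
      have "cmod (ray_integral q \<zeta> (\<lambda>x. H x - (\<Sum>i\<in>F. h i x))) \<le> C * infsum M (A - F)"
        by (rule ray_integral_bound[OF k off tail[OF F] C])
      also have "infsum M (A - F) = infsum M A - sum M F"
        using F by (subst infsum_Diff[OF M]) auto
      finally show "norm (ray_integral q \<zeta> H - (\<Sum>i\<in>F. ray_integral q \<zeta> (h i))) \<le> C * (infsum M A - sum M F)"
        using diff[OF F] by simp
    qed
  qed (use lim0 in simp)
  from tendsto_diff[OF tendsto_const[of "ray_integral q \<zeta> H"] this]
  show ?thesis unfolding has_sum_def H_def by simp
qed

section \<open>The iteration in complexified parameters\<close>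

text \<open>For each direction \<open>d\<close> of a ray, \<open>\<sigma> d\<close> is the side from which the function takes its values on this ray. The
  exponent \<open>L\<close> carries the smallness of the sum over charges, and the conditions on \<open>R\<close> leave room for the
  factors lost to complex angles (\<open>C\<close>), to the Lipschitz constant and to the change of the base point
  (the factor \<open>2\<close> at \<open>L\<close>), and for the damping along the ray (\<open>z\<^sub>0\<close>).\<close>

locale rotated_iteration =
  fixes U :: "complex set" and Z :: "charge \<Rightarrow> complex \<Rightarrow> complex" and f :: "charge \<Rightarrow> charge \<Rightarrow> rat"
    and \<rho> :: complex and \<sigma> :: "complex \<Rightarrow> real" and m C z\<^sub>0 L \<tau> R :: real
  assumes U: "open U" and Z_holo: "Z \<gamma> holomorphic_on U"
    and Z_linear: "a \<in> U \<Longrightarrow> Z \<gamma> a = of_int (fst \<gamma>) * Z gamma1 a + of_int (snd \<gamma>) * Z gamma2 a"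
    and \<rho>: "\<rho> \<noteq> 0" and \<sigma>: "d \<in> {\<rho>, - \<rho>} \<Longrightarrow> \<sigma> d = 1 \<or> \<sigma> d = - 1"
    and m: "0 < m" "m \<le> 1" and C: "0 < C" and L: "C \<le> L" and \<tau>: "0 \<le> \<tau>" "(20 / m + 4 * pi) * \<tau> \<le> 1"
    and active: "d \<in> {\<rho>, - \<rho>} \<Longrightarrow> a \<in> U \<Longrightarrow> \<gamma>' \<in> positive_charges U Z d \<Longrightarrow> f \<gamma> \<gamma>' \<noteq> 0 \<Longrightarrow>
      Re (Z \<gamma>' a * cnj d) \<le> - (2 * m) * cmod d * cmod (Z \<gamma>' a) \<and>
      real_of_int \<bar>fst \<gamma>'\<bar> + real_of_int \<bar>snd \<gamma>'\<bar> \<le> C * cmod (Z \<gamma>' a) \<and> z\<^sub>0 \<le> cmod (Z \<gamma>' a)"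
    and sums: "d \<in> {\<rho>, - \<rho>} \<Longrightarrow> \<gamma> \<in> {gamma1, gamma2} \<Longrightarrow> a \<in> U \<Longrightarrow>
      (\<lambda>\<gamma>'. \<bar>real_of_rat (f \<gamma> \<gamma>')\<bar> * exp (- L * cmod (Z \<gamma>' a))) summable_on positive_charges U Z d \<and>
      (\<Sum>\<^sub>\<infinity>\<gamma>'\<in>positive_charges U Z d. \<bar>real_of_rat (f \<gamma> \<gamma>')\<bar> * exp (- L * cmod (Z \<gamma>' a))) \<le> \<tau>"
    and R: "2 * L + 2 * C \<le> pi * R * m / 4" "2 \<le> pi * R * m / 4 * z\<^sub>0"
begin

lemma tilted: "d \<in> {\<rho>, - \<rho>} \<Longrightarrow> tilted_sector (\<sigma> d) m (cmod d)"
  using \<sigma> m \<rho> by unfold_locales auto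

text \<open>The coordinates are \<open>a\<close>, an independent variable in place of the conjugate of \<open>a\<close>, and the two angles. The
  condition on \<open>Z\<close> keeps the two incarnations of \<open>Z\<^sub>\<gamma>\<close> so close, relative to \<open>\<bar>Z\<^sub>\<gamma>\<bar>\<close>, that the decay along
  the rays persists.\<close>

definition params :: "(complex ^ 4) set" where
  "params = {p. p $ 1 \<in> U \<and> cnj (p $ 2) \<in> U \<and>
     cmod (Z gamma1 (p $ 1) - Z gamma1 (cnj (p $ 2))) < m / (4 * C) \<and>
     cmod (Z gamma2 (p $ 1) - Z gamma2 (cnj (p $ 2))) < m / (4 * C) \<and>
     \<bar>Im (p $ 3)\<bar> < 1 \<and> \<bar>Im (p $ 4)\<bar> < 1}"

definition X :: "charge \<Rightarrow> complex ^ 4 \<Rightarrow> complex \<Rightarrow> complex \<times> complex \<Rightarrow> complex" where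
  "X \<gamma> p \<zeta> \<Phi> = exp (of_real (pi * R) * Z \<gamma> (p $ 1) / \<zeta>
     + \<i> * (of_int (fst \<gamma>) * fst \<Phi> + of_int (snd \<gamma>) * snd \<Phi>)
     + of_real (pi * R) * \<zeta> * cnj (Z \<gamma> (cnj (p $ 2))))"

definition source :: "complex \<Rightarrow> charge \<Rightarrow> (complex ^ 4 \<Rightarrow> complex option \<Rightarrow> complex \<times> complex) \<Rightarrow>
    complex ^ 4 \<Rightarrow> complex \<Rightarrow> complex" where
  "source d \<gamma> \<Phi> p w = (\<Sum>\<^sub>\<infinity>\<gamma>'\<in>positive_charges U Z d. of_rat (f \<gamma> \<gamma>') * X \<gamma>' p (d * w) (\<Phi> p (Some (d * w))))"

text \<open>The contribution of one ray to the step, brought into the bounded form.\<close>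

definition ray_part :: "complex \<Rightarrow> charge \<Rightarrow> (complex ^ 4 \<Rightarrow> complex option \<Rightarrow> complex \<times> complex) \<Rightarrow>
    complex ^ 4 \<Rightarrow> complex option \<Rightarrow> complex" where
  "ray_part d \<gamma> \<Phi> p \<zeta> = sided_integral True (\<sigma> d) m (source d \<gamma> \<Phi> p) (map_option (\<lambda>z. z / d) \<zeta>)"

definition rotated_step :: "(complex ^ 4 \<Rightarrow> complex option \<Rightarrow> complex \<times> complex) \<Rightarrow>
    complex ^ 4 \<Rightarrow> complex option \<Rightarrow> complex \<times> complex" where
  "rotated_step \<Phi> p \<zeta> =
     (p $ 3 - 1 / (4 * of_real pi) * (ray_part \<rho> gamma1 \<Phi> p \<zeta> + ray_part (- \<rho>) gamma1 \<Phi> p \<zeta>),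
      p $ 4 - 1 / (4 * of_real pi) * (ray_part \<rho> gamma2 \<Phi> p \<zeta> + ray_part (- \<rho>) gamma2 \<Phi> p \<zeta>))"

text \<open>The invariant of the iteration. Values in the sectors along both rays are needed in order to rotate, and
  imaginary parts must stay bounded because the exponentials contain \<open>e\<^sup>\<i>\<^sup>\<Phi>\<close>.\<close>

definition regular :: "(complex ^ 4 \<Rightarrow> complex option \<Rightarrow> complex \<times> complex) \<Rightarrow> bool" where
  "regular \<Phi> \<longleftrightarrow> (\<forall>\<pi>\<in>{fst, snd}.
     (\<forall>p\<in>params. \<forall>\<zeta>. \<bar>Im (\<pi> (\<Phi> p \<zeta>))\<bar> \<le> 2) \<and>
     (\<forall>\<zeta>. line_holo params (\<lambda>p. \<pi> (\<Phi> p \<zeta>))) \<and>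
     (\<forall>p\<in>params. \<forall>d\<in>{\<rho>, - \<rho>}.
        continuous_on (sector (\<sigma> d) m - {0}) (\<lambda>w. \<pi> (\<Phi> p (Some (d * w)))) \<and>
        (\<lambda>w. \<pi> (\<Phi> p (Some (d * w)))) holomorphic_on open_sector (\<sigma> d) m))"

lemma regularD:
  assumes "regular \<Phi>" "\<pi> \<in> {fst, snd}"
  shows "p \<in> params \<Longrightarrow> \<bar>Im (\<pi> (\<Phi> p \<zeta>))\<bar> \<le> 2"
    and "line_holo params (\<lambda>p. \<pi> (\<Phi> p \<zeta>))"
    and "p \<in> params \<Longrightarrow> d \<in> {\<rho>, - \<rho>} \<Longrightarrow> continuous_on (sector (\<sigma> d) m - {0}) (\<lambda>w. \<pi> (\<Phi> p (Some (d * w))))"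
    and "p \<in> params \<Longrightarrow> d \<in> {\<rho>, - \<rho>} \<Longrightarrow> (\<lambda>w. \<pi> (\<Phi> p (Some (d * w)))) holomorphic_on open_sector (\<sigma> d) m"
  using assms unfolding regular_def by blast+

lemma regular_Im:
  assumes "regular \<Phi>" "p \<in> params"
  shows "\<bar>Im (fst (\<Phi> p \<zeta>))\<bar> \<le> 2" "\<bar>Im (snd (\<Phi> p \<zeta>))\<bar> \<le> 2"
  using regularD(1)[OF assms(1) _ assms(2), of fst] regularD(1)[OF assms(1) _ assms(2), of snd] by auto

lemma open_params: "open params"
proof -
  define V where "V = {p :: complex ^ 4. p $ 1 \<in> U \<and> cnj (p $ 2) \<in> U}"
  define g where "g \<gamma> p = cmod (Z \<gamma> (p $ 1) - Z \<gamma> (cnj (p $ 2)))" for \<gamma> and p :: "complex ^ 4"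
  have V: "open V" unfolding V_def
    by (intro open_Collect_conj open_vimage[OF U, unfolded vimage_def] continuous_intros)
  have g: "continuous_on V (g \<gamma>)" for \<gamma>
    unfolding g_def
    by (intro continuous_intros continuous_on_compose2[OF holomorphic_on_imp_continuous_on[OF Z_holo]])
       (auto simp: V_def intro!: continuous_intros)
  have 1: "open (g \<gamma> -` {..< m / (4 * C)} \<inter> V)" for \<gamma>
    using continuous_on_open_vimage[OF V] g open_lessThan by blast
  have 2: "open {p :: complex ^ 4. \<bar>Im (p $ 3)\<bar> < 1 \<and> \<bar>Im (p $ 4)\<bar> < 1}"
    by (intro open_Collect_conj open_Collect_less continuous_intros)
  have "open ((g gamma1 -` {..< m / (4 * C)} \<inter> V) \<inter> (g gamma2 -` {..< m / (4 * C)} \<inter> V)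
      \<inter> {p. \<bar>Im (p $ 3)\<bar> < 1 \<and> \<bar>Im (p $ 4)\<bar> < 1})"
    by (rule open_Int[OF open_Int[OF 1 1] 2])
  also have "\<dots> = params" by (auto simp: params_def V_def g_def)
  finally show ?thesis .
qed

lemma active_size:
  assumes "d \<in> {\<rho>, - \<rho>}" "a \<in> U" "\<gamma>' \<in> positive_charges U Z d" "f \<gamma> \<gamma>' \<noteq> 0"
  shows "Re (Z \<gamma>' a * cnj d) \<le> - (2 * m) * cmod d * cmod (Z \<gamma>' a)"
    and "real_of_int \<bar>fst \<gamma>'\<bar> + real_of_int \<bar>snd \<gamma>'\<bar> \<le> C * cmod (Z \<gamma>' a)"
    and "z\<^sub>0 \<le> cmod (Z \<gamma>' a)"
  using active[OF assms] by auto

lemma Z_diff_bound: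
  assumes "a \<in> U" "b \<in> U" "cmod (Z gamma1 a - Z gamma1 b) \<le> \<eta>" "cmod (Z gamma2 a - Z gamma2 b) \<le> \<eta>"
  shows "cmod (Z \<gamma> a - Z \<gamma> b) \<le> (real_of_int \<bar>fst \<gamma>\<bar> + real_of_int \<bar>snd \<gamma>\<bar>) * \<eta>"
proof -
  have "Z \<gamma> a - Z \<gamma> b = of_int (fst \<gamma>) * (Z gamma1 a - Z gamma1 b) + of_int (snd \<gamma>) * (Z gamma2 a - Z gamma2 b)"
    using Z_linear[OF assms(1), of \<gamma>] Z_linear[OF assms(2), of \<gamma>] by (simp add: algebra_simps)
  also have "cmod \<dots> \<le> \<bar>fst \<gamma>\<bar> * cmod (Z gamma1 a - Z gamma1 b) + \<bar>snd \<gamma>\<bar> * cmod (Z gamma2 a - Z gamma2 b)"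
    by (rule order_trans[OF norm_triangle_ineq]) (simp add: norm_mult)
  also have "\<dots> \<le> \<bar>fst \<gamma>\<bar> * \<eta> + \<bar>snd \<gamma>\<bar> * \<eta>"
    using assms by (intro add_mono mult_left_mono) auto
  finally show ?thesis by (simp add: distrib_right)
qed

text \<open>Write \<open>A = \<kappa> \<bar>Z\<^sub>\<gamma>\<bar>\<close> with \<open>\<kappa> = \<pi> R m / 4\<close>, and \<open>y = \<bar>\<zeta>\<bar> + 1 / \<bar>\<zeta>\<bar>\<close>. The exponent is at most \<open>2 C \<bar>Z\<^sub>\<gamma>\<bar> - A y\<close>,
  and since both \<open>A\<close> and \<open>y\<close> are at least \<open>2\<close>, the product \<open>A y\<close> dominates the sum \<open>A + y\<close>. This separates the
  smallness in \<open>\<bar>Z\<^sub>\<gamma>\<bar>\<close>, needed for the sum over charges, from the damping in \<open>\<zeta>\<close>, needed for the integral.\<close>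

lemma X_bound:
  assumes d: "d \<in> {\<rho>, - \<rho>}" and \<gamma>': "\<gamma>' \<in> positive_charges U Z d" "f \<gamma> \<gamma>' \<noteq> 0" and p: "p \<in> params"
    and \<Phi>: "\<bar>Im (fst \<Phi>)\<bar> \<le> 2" "\<bar>Im (snd \<Phi>)\<bar> \<le> 2" and w: "w \<noteq> 0" "\<bar>Im w\<bar> \<le> m * Re w"
  shows "cmod (X \<gamma>' p (d * w) \<Phi>) \<le> exp (- (2 * L) * cmod (Z \<gamma>' (p $ 1))) * damping (cmod d * cmod w)"
proof -
  define z where "z = Z \<gamma>' (p $ 1)"
  define v where "v = cnj (Z \<gamma>' (cnj (p $ 2)))"
  define n where "n = real_of_int \<bar>fst \<gamma>'\<bar> + real_of_int \<bar>snd \<gamma>'\<bar>"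
  define \<zeta> where "\<zeta> = d * w"
  define \<kappa> where "\<kappa> = pi * R * m / 4"
  have pU: "p $ 1 \<in> U" "cnj (p $ 2) \<in> U" using p by (auto simp: params_def)
  have a1: "Re (z * cnj d) \<le> - (2 * m) * cmod d * cmod z" and a2: "n \<le> C * cmod z" and a3: "z\<^sub>0 \<le> cmod z"
    using active_size[OF d pU(1) \<gamma>'] by (auto simp: z_def n_def)
  have d0: "d \<noteq> 0" using d \<rho> by auto
  have \<zeta>0: "cmod \<zeta> > 0" using d0 w by (simp add: \<zeta>_def)
  have \<kappa>: "\<kappa> > 0" using R(1) L C by (simp add: \<kappa>_def)
  then have R0: "pi * R > 0" using m by (simp add: \<kappa>_def zero_less_mult_iff)
  have "0 \<le> m * Re w" using w(2) abs_ge_zero[of "Im w"] by linarith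
  then have Re0: "0 \<le> Re w" using m by (simp add: zero_le_mult_iff)
  have w2: "cmod w \<le> 2 * Re w"
  proof -
    have "m * Re w \<le> 1 * Re w" by (rule mult_right_mono) (use m Re0 in auto)
    then show ?thesis using cmod_le[of w] w Re0 by linarith
  qed
  have decay: "Re (z * cnj \<zeta>) \<le> - (m / 2) * cmod z * cmod \<zeta>"
  proof -
    have "Re (z * cnj \<zeta>) = Re (z * cnj d) * Re w + Im (z * cnj d) * Im w"
      by (simp add: \<zeta>_def algebra_simps)
    moreover have "Re (z * cnj d) * Re w \<le> (- (2 * m) * cmod d * cmod z) * Re w"
      by (rule mult_right_mono[OF a1 Re0])
    moreover have "Im (z * cnj d) * Im w \<le> (cmod z * cmod d) * (m * Re w)"
    proof -
      have "\<bar>Im (z * cnj d)\<bar> \<le> cmod z * cmod d"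
        using abs_Im_le_cmod[of "z * cnj d"] by (simp add: norm_mult)
      then have "\<bar>Im (z * cnj d)\<bar> * \<bar>Im w\<bar> \<le> (cmod z * cmod d) * (m * Re w)"
        using w by (intro mult_mono) auto
      moreover have "Im (z * cnj d) * Im w \<le> \<bar>Im (z * cnj d)\<bar> * \<bar>Im w\<bar>"
        unfolding abs_mult[symmetric] by (rule abs_ge_self)
      ultimately show ?thesis by linarith
    qed
    ultimately have "Re (z * cnj \<zeta>) \<le> - (m * cmod z * cmod d) * Re w" by (simp add: algebra_simps)
    also have "\<dots> \<le> - (m * cmod z * cmod d) * (cmod w / 2)"
      by (rule mult_left_mono_neg) (use w2 m in auto)
    finally show ?thesis by (simp add: \<zeta>_def norm_mult algebra_simps)
  qed
  have r1: "Re (z / \<zeta>) \<le> - (m / 4) * cmod z * (1 / cmod \<zeta>)"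
  proof -
    have "Re (z / \<zeta>) = Re (z * cnj \<zeta>) / (cmod \<zeta>)\<^sup>2"
      by (metis Re_divide_of_real complex_div_cnj of_real_power)
    also have "\<dots> \<le> (- (m / 2) * cmod z * cmod \<zeta>) / (cmod \<zeta>)\<^sup>2" by (rule divide_right_mono[OF decay]) simp
    also have "\<dots> = - (m / 2) * (cmod z * (1 / cmod \<zeta>))" using \<zeta>0 by (simp add: power2_eq_square)
    also have "\<dots> \<le> - (m / 4) * (cmod z * (1 / cmod \<zeta>))" by (rule mult_right_mono) (use m in auto)
    finally show ?thesis by (simp add: mult.assoc)
  qed
  have r2: "Re (\<zeta> * v) \<le> - (m / 4) * cmod z * cmod \<zeta>"
  proof -
    have "cmod (z - cnj v) \<le> n * (m / (4 * C))"
      using Z_diff_bound[OF pU, of "m / (4 * C)" \<gamma>'] p by (auto simp: z_def v_def n_def params_def)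
    also have "\<dots> \<le> (C * cmod z) * (m / (4 * C))" by (rule mult_right_mono[OF a2]) (use m C in simp)
    also have "\<dots> = m / 4 * cmod z" using C by simp
    finally have zv: "cmod (z - cnj v) \<le> m / 4 * cmod z" .
    have "Re (\<zeta> * v) = Re (z * cnj \<zeta>) - Re ((z - cnj v) * cnj \<zeta>)" by (simp add: algebra_simps)
    moreover have "\<bar>Re ((z - cnj v) * cnj \<zeta>)\<bar> \<le> (m / 4 * cmod z) * cmod \<zeta>"
      using abs_Re_le_cmod[of "(z - cnj v) * cnj \<zeta>"] mult_right_mono[OF zv, of "cmod \<zeta>"]
      by (simp add: norm_mult)
    moreover have "- (m / 2) * cmod z * cmod \<zeta> + (m / 4 * cmod z) * cmod \<zeta> = - (m / 4) * cmod z * cmod \<zeta>"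
      by (simp add: algebra_simps)
    ultimately show ?thesis using decay by linarith
  qed
  have r3: "Re (\<i> * (of_int (fst \<gamma>') * fst \<Phi> + of_int (snd \<gamma>') * snd \<Phi>)) \<le> 2 * C * cmod z"
  proof -
    have "Re (\<i> * (of_int (fst \<gamma>') * fst \<Phi> + of_int (snd \<gamma>') * snd \<Phi>))
        = - (real_of_int (fst \<gamma>') * Im (fst \<Phi>) + real_of_int (snd \<gamma>') * Im (snd \<Phi>))" by simp
    also have "\<dots> \<le> \<bar>real_of_int (fst \<gamma>') * Im (fst \<Phi>)\<bar> + \<bar>real_of_int (snd \<gamma>') * Im (snd \<Phi>)\<bar>" by linarith
    also have "\<dots> \<le> real_of_int \<bar>fst \<gamma>'\<bar> * 2 + real_of_int \<bar>snd \<gamma>'\<bar> * 2"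
      unfolding abs_mult of_int_abs by (intro add_mono mult_left_mono \<Phi>) auto
    finally show ?thesis using a2 by (simp add: n_def)
  qed
  define y where "y = cmod \<zeta> + 1 / cmod \<zeta>"
  define A where "A = \<kappa> * cmod z"
  have "A \<ge> 2"
  proof -
    have "\<kappa> * z\<^sub>0 \<le> A" unfolding A_def by (rule mult_left_mono[OF a3]) (use \<kappa> in simp)
    then show ?thesis using R(2) by (simp add: \<kappa>_def)
  qed
  moreover have "y \<ge> 2"
  proof -
    have "0 \<le> (cmod \<zeta> - 1)\<^sup>2 / cmod \<zeta>" by simp
    also have "\<dots> = y - 2" using \<zeta>0 by (simp add: y_def power2_eq_square field_simps)
    finally show ?thesis by simp
  qed
  ultimately have "1 * 1 \<le> (A - 1) * (y - 1)" by (intro mult_mono) auto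
  then have Ay: "A + y \<le> A * y" by (simp add: algebra_simps)
  have A_ge: "(2 * L + 2 * C) * cmod z \<le> A"
    unfolding A_def \<kappa>_def by (rule mult_right_mono[OF R(1)]) simp
  have "Re (of_real (pi * R) * z / \<zeta> + \<i> * (of_int (fst \<gamma>') * fst \<Phi> + of_int (snd \<gamma>') * snd \<Phi>) + of_real (pi * R) * \<zeta> * v)
     = pi * R * Re (z / \<zeta>) + Re (\<i> * (of_int (fst \<gamma>') * fst \<Phi> + of_int (snd \<gamma>') * snd \<Phi>)) + pi * R * Re (\<zeta> * v)"
  proof -
    have "of_real (pi * R) * z / \<zeta> = of_real (pi * R) * (z / \<zeta>)" "of_real (pi * R) * \<zeta> * v = of_real (pi * R) * (\<zeta> * v)"
      by simp_all
    moreover have "Re (of_real x * u) = x * Re u" for x u by simp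
    ultimately show ?thesis by (simp only: plus_complex.sel)
  qed
  also have "\<dots> \<le> pi * R * (- (m / 4) * cmod z * (1 / cmod \<zeta>)) + 2 * C * cmod z + pi * R * (- (m / 4) * cmod z * cmod \<zeta>)"
    using R0 by (intro add_mono mult_left_mono r1 r2 r3) auto
  also have "\<dots> = 2 * C * cmod z - A * y" by (simp add: A_def y_def \<kappa>_def algebra_simps)
  also have "\<dots> \<le> - (2 * L) * cmod z - y" using Ay A_ge by (simp add: algebra_simps)
  finally have "Re (of_real (pi * R) * z / \<zeta> + \<i> * (of_int (fst \<gamma>') * fst \<Phi> + of_int (snd \<gamma>') * snd \<Phi>) + of_real (pi * R) * \<zeta> * v)
     \<le> - (2 * L) * cmod z + - y" by simp
  then have "cmod (X \<gamma>' p \<zeta> \<Phi>) \<le> exp (- (2 * L) * cmod z + - y)"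
    by (simp add: X_def norm_exp_eq_Re z_def v_def)
  also have "\<dots> = exp (- (2 * L) * cmod z) * damping (cmod d * cmod w)"
    unfolding exp_add by (simp add: damping_def y_def \<zeta>_def norm_mult)
  finally show ?thesis by (simp add: \<zeta>_def z_def)
qed

lemma X_weak_bound:
  assumes "d \<in> {\<rho>, - \<rho>}" "\<gamma>' \<in> positive_charges U Z d" "f \<gamma> \<gamma>' \<noteq> 0" "p \<in> params"
    "\<bar>Im (fst \<Phi>)\<bar> \<le> 2" "\<bar>Im (snd \<Phi>)\<bar> \<le> 2" "w \<noteq> 0" "\<bar>Im w\<bar> \<le> m * Re w"
  shows "cmod (X \<gamma>' p (d * w) \<Phi>) \<le> exp (- L * cmod (Z \<gamma>' (p $ 1))) * damping (cmod d * cmod w)"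
proof -
  have "exp (- (2 * L) * cmod (Z \<gamma>' (p $ 1))) \<le> exp (- L * cmod (Z \<gamma>' (p $ 1)))"
    using L C by (simp add: mult_right_mono)
  then show ?thesis
    using X_bound[OF assms] mult_right_mono[of _ _ "damping (cmod d * cmod w)"] damping_pos[of "cmod d * cmod w"]
    by (meson less_imp_le order_trans)
qed

text \<open>The Lipschitz constant of the exponent is at most \<open>C \<bar>Z\<^sub>\<gamma>\<bar>\<close>, and half of the exponent \<open>2 L\<close> absorbs it.\<close>

lemma X_lipschitz:
  assumes d: "d \<in> {\<rho>, - \<rho>}" and \<gamma>': "\<gamma>' \<in> positive_charges U Z d" "f \<gamma> \<gamma>' \<noteq> 0" and p: "p \<in> params"
    and \<Phi>: "\<bar>Im (fst \<Phi>)\<bar> \<le> 2" "\<bar>Im (snd \<Phi>)\<bar> \<le> 2"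
    and \<Psi>: "\<bar>Im (fst \<Psi>)\<bar> \<le> 2" "\<bar>Im (snd \<Psi>)\<bar> \<le> 2"
    and w: "w \<noteq> 0" "\<bar>Im w\<bar> \<le> m * Re w"
    and e: "cmod (fst \<Phi> - fst \<Psi>) \<le> e" "cmod (snd \<Phi> - snd \<Psi>) \<le> e"
  shows "cmod (X \<gamma>' p (d * w) \<Phi> - X \<gamma>' p (d * w) \<Psi>)
    \<le> exp (- L * cmod (Z \<gamma>' (p $ 1))) * damping (cmod d * cmod w) * e"
proof -
  define x where "x = cmod (Z \<gamma>' (p $ 1))"
  define B where "B = exp (- (2 * L) * x) * damping (cmod d * cmod w)"
  define n where "n = real_of_int \<bar>fst \<gamma>'\<bar> + real_of_int \<bar>snd \<gamma>'\<bar>"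
  have n: "n \<le> C * x" using active_size(2)[OF d _ \<gamma>'] p by (auto simp: n_def x_def params_def)
  have e0: "e \<ge> 0" by (rule order_trans[OF norm_ge_zero e(1)])
  have x0: "x \<ge> 0" by (simp add: x_def)
  have "cmod (X \<gamma>' p (d * w) \<Phi> - X \<gamma>' p (d * w) \<Psi>) \<le> B *
     cmod (\<i> * (of_int (fst \<gamma>') * (fst \<Phi> - fst \<Psi>) + of_int (snd \<gamma>') * (snd \<Phi> - snd \<Psi>)))"
    using exp_lipschitz[OF X_bound[OF d \<gamma>' p \<Phi> w, unfolded X_def] X_bound[OF d \<gamma>' p \<Psi> w, unfolded X_def]]
    by (simp add: X_def B_def x_def algebra_simps)
  also have "B * cmod (\<i> * (of_int (fst \<gamma>') * (fst \<Phi> - fst \<Psi>) + of_int (snd \<gamma>') * (snd \<Phi> - snd \<Psi>))) \<le> B * (n * e)"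
  proof (rule mult_left_mono)
    have "cmod (of_int (fst \<gamma>') * (fst \<Phi> - fst \<Psi>) + of_int (snd \<gamma>') * (snd \<Phi> - snd \<Psi>))
       \<le> real_of_int \<bar>fst \<gamma>'\<bar> * cmod (fst \<Phi> - fst \<Psi>) + real_of_int \<bar>snd \<gamma>'\<bar> * cmod (snd \<Phi> - snd \<Psi>)"
      by (rule order_trans[OF norm_triangle_ineq]) (simp add: norm_mult)
    also have "\<dots> \<le> real_of_int \<bar>fst \<gamma>'\<bar> * e + real_of_int \<bar>snd \<gamma>'\<bar> * e"
      using e by (intro add_mono mult_left_mono) auto
    finally show "cmod (\<i> * (of_int (fst \<gamma>') * (fst \<Phi> - fst \<Psi>) + of_int (snd \<gamma>') * (snd \<Phi> - snd \<Psi>))) \<le> n * e"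
      by (simp add: n_def norm_mult distrib_right)
  qed (simp add: B_def less_imp_le damping_pos)
  also have "B * (n * e) \<le> B * (exp (L * x) * e)"
  proof (intro mult_left_mono mult_right_mono)
    have "C * x \<le> L * x" by (rule mult_right_mono[OF L x0])
    then show "n \<le> exp (L * x)" using n exp_ge_add_one_self[of "L * x"] by linarith
  qed (use e0 damping_pos[of "cmod d * cmod w"] in \<open>auto simp: B_def less_imp_le\<close>)
  also have "\<dots> = exp (- (2 * L) * x) * exp (L * x) * damping (cmod d * cmod w) * e"
    by (simp add: B_def)
  also have "exp (- (2 * L) * x) * exp (L * x) = exp (- L * x)"
    unfolding exp_add[symmetric] by (simp add: algebra_simps)
  finally show ?thesis
    by (simp add: x_def)
qed

lemma sectorD:
  assumes "d \<in> {\<rho>, - \<rho>}" "w \<in> sector (\<sigma> d) m - {0}"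
  shows "w \<noteq> 0" "\<bar>Im w\<bar> \<le> m * Re w" "0 < Re w"
proof -
  show w0: "w \<noteq> 0" using assms by simp
  show 1: "\<bar>Im w\<bar> \<le> m * Re w" using assms \<sigma>[OF assms(1)] by (auto simp: sector_def)
  have "0 \<le> m * Re w" using 1 abs_ge_zero[of "Im w"] by linarith
  then have "0 \<le> Re w" using m by (simp add: zero_le_mult_iff)
  moreover have "Re w \<noteq> 0" using 1 w0 by (auto simp: complex_eq_iff)
  ultimately show "0 < Re w" by simp
qed

lemma source_term_bound:
  assumes \<Phi>: "regular \<Phi>" and d: "d \<in> {\<rho>, - \<rho>}" and \<gamma>': "\<gamma>' \<in> positive_charges U Z d"
    and p: "p \<in> params" and w: "w \<in> sector (\<sigma> d) m - {0}"
  shows "cmod (of_rat (f \<gamma> \<gamma>') * X \<gamma>' p (d * w) (\<Phi> p (Some (d * w))))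
     \<le> \<bar>real_of_rat (f \<gamma> \<gamma>')\<bar> * exp (- L * cmod (Z \<gamma>' (p $ 1))) * damping (cmod d * cmod w)"
proof (cases "f \<gamma> \<gamma>' = 0")
  case False
  have "cmod (X \<gamma>' p (d * w) (\<Phi> p (Some (d * w)))) \<le> exp (- L * cmod (Z \<gamma>' (p $ 1))) * damping (cmod d * cmod w)"
    by (rule X_weak_bound[OF d \<gamma>' False p regular_Im[OF \<Phi> p] sectorD(1,2)[OF d w]])
  then show ?thesis unfolding norm_mult cmod_of_rat mult.assoc by (rule mult_left_mono) simp
qed simp

lemma source_sums:
  fixes p :: "complex ^ 4"
  assumes "d \<in> {\<rho>, - \<rho>}" "\<gamma> \<in> {gamma1, gamma2}" "p \<in> params"
  shows "(\<lambda>\<gamma>'. \<bar>real_of_rat (f \<gamma> \<gamma>')\<bar> * exp (- L * cmod (Z \<gamma>' (p $ 1)))) summable_on positive_charges U Z d"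
    and "(\<Sum>\<^sub>\<infinity>\<gamma>'\<in>positive_charges U Z d. \<bar>real_of_rat (f \<gamma> \<gamma>')\<bar> * exp (- L * cmod (Z \<gamma>' (p $ 1)))) \<le> \<tau>"
  using sums[OF assms(1,2)] assms(3) by (auto simp: params_def)

lemma source_term_damped:
  assumes \<Phi>: "regular \<Phi>" and d: "d \<in> {\<rho>, - \<rho>}" and \<gamma>': "\<gamma>' \<in> positive_charges U Z d"
    and p: "p \<in> params"
  shows "damped (\<sigma> d) m (cmod d) (\<bar>real_of_rat (f \<gamma> \<gamma>')\<bar> * exp (- L * cmod (Z \<gamma>' (p $ 1))))
     (\<lambda>w. of_rat (f \<gamma> \<gamma>') * X \<gamma>' p (d * w) (\<Phi> p (Some (d * w))))"
proof -
  have d0: "d \<noteq> 0" using d \<rho> by auto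
  define u v where "u w = fst (\<Phi> p (Some (d * w)))" and "v w = snd (\<Phi> p (Some (d * w)))" for w
  have g_eq: "(\<lambda>w. of_rat (f \<gamma> \<gamma>') * X \<gamma>' p (d * w) (\<Phi> p (Some (d * w))))
   = (\<lambda>w. of_rat (f \<gamma> \<gamma>') * exp (of_real (pi * R) * Z \<gamma>' (p $ 1) / (d * w)
     + \<i> * (of_int (fst \<gamma>') * u w + of_int (snd \<gamma>') * v w)
     + of_real (pi * R) * (d * w) * cnj (Z \<gamma>' (cnj (p $ 2)))))"
    by (rule ext) (simp add: X_def u_def v_def)
  have uv: "continuous_on (sector (\<sigma> d) m - {0}) u" "continuous_on (sector (\<sigma> d) m - {0}) v"
    "u holomorphic_on open_sector (\<sigma> d) m" "v holomorphic_on open_sector (\<sigma> d) m"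
    using regularD(3,4)[OF \<Phi> _ p d, of fst] regularD(3,4)[OF \<Phi> _ p d, of snd]
    by (simp_all add: u_def[abs_def] v_def[abs_def])
  show ?thesis unfolding damped_def
  proof (intro conjI ballI source_term_bound[OF \<Phi> d \<gamma>' p])
    show "continuous_on (sector (\<sigma> d) m - {0}) (\<lambda>w. of_rat (f \<gamma> \<gamma>') * X \<gamma>' p (d * w) (\<Phi> p (Some (d * w))))"
      unfolding g_eq using d0 by (intro continuous_intros uv) auto
    show "(\<lambda>w. of_rat (f \<gamma> \<gamma>') * X \<gamma>' p (d * w) (\<Phi> p (Some (d * w)))) holomorphic_on open_sector (\<sigma> d) m"
      unfolding g_eq using d0 open_sector_subset[of "\<sigma> d" m] by (intro holomorphic_intros uv) auto
  qed
qed

lemma source_damped: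
  assumes \<Phi>: "regular \<Phi>" and d: "d \<in> {\<rho>, - \<rho>}" and \<gamma>: "\<gamma> \<in> {gamma1, gamma2}" and p: "p \<in> params"
  shows "damped (\<sigma> d) m (cmod d) \<tau> (source d \<gamma> \<Phi> p)"
proof -
  let ?M = "\<lambda>\<gamma>'. \<bar>real_of_rat (f \<gamma> \<gamma>')\<bar> * exp (- L * cmod (Z \<gamma>' (p $ 1)))"
  let ?g = "\<lambda>\<gamma>' w. of_rat (f \<gamma> \<gamma>') * X \<gamma>' p (d * w) (\<Phi> p (Some (d * w)))"
  note M = source_sums[OF d \<gamma> p]
  note tb = source_term_bound[OF \<Phi> d _ p]
  note td = source_term_damped[OF \<Phi> d _ p]
  have d0: "d \<noteq> 0" using d \<rho> by auto
  have bound: "cmod (?g \<gamma>' w) \<le> ?M \<gamma>'" if "\<gamma>' \<in> positive_charges U Z d" "w \<in> sector (\<sigma> d) m - {0}" for \<gamma>' w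
  proof -
    have "?M \<gamma>' * damping (cmod d * cmod w) \<le> ?M \<gamma>' * 1"
      using that d0 by (intro mult_left_mono damping_le(1)) auto
    then show ?thesis using tb[OF that, of \<gamma>] by simp
  qed
  show ?thesis unfolding damped_def
  proof (intro conjI ballI)
    show "continuous_on (sector (\<sigma> d) m - {0}) (source d \<gamma> \<Phi> p)"
      unfolding source_def
      by (rule continuous_on_infsum[OF _ bound M(1)]) (use td in \<open>simp_all add: damped_def\<close>)
    show "source d \<gamma> \<Phi> p holomorphic_on open_sector (\<sigma> d) m"
      unfolding source_def
      by (rule holomorphic_on_infsum[OF open_open_sector _ bound M(1)])
         (use td open_sector_subset[of "\<sigma> d" m] in \<open>auto simp: damped_def\<close>)
    fix w assume w: "w \<in> sector (\<sigma> d) m - {0}"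
    have "cmod (source d \<gamma> \<Phi> p w) \<le> (\<Sum>\<^sub>\<infinity>\<gamma>'\<in>positive_charges U Z d. ?M \<gamma>' * damping (cmod d * cmod w))"
      unfolding source_def
      by (rule norm_infsum_majorant(2)[OF summable_on_cmult_left[OF M(1)] tb[OF _ w]])
    also have "\<dots> = infsum ?M (positive_charges U Z d) * damping (cmod d * cmod w)"
      by (rule infsum_cmult_left')
    also have "\<dots> \<le> \<tau> * damping (cmod d * cmod w)"
      by (rule mult_right_mono[OF M(2)]) (simp add: less_imp_le damping_pos)
    finally show "cmod (source d \<gamma> \<Phi> p w) \<le> \<tau> * damping (cmod d * cmod w)" .
  qed
qed

lemma source_diff_damped:
  assumes \<Phi>: "regular \<Phi>" and \<Psi>: "regular \<Psi>" and d: "d \<in> {\<rho>, - \<rho>}" and \<gamma>: "\<gamma> \<in> {gamma1, gamma2}" and p: "p \<in> params"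
    and e: "\<And>\<zeta>. cmod (fst (\<Phi> p \<zeta>) - fst (\<Psi> p \<zeta>)) \<le> e" "\<And>\<zeta>. cmod (snd (\<Phi> p \<zeta>) - snd (\<Psi> p \<zeta>)) \<le> e"
  shows "damped (\<sigma> d) m (cmod d) (\<tau> * e) (\<lambda>w. source d \<gamma> \<Phi> p w - source d \<gamma> \<Psi> p w)"
proof -
  interpret tilted_sector "\<sigma> d" m "cmod d" by (rule tilted[OF d])
  let ?A = "positive_charges U Z d"
  let ?M = "\<lambda>\<gamma>'. \<bar>real_of_rat (f \<gamma> \<gamma>')\<bar> * exp (- L * cmod (Z \<gamma>' (p $ 1)))"
  let ?g = "\<lambda>\<Phi> \<gamma>' w. of_rat (f \<gamma> \<gamma>') * X \<gamma>' p (d * w) (\<Phi> p (Some (d * w)))"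
  note M = source_sums[OF d \<gamma> p]
  have e0: "e \<ge> 0" by (rule order_trans[OF norm_ge_zero e(1)])
  have D: "damped (\<sigma> d) m (cmod d) (\<tau> + \<tau>) (\<lambda>w. source d \<gamma> \<Phi> p w - source d \<gamma> \<Psi> p w)"
    by (rule damped_diff[OF source_damped[OF \<Phi> d \<gamma> p] source_damped[OF \<Psi> d \<gamma> p]])
  have bnd: "cmod (source d \<gamma> \<Phi> p w - source d \<gamma> \<Psi> p w) \<le> \<tau> * e * damping (cmod d * cmod w)"
    if w: "w \<in> sector (\<sigma> d) m - {0}" for w
  proof -
    have s: "(\<lambda>\<gamma>'. ?g \<Phi> \<gamma>' w) summable_on ?A" if "regular \<Phi>" for \<Phi>
      by (rule norm_infsum_majorant(1)[OF summable_on_cmult_left[OF M(1)] source_term_bound[OF that d _ p w]])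
    have eq: "source d \<gamma> \<Phi> p w - source d \<gamma> \<Psi> p w = (\<Sum>\<^sub>\<infinity>\<gamma>'\<in>?A. ?g \<Phi> \<gamma>' w + - ?g \<Psi> \<gamma>' w)"
      unfolding source_def
      by (simp only: infsum_add[OF s[OF \<Phi>] summable_on_uminus[THEN iffD2, OF s[OF \<Psi>]]] infsum_uminus diff_conv_add_uminus)
    have "cmod (source d \<gamma> \<Phi> p w - source d \<gamma> \<Psi> p w)
        \<le> (\<Sum>\<^sub>\<infinity>\<gamma>'\<in>?A. ?M \<gamma>' * (damping (cmod d * cmod w) * e))"
      unfolding eq
    proof (rule norm_infsum_majorant(2)[OF summable_on_cmult_left[OF M(1)]])
      fix \<gamma>' assume \<gamma>': "\<gamma>' \<in> ?A"
      show "cmod (?g \<Phi> \<gamma>' w + - ?g \<Psi> \<gamma>' w) \<le> ?M \<gamma>' * (damping (cmod d * cmod w) * e)"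
      proof (cases "f \<gamma> \<gamma>' = 0")
        case False
        have "cmod (X \<gamma>' p (d * w) (\<Phi> p (Some (d * w))) - X \<gamma>' p (d * w) (\<Psi> p (Some (d * w))))
           \<le> exp (- L * cmod (Z \<gamma>' (p $ 1))) * damping (cmod d * cmod w) * e"
          by (rule X_lipschitz[OF d \<gamma>' False p regular_Im[OF \<Phi> p] regular_Im[OF \<Psi> p] sectorD(1,2)[OF d w] e])
        from mult_left_mono[OF this, of "\<bar>real_of_rat (f \<gamma> \<gamma>')\<bar>"]
        have "cmod (of_rat (f \<gamma> \<gamma>') * (X \<gamma>' p (d * w) (\<Phi> p (Some (d * w))) - X \<gamma>' p (d * w) (\<Psi> p (Some (d * w)))))
          \<le> \<bar>real_of_rat (f \<gamma> \<gamma>')\<bar> * (exp (- L * cmod (Z \<gamma>' (p $ 1))) * damping (cmod d * cmod w) * e)"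
          by (simp add: norm_mult cmod_of_rat)
        moreover have "?g \<Phi> \<gamma>' w + - ?g \<Psi> \<gamma>' w
          = of_rat (f \<gamma> \<gamma>') * (X \<gamma>' p (d * w) (\<Phi> p (Some (d * w))) - X \<gamma>' p (d * w) (\<Psi> p (Some (d * w))))"
          by (simp add: right_diff_distrib)
        ultimately show ?thesis by (simp only: mult.assoc)
      qed simp
    qed
    also have "\<dots> = infsum ?M ?A * (damping (cmod d * cmod w) * e)" by (rule infsum_cmult_left')
    also have "\<dots> \<le> \<tau> * (damping (cmod d * cmod w) * e)"
      by (rule mult_right_mono[OF M(2)]) (simp add: less_imp_le damping_pos e0)
    finally show ?thesis unfolding mult.assoc by (simp only: mult.commute[of e])
  qed
  show ?thesis using D bnd unfolding damped_def by blast
qed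

lemma X_line_holo:
  assumes "line_holo params (\<lambda>p. fst (\<Phi> p))" "line_holo params (\<lambda>p. snd (\<Phi> p))"
  shows "line_holo params (\<lambda>p. X \<gamma> p \<zeta> (\<Phi> p))"
proof -
  have "line_holo params (\<lambda>p. Z \<gamma> (p $ 1))"
    by (rule line_holo_coord[OF U Z_holo]) (simp add: params_def)
  moreover have "line_holo params (\<lambda>p. (cnj \<circ> Z \<gamma> \<circ> cnj) (p $ 2))"
  proof (rule line_holo_coord)
    show op: "open (cnj ` U)"
      unfolding image_cnj_conv_vimage_cnj using U by (intro open_vimage) auto
    show "cnj \<circ> Z \<gamma> \<circ> cnj holomorphic_on cnj ` U"
      by (rule holomorphic_on_compose_cnj_cnj) (use Z_holo op in \<open>auto simp: image_image\<close>)
    show "p $ 2 \<in> cnj ` U" if "p \<in> params" for p :: "complex ^ 4"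
      using that by (auto simp: params_def intro!: image_eqI[of _ _ "cnj (p $ 2)"])
  qed
  ultimately have "line_holo params (\<lambda>p. exp (of_real (pi * R) / \<zeta> * Z \<gamma> (p $ 1)
     + \<i> * (of_int (fst \<gamma>) * fst (\<Phi> p) + of_int (snd \<gamma>) * snd (\<Phi> p))
     + of_real (pi * R) * \<zeta> * (cnj \<circ> Z \<gamma> \<circ> cnj) (p $ 2)))"
    by (intro line_holo_exp line_holo_add line_holo_mult line_holo_const assms)
  then show ?thesis by (simp add: X_def)
qed

text \<open>Locally in the parameters \<open>\<bar>Z\<^sub>\<gamma>\<bar>\<close> loses at most a factor \<open>2\<close>, uniformly in the charge, so that half of the exponent \<open>2 L\<close>
  provides a summable majorant which does not depend on the parameters.\<close>

lemma source_line_holo: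
  assumes \<Phi>: "regular \<Phi>" and d: "d \<in> {\<rho>, - \<rho>}" and \<gamma>: "\<gamma> \<in> {gamma1, gamma2}" and w: "w \<in> sector (\<sigma> d) m - {0}"
  shows "line_holo params (\<lambda>p. source d \<gamma> \<Phi> p w)"
  unfolding source_def
proof (rule line_holo_infsum[OF open_params])
  fix \<gamma>' show "line_holo params (\<lambda>p. of_rat (f \<gamma> \<gamma>') * X \<gamma>' p (d * w) (\<Phi> p (Some (d * w))))"
    by (intro line_holo_mult line_holo_const X_line_holo) (use regularD(2)[OF \<Phi>] in auto)
next
  fix p0 assume p0: "p0 \<in> params"
  define N where "N = {p \<in> params. cmod (Z gamma1 (p $ 1) - Z gamma1 (p0 $ 1)) < 1 / (2 * C)
    \<and> cmod (Z gamma2 (p $ 1) - Z gamma2 (p0 $ 1)) < 1 / (2 * C)}"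
  let ?M = "\<lambda>\<gamma>'. \<bar>real_of_rat (f \<gamma> \<gamma>')\<bar> * exp (- L * cmod (Z \<gamma>' (p0 $ 1)))"
  have "open N"
  proof -
    define g where "g \<gamma> p = cmod (Z \<gamma> (p $ 1) - Z \<gamma> (p0 $ 1))" for \<gamma> and p :: "complex ^ 4"
    have "continuous_on params (g \<gamma>)" for \<gamma>
      unfolding g_def
      by (intro continuous_intros continuous_on_compose2[OF holomorphic_on_imp_continuous_on[OF Z_holo]])
         (auto simp: params_def intro!: continuous_intros)
    then have 1: "open (g \<gamma> -` {..< 1 / (2 * C)} \<inter> params)" for \<gamma>
      using continuous_on_open_vimage[OF open_params] open_lessThan by blast
    have "N = (g gamma1 -` {..< 1 / (2 * C)} \<inter> params) \<inter> (g gamma2 -` {..< 1 / (2 * C)} \<inter> params)"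
      by (auto simp: N_def g_def)
    then show ?thesis using open_Int[OF 1 1] by simp
  qed
  moreover have "p0 \<in> N" using p0 C by (simp add: N_def)
  moreover have "N \<subseteq> params" by (auto simp: N_def)
  moreover have "cmod (of_rat (f \<gamma> \<gamma>') * X \<gamma>' q (d * w) (\<Phi> q (Some (d * w)))) \<le> ?M \<gamma>'"
    if \<gamma>': "\<gamma>' \<in> positive_charges U Z d" and q: "q \<in> N" for \<gamma>' q
  proof (cases "f \<gamma> \<gamma>' = 0")
    case False
    have qP: "q \<in> params" using q by (simp add: N_def)
    define n where "n = real_of_int \<bar>fst \<gamma>'\<bar> + real_of_int \<bar>snd \<gamma>'\<bar>"
    have n: "n \<le> C * cmod (Z \<gamma>' (p0 $ 1))"
      using active_size(2)[OF d _ \<gamma>' False] p0 by (auto simp: n_def params_def)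
    have "cmod (Z \<gamma>' (q $ 1) - Z \<gamma>' (p0 $ 1)) \<le> n * (1 / (2 * C))"
      unfolding n_def by (rule Z_diff_bound) (use q p0 in \<open>auto simp: N_def params_def\<close>)
    also have "\<dots> \<le> C * cmod (Z \<gamma>' (p0 $ 1)) * (1 / (2 * C))"
      by (rule mult_right_mono[OF n]) (use C in simp)
    also have "\<dots> = cmod (Z \<gamma>' (p0 $ 1)) / 2" using C by simp
    finally have "cmod (Z \<gamma>' (p0 $ 1)) / 2 \<le> cmod (Z \<gamma>' (q $ 1))"
      using norm_triangle_ineq2[of "Z \<gamma>' (p0 $ 1)" "Z \<gamma>' (q $ 1)"] by (simp add: norm_minus_commute)
    then have "L * cmod (Z \<gamma>' (p0 $ 1)) \<le> (2 * L) * cmod (Z \<gamma>' (q $ 1))"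
      using mult_left_mono[of "cmod (Z \<gamma>' (p0 $ 1)) / 2" "cmod (Z \<gamma>' (q $ 1))" "2 * L"] L C by simp
    then have 1: "exp (- (2 * L) * cmod (Z \<gamma>' (q $ 1))) \<le> exp (- L * cmod (Z \<gamma>' (p0 $ 1)))" by simp
    have d0: "d \<noteq> 0" using d \<rho> by auto
    have "cmod (X \<gamma>' q (d * w) (\<Phi> q (Some (d * w)))) \<le> exp (- (2 * L) * cmod (Z \<gamma>' (q $ 1))) * damping (cmod d * cmod w)"
      by (rule X_bound[OF d \<gamma>' False qP regular_Im[OF \<Phi> qP] sectorD(1,2)[OF d w]])
    also have "\<dots> \<le> exp (- L * cmod (Z \<gamma>' (p0 $ 1))) * 1"
      by (rule mult_mono[OF 1 damping_le(1)]) (use d0 w damping_pos[of "cmod d * cmod w"] in auto)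
    finally show ?thesis unfolding norm_mult cmod_of_rat by (intro mult_left_mono) auto
  qed simp
  ultimately show "\<exists>N M. open N \<and> p0 \<in> N \<and> N \<subseteq> params \<and> M summable_on positive_charges U Z d \<and>
     (\<forall>i\<in>positive_charges U Z d. \<forall>q\<in>N. norm (of_rat (f \<gamma> i) * X i q (d * w) (\<Phi> q (Some (d * w)))) \<le> M i)"
    using source_sums(1)[OF d \<gamma> p0] by (intro exI[of _ N] exI[of _ ?M] conjI) auto
qed

lemma ray_part_bound:
  assumes "regular \<Phi>" "d \<in> {\<rho>, - \<rho>}" "\<gamma> \<in> {gamma1, gamma2}" "p \<in> params"
  shows "cmod (ray_part d \<gamma> \<Phi> p \<zeta>) \<le> 1"
  unfolding ray_part_def
  using tilted_sector.sided_integral_bound[OF tilted[OF assms(2)] source_damped[OF assms]] \<tau>(2)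
  by (meson order_trans)

lemma ray_part_diff_bound:
  assumes \<Phi>: "regular \<Phi>" and \<Psi>: "regular \<Psi>" and d: "d \<in> {\<rho>, - \<rho>}" and \<gamma>: "\<gamma> \<in> {gamma1, gamma2}" and p: "p \<in> params"
    and e: "\<And>\<zeta>. cmod (fst (\<Phi> p \<zeta>) - fst (\<Psi> p \<zeta>)) \<le> e" "\<And>\<zeta>. cmod (snd (\<Phi> p \<zeta>) - snd (\<Psi> p \<zeta>)) \<le> e"
  shows "cmod (ray_part d \<gamma> \<Phi> p \<zeta> - ray_part d \<gamma> \<Psi> p \<zeta>) \<le> e"
proof -
  interpret tilted_sector "\<sigma> d" m "cmod d" by (rule tilted[OF d])
  have e0: "e \<ge> 0" by (rule order_trans[OF norm_ge_zero e(1)])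
  have "ray_part d \<gamma> \<Phi> p \<zeta> - ray_part d \<gamma> \<Psi> p \<zeta> = sided_integral True (\<sigma> d) m
     (\<lambda>w. source d \<gamma> \<Phi> p w - source d \<gamma> \<Psi> p w) (map_option (\<lambda>z. z / d) \<zeta>)"
    unfolding ray_part_def
    by (rule sided_integral_diff[symmetric, OF source_damped[OF \<Phi> d \<gamma> p] source_damped[OF \<Psi> d \<gamma> p]])
  also have "cmod \<dots> \<le> (20 / m + 4 * pi) * (\<tau> * e)"
    by (rule sided_integral_bound[OF source_diff_damped[OF \<Phi> \<Psi> d \<gamma> p e]])
  also have "\<dots> \<le> 1 * e" unfolding mult.assoc[symmetric] by (rule mult_right_mono[OF \<tau>(2) e0])
  finally show ?thesis by simp
qed

lemma ray_part_line_holo: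
  assumes \<Phi>: "regular \<Phi>" and d: "d \<in> {\<rho>, - \<rho>}" and \<gamma>: "\<gamma> \<in> {gamma1, gamma2}"
  shows "line_holo params (\<lambda>p. ray_part d \<gamma> \<Phi> p \<zeta>)"
  unfolding ray_part_def
  by (rule tilted_sector.sided_integral_line_holo[OF tilted[OF d] open_params
        source_damped[OF \<Phi> d \<gamma>] source_line_holo[OF \<Phi> d \<gamma>]])

lemma ray_part_holomorphic:
  assumes \<Phi>: "regular \<Phi>" and d: "d \<in> {\<rho>, - \<rho>}" and \<gamma>: "\<gamma> \<in> {gamma1, gamma2}" and p: "p \<in> params"
  shows "(\<lambda>z. ray_part d \<gamma> \<Phi> p (Some z)) holomorphic_on {z. z / d \<notin> closed_ray 1}"
proof -
  have d0: "d \<noteq> 0" using d \<rho> by auto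
  have "(\<lambda>w. sided_integral True (\<sigma> d) m (source d \<gamma> \<Phi> p) (Some w)) holomorphic_on - closed_ray 1"
    by (rule tilted_sector.sided_integral_holomorphic[OF tilted[OF d] source_damped[OF \<Phi> d \<gamma> p]])
  moreover have "(\<lambda>z. z / d) holomorphic_on {z. z / d \<notin> closed_ray 1}"
    using d0 by (intro holomorphic_intros) auto
  moreover have "(\<lambda>z. z / d) ` {z. z / d \<notin> closed_ray 1} \<subseteq> - closed_ray 1" by auto
  ultimately have "(\<lambda>w. sided_integral True (\<sigma> d) m (source d \<gamma> \<Phi> p) (Some w)) \<circ> (\<lambda>z. z / d)
      holomorphic_on {z. z / d \<notin> closed_ray 1}" using holomorphic_on_compose_gen by blast
  then show ?thesis by (simp add: o_def ray_part_def)
qed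

text \<open>The contribution of the opposite ray is holomorphic in a neighbourhood of the sector; that of the ray itself is
  continuous up to the ray by construction.\<close>

lemma ray_part_on_sectors:
  assumes \<Phi>: "regular \<Phi>" and d: "d \<in> {\<rho>, - \<rho>}" and d': "d' \<in> {\<rho>, - \<rho>}" and \<gamma>: "\<gamma> \<in> {gamma1, gamma2}" and p: "p \<in> params"
  shows "continuous_on (sector (\<sigma> d) m - {0}) (\<lambda>w. ray_part d' \<gamma> \<Phi> p (Some (d * w)))"
    and "(\<lambda>w. ray_part d' \<gamma> \<Phi> p (Some (d * w))) holomorphic_on open_sector (\<sigma> d) m"
proof -
  have d0: "d \<noteq> 0" "d' \<noteq> 0" using d d' \<rho> by auto
  interpret tilted_sector "\<sigma> d" m "cmod d" by (rule tilted[OF d])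
  have sub: "open_sector (\<sigma> d) m \<subseteq> sector (\<sigma> d) m - {0}" by (rule open_sector_subset)
  have comp: "(\<lambda>w. ray_part d' \<gamma> \<Phi> p (Some (d * w))) holomorphic_on S"
    if "\<And>w. w \<in> S \<Longrightarrow> d * w / d' \<notin> closed_ray 1" for S
  proof -
    have "(\<lambda>z. ray_part d' \<gamma> \<Phi> p (Some z)) \<circ> (\<lambda>w. d * w) holomorphic_on S"
      by (rule holomorphic_on_compose_gen[OF _ ray_part_holomorphic[OF \<Phi> d' \<gamma> p]])
         (use that in \<open>auto intro!: holomorphic_intros\<close>)
    then show ?thesis by (simp add: o_def)
  qed
  have "continuous_on (sector (\<sigma> d) m - {0}) (\<lambda>w. ray_part d' \<gamma> \<Phi> p (Some (d * w))) \<and>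
    (\<lambda>w. ray_part d' \<gamma> \<Phi> p (Some (d * w))) holomorphic_on open_sector (\<sigma> d) m"
  proof (cases "d' = d")
    case True
    have "continuous_on {w. 0 \<le> \<sigma> d * Im w} (\<lambda>w. sided_integral True (\<sigma> d) m (source d \<gamma> \<Phi> p) (Some w))"
      by (rule sided_integral_continuous[OF source_damped[OF \<Phi> d \<gamma> p]]) simp
    then have "continuous_on (sector (\<sigma> d) m - {0}) (\<lambda>w. sided_integral True (\<sigma> d) m (source d \<gamma> \<Phi> p) (Some w))"
      by (rule continuous_on_subset) (auto simp: sector_def)
    moreover have "(\<lambda>w. ray_part d' \<gamma> \<Phi> p (Some (d * w))) holomorphic_on open_sector (\<sigma> d) m"
    proof (rule comp)
      fix w assume "w \<in> open_sector (\<sigma> d) m"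
      then have "w \<notin> closed_ray 1" using closed_rays_in_sector(2)[of 1 w] by blast
      then show "d * w / d' \<notin> closed_ray 1" using d0 True by simp
    qed
    ultimately show ?thesis using True d0 by (simp add: ray_part_def)
  next
    case False
    then have "d' = - d" using d d' by auto
    have "(\<lambda>w. ray_part d' \<gamma> \<Phi> p (Some (d * w))) holomorphic_on {w. 0 < Re w}"
      by (rule comp) (use d0 \<open>d' = - d\<close> in \<open>auto simp: closed_ray_def\<close>)
    moreover have "sector (\<sigma> d) m - {0} \<subseteq> {w. 0 < Re w}" using sectorD(3)[OF d] by blast
    ultimately show ?thesis using sub
      by (meson holomorphic_on_imp_continuous_on holomorphic_on_subset order_trans)
  qed
  then show "continuous_on (sector (\<sigma> d) m - {0}) (\<lambda>w. ray_part d' \<gamma> \<Phi> p (Some (d * w)))"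
    "(\<lambda>w. ray_part d' \<gamma> \<Phi> p (Some (d * w))) holomorphic_on open_sector (\<sigma> d) m" by auto
qed

lemma rotated_step_comp:
  "fst (rotated_step \<Phi> p \<zeta>) = p $ 3 - 1 / (4 * of_real pi) * (ray_part \<rho> gamma1 \<Phi> p \<zeta> + ray_part (- \<rho>) gamma1 \<Phi> p \<zeta>)"
  "snd (rotated_step \<Phi> p \<zeta>) = p $ 4 - 1 / (4 * of_real pi) * (ray_part \<rho> gamma2 \<Phi> p \<zeta> + ray_part (- \<rho>) gamma2 \<Phi> p \<zeta>)"
  by (simp_all add: rotated_step_def)

lemma average_bound:
  assumes "cmod x \<le> e" "cmod y \<le> e"
  shows "cmod (1 / (4 * of_real pi) * (x + y)) \<le> e / 2"
proof -
  have e0: "e \<ge> 0" by (rule order_trans[OF norm_ge_zero assms(1)])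
  have "cmod (1 / (4 * of_real pi) * (x + y)) = 1 / (4 * pi) * cmod (x + y)"
    by (simp add: norm_mult norm_divide)
  also have "\<dots> \<le> 1 / (4 * pi) * (e + e)"
    by (intro mult_left_mono order_trans[OF norm_triangle_ineq] add_mono assms) simp
  also have "\<dots> \<le> 1 / 4 * (e + e)"
    using pi_gt3 e0 by (intro mult_right_mono) (auto simp: field_simps)
  finally show ?thesis by simp
qed

lemma rotated_step_near_angles:
  assumes "regular \<Phi>" "p \<in> params"
  shows "cmod (fst (rotated_step \<Phi> p \<zeta>) - p $ 3) \<le> 1 / 2" "cmod (snd (rotated_step \<Phi> p \<zeta>) - p $ 4) \<le> 1 / 2"
  using average_bound[OF ray_part_bound[OF assms(1) _ _ assms(2)] ray_part_bound[OF assms(1) _ _ assms(2)]]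
  by (simp_all add: rotated_step_comp del: mult_eq_0_iff)

text \<open>Each of the two rays contributes at most \<open>e / (4 \<pi>)\<close>.\<close>

lemma rotated_step_contraction:
  assumes \<Phi>: "regular \<Phi>" and \<Psi>: "regular \<Psi>" and p: "p \<in> params"
    and e: "\<And>\<zeta>. cmod (fst (\<Phi> p \<zeta>) - fst (\<Psi> p \<zeta>)) \<le> e" "\<And>\<zeta>. cmod (snd (\<Phi> p \<zeta>) - snd (\<Psi> p \<zeta>)) \<le> e"
  shows "cmod (fst (rotated_step \<Phi> p \<zeta>) - fst (rotated_step \<Psi> p \<zeta>)) \<le> e / 2"
    and "cmod (snd (rotated_step \<Phi> p \<zeta>) - snd (rotated_step \<Psi> p \<zeta>)) \<le> e / 2"
proof -
  note b = ray_part_diff_bound[OF \<Phi> \<Psi> _ _ p e]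
  have *: "(x - k * (u + v)) - (x - k * (u' + v')) = - (k * ((u - u') + (v - v')))" for x k u v u' v' :: complex
    by (simp add: algebra_simps)
  show "cmod (fst (rotated_step \<Phi> p \<zeta>) - fst (rotated_step \<Psi> p \<zeta>)) \<le> e / 2"
    unfolding rotated_step_comp * norm_minus_cancel by (rule average_bound[OF b b]) auto
  show "cmod (snd (rotated_step \<Phi> p \<zeta>) - snd (rotated_step \<Psi> p \<zeta>)) \<le> e / 2"
    unfolding rotated_step_comp * norm_minus_cancel by (rule average_bound[OF b b]) auto
qed

lemma coord_line_holo: "line_holo params (\<lambda>p. p $ i)"
  using line_holo_coord[of UNIV "\<lambda>z. z" params i] by (auto intro: holomorphic_intros)

lemma rotated_step_component:
  assumes "\<pi> \<in> {fst, snd}"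
  obtains i :: 4 and \<gamma> where "i = 3 \<or> i = 4" "\<gamma> \<in> {gamma1, gamma2}"
    "\<And>\<Phi> p \<zeta>. \<pi> (rotated_step \<Phi> p \<zeta>) =
       p $ i - 1 / (4 * of_real pi) * (ray_part \<rho> \<gamma> \<Phi> p \<zeta> + ray_part (- \<rho>) \<gamma> \<Phi> p \<zeta>)"
  using assms that[of 3 gamma1] that[of 4 gamma2] by (auto simp: rotated_step_def)

lemma regular_rotated_step:
  assumes \<Phi>: "regular \<Phi>"
  shows "regular (rotated_step \<Phi>)"
  unfolding regular_def
proof (rule ballI)
  fix \<pi> :: "complex \<times> complex \<Rightarrow> complex" assume "\<pi> \<in> {fst, snd}"
  then obtain i \<gamma> where i: "i = 3 \<or> i = 4" and \<gamma>: "\<gamma> \<in> {gamma1, gamma2}" and eq: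
    "\<And>\<Phi> p \<zeta>. \<pi> (rotated_step \<Phi> p \<zeta>) =
       p $ i - 1 / (4 * of_real pi) * (ray_part \<rho> \<gamma> \<Phi> p \<zeta> + ray_part (- \<rho>) \<gamma> \<Phi> p \<zeta>)"
    by (rule rotated_step_component) (rule that)
  show "(\<forall>p\<in>params. \<forall>\<zeta>. \<bar>Im (\<pi> (rotated_step \<Phi> p \<zeta>))\<bar> \<le> 2) \<and>
     (\<forall>\<zeta>. line_holo params (\<lambda>p. \<pi> (rotated_step \<Phi> p \<zeta>))) \<and>
     (\<forall>p\<in>params. \<forall>d\<in>{\<rho>, - \<rho>}.
        continuous_on (sector (\<sigma> d) m - {0}) (\<lambda>w. \<pi> (rotated_step \<Phi> p (Some (d * w)))) \<and>
        (\<lambda>w. \<pi> (rotated_step \<Phi> p (Some (d * w)))) holomorphic_on open_sector (\<sigma> d) m)"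
    unfolding eq
  proof (intro conjI ballI allI)
    fix p :: "complex ^ 4" and \<zeta> assume p: "p \<in> params"
    let ?q = "1 / (4 * of_real pi) * (ray_part \<rho> \<gamma> \<Phi> p \<zeta> + ray_part (- \<rho>) \<gamma> \<Phi> p \<zeta>)"
    have "cmod ?q \<le> 1 / 2"
      by (rule average_bound[OF ray_part_bound[OF \<Phi> _ \<gamma> p] ray_part_bound[OF \<Phi> _ \<gamma> p]]) auto
    moreover have "\<bar>Im (p $ i)\<bar> < 1" using p i by (auto simp: params_def)
    ultimately show "\<bar>Im (p $ i - ?q)\<bar> \<le> 2"
      using abs_Im_le_cmod[of ?q] unfolding minus_complex.sel by linarith
  next
    fix \<zeta>
    show "line_holo params (\<lambda>p. p $ i - 1 / (4 * of_real pi) * (ray_part \<rho> \<gamma> \<Phi> p \<zeta> + ray_part (- \<rho>) \<gamma> \<Phi> p \<zeta>))"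
      by (intro line_holo_diff line_holo_mult line_holo_add line_holo_const coord_line_holo
            ray_part_line_holo[OF \<Phi> _ \<gamma>]) auto
  next
    fix p :: "complex ^ 4" and d assume p: "p \<in> params" and d: "d \<in> {\<rho>, - \<rho>}"
    show "continuous_on (sector (\<sigma> d) m - {0}) (\<lambda>w. p $ i - 1 / (4 * of_real pi) *
        (ray_part \<rho> \<gamma> \<Phi> p (Some (d * w)) + ray_part (- \<rho>) \<gamma> \<Phi> p (Some (d * w))))"
      by (intro continuous_on_diff continuous_on_mult continuous_on_add continuous_on_const
            ray_part_on_sectors(1)[OF \<Phi> d _ \<gamma> p]) auto
    show "(\<lambda>w. p $ i - 1 / (4 * of_real pi) *
        (ray_part \<rho> \<gamma> \<Phi> p (Some (d * w)) + ray_part (- \<rho>) \<gamma> \<Phi> p (Some (d * w)))) holomorphic_on open_sector (\<sigma> d) m"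
      by (intro holomorphic_on_diff holomorphic_on_mult holomorphic_on_add holomorphic_on_const
            ray_part_on_sectors(2)[OF \<Phi> d _ \<gamma> p]) auto
  qed
qed

end

section \<open>The limit of the iteration\<close>

lemma geometric_limit:
  fixes g :: "nat \<Rightarrow> complex"
  assumes step: "\<And>n. cmod (g (Suc n) - g n) \<le> (1 / 2) ^ Suc n"
  shows "g \<longlonglongrightarrow> lim g" "cmod (g n - lim g) \<le> (1 / 2) ^ n"
proof -
  have dist: "cmod (g (n + k) - g n) \<le> (1 / 2) ^ n - (1 / 2) ^ (n + k)" for n k
  proof (induction k)
    case (Suc k)
    have "cmod (g (n + Suc k) - g n) \<le> cmod (g (Suc (n + k)) - g (n + k)) + cmod (g (n + k) - g n)"
      using norm_triangle_ineq[of "g (Suc (n + k)) - g (n + k)" "g (n + k) - g n"] by simp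
    also have "\<dots> \<le> (1 / 2) ^ Suc (n + k) + ((1 / 2) ^ n - (1 / 2) ^ (n + k))"
      by (intro add_mono step Suc.IH)
    finally show ?case by simp
  qed simp
  have close: "cmod (g (n + k) - g n) \<le> (1 / 2) ^ n" for n k
    using dist[of n k] zero_le_power[of "1 / 2 :: real" "n + k"] by linarith
  have "Cauchy g"
  proof (rule CauchyI)
    fix e :: real assume "0 < e"
    then obtain N where N: "(1 / 2 :: real) ^ N < e / 2" using real_arch_pow_inv[of "e / 2" "1 / 2"] by auto
    show "\<exists>M. \<forall>i\<ge>M. \<forall>j\<ge>M. norm (g i - g j) < e"
    proof (intro exI[of _ N] allI impI)
      fix i j assume "N \<le> i" "N \<le> j"
      then have "cmod (g i - g N) \<le> (1 / 2) ^ N" "cmod (g j - g N) \<le> (1 / 2) ^ N"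
        using close[of N "i - N"] close[of N "j - N"] by simp_all
      then show "norm (g i - g j) < e"
        using norm_triangle_ineq4[of "g i - g N" "g j - g N"] N by simp
    qed
  qed
  then show lim: "g \<longlonglongrightarrow> lim g" using Cauchy_convergent convergent_LIMSEQ_iff by blast
  have "(\<lambda>k. g n - g (n + k)) \<longlonglongrightarrow> g n - lim g"
    using LIMSEQ_ignore_initial_segment[OF lim, of n] by (intro tendsto_intros) (simp add: add.commute)
  then show "cmod (g n - lim g) \<le> (1 / 2) ^ n"
    by (rule Lim_bounded[OF tendsto_norm, of _ _ 0]) (use close in \<open>simp add: norm_minus_commute\<close>)
qed

lemma le_of_geometric:
  fixes x :: real
  assumes "\<And>n. x \<le> y + c * (1 / 2) ^ n" shows "x \<le> y"
proof -
  have "(\<lambda>n. y + c * (1 / 2) ^ n) \<longlonglongrightarrow> y + c * 0"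
    by (intro tendsto_intros LIMSEQ_power_zero) simp
  then show ?thesis using LIMSEQ_le_const[of "\<lambda>n. y + c * (1 / 2) ^ n" y x] assms by simp
qed

context rotated_iteration begin

definition angle_field :: "complex ^ 4 \<Rightarrow> complex option \<Rightarrow> complex \<times> complex" where
  "angle_field p \<zeta> = (p $ 3, p $ 4)"

definition approx :: "nat \<Rightarrow> complex ^ 4 \<Rightarrow> complex option \<Rightarrow> complex \<times> complex" where
  "approx n = (rotated_step ^^ n) angle_field"

definition limit :: "complex ^ 4 \<Rightarrow> complex option \<Rightarrow> complex \<times> complex" where
  "limit p \<zeta> = (lim (\<lambda>n. fst (approx n p \<zeta>)), lim (\<lambda>n. snd (approx n p \<zeta>)))"

lemma approx_simps [simp]: "approx 0 = angle_field" "approx (Suc n) = rotated_step (approx n)"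
  by (simp_all add: approx_def)

lemma regular_angle_field: "regular angle_field"
proof -
  have "\<bar>Im (p $ 3)\<bar> \<le> 2" "\<bar>Im (p $ 4)\<bar> \<le> 2" if "p \<in> params" for p :: "complex ^ 4"
    using that by (auto simp: params_def)
  then show ?thesis by (auto simp: regular_def angle_field_def coord_line_holo)
qed

lemma regular_approx: "regular (approx n)"
  by (induction n) (simp_all add: regular_angle_field regular_rotated_step)

lemma approx_step:
  assumes "p \<in> params"
  shows "cmod (fst (approx (Suc n) p \<zeta>) - fst (approx n p \<zeta>)) \<le> (1 / 2) ^ Suc n \<and>
    cmod (snd (approx (Suc n) p \<zeta>) - snd (approx n p \<zeta>)) \<le> (1 / 2) ^ Suc n"
proof (induction n arbitrary: \<zeta>)
  case 0
  then show ?case using rotated_step_near_angles[OF regular_angle_field assms] by (simp add: angle_field_def)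
next
  case (Suc n)
  show ?case
    using rotated_step_contraction[OF regular_approx[of "Suc n"] regular_approx[of n] assms, of "(1 / 2) ^ Suc n" \<zeta>] Suc
    by simp
qed

lemma approx_limit:
  assumes "p \<in> params" "\<pi> \<in> {fst, snd}"
  shows "cmod (\<pi> (approx n p \<zeta>) - \<pi> (limit p \<zeta>)) \<le> (1 / 2) ^ n"
    and "(\<lambda>n. \<pi> (approx n p \<zeta>)) \<longlonglongrightarrow> \<pi> (limit p \<zeta>)"
  using approx_step[OF assms(1)] assms(2)
    geometric_limit[of "\<lambda>n. fst (approx n p \<zeta>)"] geometric_limit[of "\<lambda>n. snd (approx n p \<zeta>)"]
  by (auto simp: limit_def simp del: approx_simps)

lemma approx_uniform_limit:
  assumes \<pi>: "\<pi> \<in> {fst, snd}" and "\<And>x. x \<in> S \<Longrightarrow> q x \<in> params"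
  shows "uniform_limit S (\<lambda>n x. \<pi> (approx n (q x) (z x))) (\<lambda>x. \<pi> (limit (q x) (z x))) sequentially"
proof (rule uniform_limitI)
  fix e :: real assume "0 < e"
  moreover have "(\<lambda>n. (1 / 2 :: real) ^ n) \<longlonglongrightarrow> 0" by (rule LIMSEQ_power_zero) simp
  ultimately have "\<forall>\<^sub>F n in sequentially. (1 / 2 :: real) ^ n < e" by (intro order_tendstoD)
  then show "\<forall>\<^sub>F n in sequentially. \<forall>x\<in>S. dist (\<pi> (approx n (q x) (z x))) (\<pi> (limit (q x) (z x))) < e"
  proof eventually_elim
    case (elim n)
    then show ?case using approx_limit(1)[OF assms(2) \<pi>] by (auto simp: dist_norm intro: le_less_trans)
  qed
qed

lemma regular_limit: "regular limit"
  unfolding regular_def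
proof (rule ballI)
  fix \<pi> :: "complex \<times> complex \<Rightarrow> complex" assume \<pi>: "\<pi> \<in> {fst, snd}"
  show "(\<forall>p\<in>params. \<forall>\<zeta>. \<bar>Im (\<pi> (limit p \<zeta>))\<bar> \<le> 2) \<and>
     (\<forall>\<zeta>. line_holo params (\<lambda>p. \<pi> (limit p \<zeta>))) \<and>
     (\<forall>p\<in>params. \<forall>d\<in>{\<rho>, - \<rho>}.
        continuous_on (sector (\<sigma> d) m - {0}) (\<lambda>w. \<pi> (limit p (Some (d * w)))) \<and>
        (\<lambda>w. \<pi> (limit p (Some (d * w)))) holomorphic_on open_sector (\<sigma> d) m)"
  proof (intro conjI ballI allI)
    fix p \<zeta> assume p: "p \<in> params"
    show "\<bar>Im (\<pi> (limit p \<zeta>))\<bar> \<le> 2"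
    proof (rule le_of_geometric)
      fix n
      have "\<bar>Im (\<pi> (approx n p \<zeta>) - \<pi> (limit p \<zeta>))\<bar> \<le> (1 / 2) ^ n"
        using abs_Im_le_cmod approx_limit(1)[OF p \<pi>] by (rule order_trans)
      then show "\<bar>Im (\<pi> (limit p \<zeta>))\<bar> \<le> 2 + 1 * (1 / 2) ^ n"
        using regularD(1)[OF regular_approx[of n] \<pi> p, of \<zeta>] by simp
    qed
  next
    fix \<zeta>
    show "line_holo params (\<lambda>p. \<pi> (limit p \<zeta>))"
    proof (rule line_holo_uniform_limit[OF open_params, of sequentially "\<lambda>n p. \<pi> (approx n p \<zeta>)"])
      fix p assume "p \<in> params"
      then show "\<exists>N. open N \<and> p \<in> N \<and> (\<forall>\<^sub>F n in sequentially. line_holo N (\<lambda>p. \<pi> (approx n p \<zeta>))) \<and>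
          uniform_limit N (\<lambda>n p. \<pi> (approx n p \<zeta>)) (\<lambda>p. \<pi> (limit p \<zeta>)) sequentially"
        using open_params regularD(2)[OF regular_approx \<pi>] approx_uniform_limit[OF \<pi>, of params "\<lambda>p. p" "\<lambda>_. \<zeta>"]
        by (intro exI[of _ params] conjI always_eventually allI) auto
    qed simp
  next
    fix p d assume p: "p \<in> params" and d: "d \<in> {\<rho>, - \<rho>}"
    have ul: "uniform_limit S (\<lambda>n w. \<pi> (approx n p (Some (d * w)))) (\<lambda>w. \<pi> (limit p (Some (d * w)))) sequentially" for S
      by (rule approx_uniform_limit[OF \<pi>]) (rule p)
    show "continuous_on (sector (\<sigma> d) m - {0}) (\<lambda>w. \<pi> (limit p (Some (d * w))))"
      by (rule uniform_limit_theorem[OF always_eventually ul]) (use regularD(3)[OF regular_approx \<pi> p d] in auto)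
    show "(\<lambda>w. \<pi> (limit p (Some (d * w)))) holomorphic_on open_sector (\<sigma> d) m"
    proof (rule holomorphic_uniform_sequence[OF open_open_sector])
      show "(\<lambda>w. \<pi> (approx n p (Some (d * w)))) holomorphic_on open_sector (\<sigma> d) m" for n
        by (rule regularD(4)[OF regular_approx \<pi> p d])
      fix x assume "x \<in> open_sector (\<sigma> d) m"
      then obtain r where "r > 0" "cball x r \<subseteq> open_sector (\<sigma> d) m"
        using open_open_sector open_contains_cball by metis
      then show "\<exists>r>0. cball x r \<subseteq> open_sector (\<sigma> d) m \<and>
          uniform_limit (cball x r) (\<lambda>n w. \<pi> (approx n p (Some (d * w)))) (\<lambda>w. \<pi> (limit p (Some (d * w)))) sequentially"
        using ul by blast
    qed
  qed
qed

text \<open>The limit and its image under the step are both limits of the iterates.\<close>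

lemma limit_fixed:
  assumes p: "p \<in> params"
  shows "rotated_step limit p \<zeta> = limit p \<zeta>"
proof -
  have contr: "cmod (\<pi> (rotated_step (approx n) p \<zeta>) - \<pi> (rotated_step limit p \<zeta>)) \<le> (1 / 2) ^ n / 2"
    if "\<pi> \<in> {fst, snd}" for \<pi> n
    using rotated_step_contraction[OF regular_approx regular_limit p, of n "(1 / 2) ^ n"]
      approx_limit(1)[OF p, of fst n] approx_limit(1)[OF p, of snd n] that by auto
  have "\<pi> (rotated_step limit p \<zeta>) = \<pi> (limit p \<zeta>)" if \<pi>: "\<pi> \<in> {fst, snd}" for \<pi>
  proof -
    have "cmod (\<pi> (rotated_step limit p \<zeta>) - \<pi> (limit p \<zeta>)) \<le> 0"
    proof (rule le_of_geometric)
      fix n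
      have 1: "cmod (\<pi> (rotated_step (approx n) p \<zeta>) - \<pi> (limit p \<zeta>)) \<le> (1 / 2) ^ n / 2"
        using approx_limit(1)[OF p \<pi>, of "Suc n" \<zeta>] by simp
      show "cmod (\<pi> (rotated_step limit p \<zeta>) - \<pi> (limit p \<zeta>)) \<le> 0 + 1 * (1 / 2) ^ n"
        using norm_triangle_ineq4[of "\<pi> (rotated_step (approx n) p \<zeta>) - \<pi> (limit p \<zeta>)"
            "\<pi> (rotated_step (approx n) p \<zeta>) - \<pi> (rotated_step limit p \<zeta>)"] 1 contr[OF \<pi>, of n] by simp
    qed
    then show ?thesis by simp
  qed
  from this[of fst] this[of snd] show ?thesis by (simp add: prod_eq_iff)
qed

definition shifted :: "int \<Rightarrow> int \<Rightarrow> complex ^ 4 \<Rightarrow> complex ^ 4 \<Rightarrow> bool" where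
  "shifted k l p p' \<longleftrightarrow> p' $ 1 = p $ 1 \<and> p' $ 2 = p $ 2 \<and>
     p' $ 3 = p $ 3 + of_real (2 * pi * k) \<and> p' $ 4 = p $ 4 + of_real (2 * pi * l)"

lemma X_shifted:
  assumes "shifted k l p p'"
  shows "X \<gamma> p' \<zeta> (\<Phi> + (of_real (2 * pi * k), of_real (2 * pi * l))) = X \<gamma> p \<zeta> \<Phi>"
proof -
  have "\<i> * (of_int (fst \<gamma>) * fst (\<Phi> + (of_real (2 * pi * k), of_real (2 * pi * l)))
      + of_int (snd \<gamma>) * snd (\<Phi> + (of_real (2 * pi * k), of_real (2 * pi * l))))
    = \<i> * (of_int (fst \<gamma>) * fst \<Phi> + of_int (snd \<gamma>) * snd \<Phi>)
      + \<i> * (of_int (fst \<gamma> * k + snd \<gamma> * l) * (of_real pi * 2))"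
    by (simp add: algebra_simps)
  then have *: "X \<gamma> p' \<zeta> (\<Phi> + (of_real (2 * pi * k), of_real (2 * pi * l)))
    = exp ((of_real (pi * R) * Z \<gamma> (p $ 1) / \<zeta>
     + \<i> * (of_int (fst \<gamma>) * fst \<Phi> + of_int (snd \<gamma>) * snd \<Phi>)
     + of_real (pi * R) * \<zeta> * cnj (Z \<gamma> (cnj (p $ 2)))) + \<i> * (of_int (fst \<gamma> * k + snd \<gamma> * l) * (of_real pi * 2)))"
    unfolding X_def using assms by (simp only: shifted_def add_ac)
  show ?thesis unfolding * exp_plus_2pin by (simp add: X_def)
qed

lemma approx_shifted:
  assumes "shifted k l p p'"
  shows "approx n p' \<zeta> = approx n p \<zeta> + (of_real (2 * pi * k), of_real (2 * pi * l))"
proof (induction n arbitrary: \<zeta>)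
  case 0
  then show ?case using assms by (simp add: angle_field_def shifted_def)
next
  case (Suc n)
  have "source d \<gamma> (approx n) p' = source d \<gamma> (approx n) p" for d \<gamma>
    unfolding source_def Suc X_shifted[OF assms] ..
  then have "ray_part d \<gamma> (approx n) p' \<zeta> = ray_part d \<gamma> (approx n) p \<zeta>" for d \<gamma>
    by (simp add: ray_part_def)
  then show ?case using assms by (simp add: rotated_step_def shifted_def)
qed

lemma limit_shifted:
  assumes "shifted k l p p'" "p \<in> params" "p' \<in> params"
  shows "limit p' \<zeta> = limit p \<zeta> + (of_real (2 * pi * k), of_real (2 * pi * l))"
proof -
  have "\<pi> (limit p' \<zeta>) = \<pi> (limit p \<zeta>) + \<pi> (of_real (2 * pi * k), of_real (2 * pi * l))"
    if \<pi>: "\<pi> \<in> {fst, snd}" for \<pi>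
  proof -
    have "(\<lambda>n. \<pi> (approx n p' \<zeta>)) \<longlonglongrightarrow> \<pi> (limit p' \<zeta>)" by (rule approx_limit(2)[OF assms(3) \<pi>])
    moreover have "(\<lambda>n. \<pi> (approx n p' \<zeta>)) \<longlonglongrightarrow> \<pi> (limit p \<zeta>) + \<pi> (of_real (2 * pi * k), of_real (2 * pi * l))"
      unfolding approx_shifted[OF assms(1)]
      using tendsto_add[OF approx_limit(2)[OF assms(2) \<pi>, of \<zeta>] tendsto_const[of "\<pi> (of_real (2 * pi * k), of_real (2 * pi * l))"]] \<pi>
      by auto
    ultimately show ?thesis by (rule LIMSEQ_unique)
  qed
  from this[of fst] this[of snd] show ?thesis by (simp add: prod_eq_iff)
qed

section \<open>Boundary values on the closed half-planes\<close>

text \<open>The half-plane on the side \<open>s\<close> of \<open>\<rho>\<close> is on the side \<open>- s\<close> of \<open>- \<rho>\<close>.\<close>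

definition side :: "real \<Rightarrow> complex \<Rightarrow> real" where "side s d = (if d = \<rho> then s else - s)"

text \<open>The continuous extension from the open half-plane on the side \<open>s\<close> has a residue on the ray \<open>d\<close> precisely if
  this half-plane is the one to which that ray belongs.\<close>

definition ext_part :: "real \<Rightarrow> complex \<Rightarrow> charge \<Rightarrow> (complex ^ 4 \<Rightarrow> complex option \<Rightarrow> complex \<times> complex) \<Rightarrow>
    complex ^ 4 \<Rightarrow> complex option \<Rightarrow> complex" where
  "ext_part s d \<gamma> \<Phi> p \<zeta> = sided_integral (side s d = \<sigma> d) (\<sigma> d) m (source d \<gamma> \<Phi> p) (map_option (\<lambda>z. z / d) \<zeta>)"

definition extension :: "real \<Rightarrow> (complex ^ 4 \<Rightarrow> complex option \<Rightarrow> complex \<times> complex) \<Rightarrow>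
    complex ^ 4 \<Rightarrow> complex option \<Rightarrow> complex \<times> complex" where
  "extension s \<Phi> p \<zeta> =
     (p $ 3 - 1 / (4 * of_real pi) * (ext_part s \<rho> gamma1 \<Phi> p \<zeta> + ext_part s (- \<rho>) gamma1 \<Phi> p \<zeta>),
      p $ 4 - 1 / (4 * of_real pi) * (ext_part s \<rho> gamma2 \<Phi> p \<zeta> + ext_part s (- \<rho>) gamma2 \<Phi> p \<zeta>))"

lemma rho_neq: "- \<rho> \<noteq> \<rho>" "d \<in> {\<rho>, - \<rho>} \<Longrightarrow> d \<noteq> 0" using \<rho> by (auto simp: eq_neg_iff_add_eq_0)

lemma side_Im: "d \<in> {\<rho>, - \<rho>} \<Longrightarrow> side s d * Im (z / d) = s * Im (z / \<rho>)"
  using rho_neq by (auto simp: side_def)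

lemma side_cases: "d \<in> {\<rho>, - \<rho>} \<Longrightarrow> s = 1 \<or> s = - 1 \<Longrightarrow> side s d \<noteq> \<sigma> d \<Longrightarrow> side s d = - \<sigma> d"
  using \<sigma>[of d] by (auto simp: side_def split: if_splits)

lemma ext_part_eq:
  assumes \<Phi>: "regular \<Phi>" and d: "d \<in> {\<rho>, - \<rho>}" and \<gamma>: "\<gamma> \<in> {gamma1, gamma2}" and p: "p \<in> params"
    and sg: "s = 1 \<or> s = - 1" and \<zeta>: "\<And>z. \<zeta> = Some z \<Longrightarrow> z = 0 \<or> 0 < s * Im (z / \<rho>)"
  shows "ext_part s d \<gamma> \<Phi> p \<zeta> = ray_part d \<gamma> \<Phi> p \<zeta>"
proof (cases "side s d = \<sigma> d")
  case True
  then show ?thesis by (simp add: ext_part_def ray_part_def)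
next
  case False
  interpret tilted_sector "\<sigma> d" m "cmod d" by (rule tilted[OF d])
  note D = source_damped[OF \<Phi> d \<gamma> p]
  let ?\<zeta> = "map_option (\<lambda>z. z / d) \<zeta>"
  have *: "w = 0 \<or> \<sigma> d * Im w < 0" if w: "?\<zeta> = Some w" for w
  proof -
    obtain z where z: "\<zeta> = Some z" "w = z / d" using w by auto
    have "\<sigma> d * Im w = - (s * Im (z / \<rho>))"
      using side_Im[OF d, of s z] side_cases[OF d sg False] z by simp
    then show ?thesis using \<zeta>[OF z(1)] z by auto
  qed
  have off: "off_ray 1 ?\<zeta>" unfolding off_ray_def using * by fastforce
  have "sided_integral False (\<sigma> d) m (source d \<gamma> \<Phi> p) ?\<zeta> = ray_integral 1 ?\<zeta> (source d \<gamma> \<Phi> p)"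
    by (rule sided_integral_other_side[OF D *])
  then show ?thesis
    using sided_integral_off_ray[OF D off] False by (simp add: ext_part_def ray_part_def)
qed

lemma ext_part_far:
  assumes "\<not> near_ray m (z / d)"
  shows "ext_part s d \<gamma> \<Phi> p (Some z) = ray_part d \<gamma> \<Phi> p (Some z)"
  using assms by (simp add: ext_part_def ray_part_def sided_integral_def)

lemma ext_part_continuous:
  assumes \<Phi>: "regular \<Phi>" and d: "d \<in> {\<rho>, - \<rho>}" and \<gamma>: "\<gamma> \<in> {gamma1, gamma2}" and p: "p \<in> params"
    and sg: "s = 1 \<or> s = - 1"
  shows "continuous_on {z. 0 \<le> s * Im (z / \<rho>)} (\<lambda>z. ext_part s d \<gamma> \<Phi> p (Some z))"
    and "((\<lambda>z. ext_part s d \<gamma> \<Phi> p (Some z)) \<longlongrightarrow> ext_part s d \<gamma> \<Phi> p None)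
      (inf at_infinity (principal {z. 0 \<le> s * Im (z / \<rho>)}))"
proof -
  interpret tilted_sector "\<sigma> d" m "cmod d" by (rule tilted[OF d])
  note D = source_damped[OF \<Phi> d \<gamma> p]
  note d0 = rho_neq(2)[OF d]
  let ?b = "side s d = \<sigma> d"
  let ?C = "if ?b then {w. 0 \<le> \<sigma> d * Im w} else {w. \<sigma> d * Im w \<le> 0}"
  have C: "z / d \<in> ?C" if "0 \<le> s * Im (z / \<rho>)" for z
  proof (cases ?b)
    case True
    then show ?thesis using side_Im[OF d, of s z] that by simp
  next
    case False
    then show ?thesis using side_Im[OF d, of s z] side_cases[OF d sg False] that by simp
  qed
  have "continuous_on {z. 0 \<le> s * Im (z / \<rho>)} (\<lambda>z. sided_integral ?b (\<sigma> d) m (source d \<gamma> \<Phi> p) (Some (z / d)))"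
    by (rule continuous_on_compose2[OF sided_integral_continuous[OF D refl, of ?b]])
       (use C d0 in \<open>auto intro!: continuous_intros\<close>)
  then show "continuous_on {z. 0 \<le> s * Im (z / \<rho>)} (\<lambda>z. ext_part s d \<gamma> \<Phi> p (Some z))"
    by (simp add: ext_part_def)
  have "filterlim (\<lambda>z. z / d) at_infinity (at_infinity :: complex filter)"
    unfolding filterlim_at_infinity[OF order_refl]
  proof (intro allI impI)
    fix r :: real assume "r > 0"
    show "\<forall>\<^sub>F z in at_infinity. r \<le> norm (z / d)"
      unfolding eventually_at_infinity
      by (rule exI[of _ "r * cmod d"]) (use d0 in \<open>auto simp: norm_divide le_divide_eq\<close>)
  qed
  moreover have "\<forall>\<^sub>F z in inf at_infinity (principal {z. 0 \<le> s * Im (z / \<rho>)}). z / d \<in> ?C"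
    unfolding eventually_inf_principal using C by (intro always_eventually) auto
  ultimately have "filterlim (\<lambda>z. z / d) (inf at_infinity (principal ?C)) (inf at_infinity (principal {z. 0 \<le> s * Im (z / \<rho>)}))"
    unfolding filterlim_inf filterlim_principal by (auto intro: filterlim_mono)
  from filterlim_compose[OF sided_integral_at_infinity[OF D refl, of ?b] this]
  show "((\<lambda>z. ext_part s d \<gamma> \<Phi> p (Some z)) \<longlongrightarrow> ext_part s d \<gamma> \<Phi> p None)
      (inf at_infinity (principal {z. 0 \<le> s * Im (z / \<rho>)}))"
    by (simp add: ext_part_def)
qed

lemma extension_eq:
  assumes \<Phi>: "regular \<Phi>" and p: "p \<in> params"
    and sg: "s = 1 \<or> s = - 1" and \<zeta>: "\<And>z. \<zeta> = Some z \<Longrightarrow> z = 0 \<or> 0 < s * Im (z / \<rho>)"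
  shows "extension s \<Phi> p \<zeta> = rotated_step \<Phi> p \<zeta>"
  unfolding extension_def rotated_step_def using ext_part_eq[OF \<Phi> _ _ p sg \<zeta>] by auto

lemma extension_continuous:
  assumes \<Phi>: "regular \<Phi>" and p: "p \<in> params" and sg: "s = 1 \<or> s = - 1"
  shows "continuous_on {z. 0 \<le> s * Im (z / \<rho>)} (\<lambda>z. extension s \<Phi> p (Some z))"
    and "((\<lambda>z. extension s \<Phi> p (Some z)) \<longlongrightarrow> extension s \<Phi> p None)
      (inf at_infinity (principal {z. 0 \<le> s * Im (z / \<rho>)}))"
  unfolding extension_def
  by (intro continuous_intros ext_part_continuous(1)[OF \<Phi> _ _ p sg]; simp)
     (intro tendsto_intros ext_part_continuous(2)[OF \<Phi> _ _ p sg]; simp)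

lemma extension_on_ray:
  assumes d: "d \<in> {\<rho>, - \<rho>}" and side: "side s d = \<sigma> d" and z: "z \<in> ray d"
  shows "extension s \<Phi> p (Some z) = rotated_step \<Phi> p (Some z)"
proof -
  obtain t where t: "t > 0" "z = of_real t * d" using z by (auto simp: ray_def)
  note d0 = rho_neq(2)[OF d]
  have "ext_part s d' \<gamma> \<Phi> p (Some z) = ray_part d' \<gamma> \<Phi> p (Some z)" if d': "d' \<in> {\<rho>, - \<rho>}" for d' \<gamma>
  proof (cases "d' = d")
    case True
    then show ?thesis using side by (simp add: ext_part_def ray_part_def)
  next
    case False
    then have "z / d' = - of_real t" using d d' d0 t(2) by auto
    then have "\<not> near_ray m (z / d')" using t(1) m by (simp add: near_ray_def mult_less_0_iff not_le)
    then show ?thesis by (rule ext_part_far)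
  qed
  then show ?thesis by (simp add: extension_def rotated_step_def)
qed

lemma rotated_step_holomorphic:
  assumes \<Phi>: "regular \<Phi>" and p: "p \<in> params" and sg: "s = 1 \<or> s = - 1" and \<pi>: "\<pi> \<in> {fst, snd}"
  shows "(\<lambda>z. \<pi> (rotated_step \<Phi> p (Some z))) holomorphic_on {z. 0 < s * Im (z / \<rho>)}"
proof -
  obtain i \<gamma> where \<gamma>: "\<gamma> \<in> {gamma1, gamma2}" and eq:
    "\<And>\<Phi> p \<zeta>. \<pi> (rotated_step \<Phi> p \<zeta>) =
       p $ i - 1 / (4 * of_real pi) * (ray_part \<rho> \<gamma> \<Phi> p \<zeta> + ray_part (- \<rho>) \<gamma> \<Phi> p \<zeta>)"
    using \<pi> by (rule rotated_step_component) (rule that)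
  have "(\<lambda>z. ray_part d \<gamma> \<Phi> p (Some z)) holomorphic_on {z. 0 < s * Im (z / \<rho>)}" if d: "d \<in> {\<rho>, - \<rho>}" for d
  proof (rule holomorphic_on_subset[OF ray_part_holomorphic[OF \<Phi> d \<gamma> p]])
    show "{z. 0 < s * Im (z / \<rho>)} \<subseteq> {z. z / d \<notin> closed_ray 1}"
    proof
      fix z assume "z \<in> {z. 0 < s * Im (z / \<rho>)}"
      then have "0 < side s d * Im (z / d)" using side_Im[OF d, of s z] by simp
      then have "Im (z / d) \<noteq> 0" by auto
      then show "z \<in> {z. z / d \<notin> closed_ray 1}" by (simp add: closed_ray_def)
    qed
  qed
  then show ?thesis unfolding eq
    by (intro holomorphic_on_diff holomorphic_on_mult holomorphic_on_add holomorphic_on_const) auto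
qed

section \<open>Real parameters\<close>

definition real_point :: "complex \<times> real \<times> real \<Rightarrow> complex ^ 4" where
  "real_point x = vector [fst x, cnj (fst x), of_real (fst (snd x)), of_real (snd (snd x))]"

lemma real_point_nth [simp]: "real_point x $ 1 = fst x" "real_point x $ 2 = cnj (fst x)"
  "real_point x $ 3 = of_real (fst (snd x))" "real_point x $ 4 = of_real (snd (snd x))"
  by (simp_all add: real_point_def vector_def)

lemma bounded_linear_real_point: "bounded_linear real_point"
proof -
  have "linear real_point"
  proof (rule linearI)
    show "real_point (x + y) = real_point x + real_point y" for x y by (simp add: vec_eq_iff forall_4)
    show "real_point (r *\<^sub>R x) = r *\<^sub>R real_point x" for r x
      unfolding vec_eq_iff forall_4 vector_scaleR_component real_point_nth by (simp add: scaleR_conv_of_real)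
  qed
  then show ?thesis by (simp add: linear_conv_bounded_linear)
qed

lemma real_point_params: "fst x \<in> U \<Longrightarrow> real_point x \<in> params"
  using m C by (simp add: params_def)

lemma Xsf_eq: "Xsf Z R \<gamma> a \<zeta> \<Phi> = X \<gamma> (real_point (a, \<theta>)) \<zeta> \<Phi>"
  by (simp add: Xsf_def X_def)

lemma bracket_term:
  assumes \<Phi>: "regular \<Phi>" and d: "d \<in> {\<rho>, - \<rho>}" and \<gamma>: "\<gamma> \<in> {gamma1, gamma2}" and p: "p \<in> params"
    and off: "off_ray d \<zeta>"
  shows "(\<Sum>\<^sub>\<infinity>\<gamma>'\<in>positive_charges U Z d. of_rat (f \<gamma> \<gamma>') * ray_integral d \<zeta> (\<lambda>\<zeta>'. X \<gamma>' p \<zeta>' (\<Phi> p (Some \<zeta>'))))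
    = ray_part d \<gamma> \<Phi> p \<zeta>"
proof -
  interpret tilted_sector "\<sigma> d" m "cmod d" by (rule tilted[OF d])
  note d0 = rho_neq(2)[OF d]
  let ?\<zeta> = "map_option (\<lambda>z. z / d) \<zeta>"
  have off1: "off_ray 1 ?\<zeta>"
    using off d0 by (cases \<zeta>) (auto simp: off_ray_def field_simps)
  have out: "w = 0 \<or> w \<notin> closed_ray 1" if w: "?\<zeta> = Some w" for w
  proof (rule ccontr)
    assume "\<not> (w = 0 \<or> w \<notin> closed_ray 1)"
    then have "Im w = 0" "Re w > 0" by (auto simp: closed_ray_def complex_eq_iff order_less_le)
    then have "w = of_real (Re w) * 1" "Re w > 0" by (simp_all add: complex_eq_iff)
    then show False using off1 w unfolding off_ray_def by metis
  qed
  have "\<exists>K. \<forall>t>0. cmod (kern ?\<zeta> (of_real t * 1)) \<le> K"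
    by (rule kern_bounded_outside(2)[OF out]) auto
  then obtain K where K: "\<And>t. t > 0 \<Longrightarrow> cmod (kern ?\<zeta> (of_real t * 1)) \<le> K" by blast
  have "of_rat (f \<gamma> \<gamma>') * ray_integral d \<zeta> (\<lambda>\<zeta>'. X \<gamma>' p \<zeta>' (\<Phi> p (Some \<zeta>')))
     = ray_integral 1 ?\<zeta> (\<lambda>w. of_rat (f \<gamma> \<gamma>') * X \<gamma>' p (d * w) (\<Phi> p (Some (d * w))))" for \<gamma>'
    unfolding ray_integral_scale[OF d0] ray_integral_cmult ..
  moreover have "((\<lambda>\<gamma>'. ray_integral 1 ?\<zeta> (\<lambda>w. of_rat (f \<gamma> \<gamma>') * X \<gamma>' p (d * w) (\<Phi> p (Some (d * w))))) has_sum
      ray_integral 1 ?\<zeta> (source d \<gamma> \<Phi> p)) (positive_charges U Z d)"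
    unfolding source_def
    by (rule ray_integral_infsum[OF ray_scale_pos off1 K damped_rayD[OF source_term_damped[OF \<Phi> d _ p]] source_sums(1)[OF d \<gamma> p]]) auto
  ultimately have "(\<Sum>\<^sub>\<infinity>\<gamma>'\<in>positive_charges U Z d. of_rat (f \<gamma> \<gamma>') * ray_integral d \<zeta> (\<lambda>\<zeta>'. X \<gamma>' p \<zeta>' (\<Phi> p (Some \<zeta>'))))
    = ray_integral 1 ?\<zeta> (source d \<gamma> \<Phi> p)" by (simp add: infsumI)
  also have "\<dots> = ray_part d \<gamma> \<Phi> p \<zeta>"
    unfolding ray_part_def by (rule sided_integral_off_ray[OF source_damped[OF \<Phi> d \<gamma> p] off1, symmetric])
  finally show ?thesis .
qed

lemma step_off_rays_eq:
  assumes \<Phi>: "regular \<Phi>" and a: "a \<in> U" and eq: "\<And>\<zeta>. \<Theta> a \<theta> \<zeta> = \<Phi> (real_point (a, \<theta>)) \<zeta>"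
    and off: "off_ray \<rho> \<zeta>" "off_ray (- \<rho>) \<zeta>"
  shows "step_off_rays U Z \<rho> f R \<Theta> a \<theta> \<zeta> = rotated_step \<Phi> (real_point (a, \<theta>)) \<zeta>"
proof -
  have p: "real_point (a, \<theta>) \<in> params" using a by (simp add: real_point_params)
  have "bracket U Z \<rho> f R \<gamma> \<Theta> a \<theta> \<zeta> = ray_part \<rho> \<gamma> \<Phi> (real_point (a, \<theta>)) \<zeta> + ray_part (- \<rho>) \<gamma> \<Phi> (real_point (a, \<theta>)) \<zeta>"
    if "\<gamma> \<in> {gamma1, gamma2}" for \<gamma>
    unfolding bracket_def Xsf_eq[where \<theta> = \<theta>] eq
    using bracket_term[OF \<Phi> _ that p off(1)] bracket_term[OF \<Phi> _ that p off(2)] by simp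
  then show ?thesis by (simp add: step_off_rays_def rotated_step_def)
qed

end

text \<open>A neighbourhood of \<open>\<infinity>\<close> is the complement of a compact set, here of the part of a large disc in which \<open>G\<close> is not
  yet known to have its values in the given open set.\<close>

lemma continuous_map_sphere:
  fixes G :: "complex option \<Rightarrow> 'b::topological_space"
  assumes cont: "continuous_on C (\<lambda>z. G (Some z))"
    and inf: "((\<lambda>z. G (Some z)) \<longlongrightarrow> G None) (inf at_infinity (principal C))"
  shows "continuous_map (subtopology riemann_sphere (insert None (Some ` C))) euclidean G"
  unfolding continuous_map_def
proof (intro conjI allI impI)
  let ?S = "insert None (Some ` C)"
  have top: "topspace (subtopology riemann_sphere ?S) = ?S" by auto
  fix V :: "'b set" assume "openin euclidean V"
  then have V: "open V" by simp
  then obtain A where A: "open A" "A \<inter> C = (\<lambda>z. G (Some z)) -` V \<inter> C"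
    using cont unfolding continuous_on_open_invariant by blast
  have "\<exists>T. openin riemann_sphere T \<and> {x \<in> ?S. G x \<in> V} = T \<inter> ?S"
  proof (cases "G None \<in> V")
    case False
    then have "{x \<in> ?S. G x \<in> V} = Some ` A \<inter> ?S" using A(2) by auto
    then show ?thesis using A(1) by (intro exI[of _ "Some ` A"]) simp
  next
    case True
    have "\<forall>\<^sub>F z in inf at_infinity (principal C). G (Some z) \<in> V"
      using inf V True by (rule topological_tendstoD)
    then obtain b where b: "\<And>z. b \<le> cmod z \<Longrightarrow> z \<in> C \<Longrightarrow> G (Some z) \<in> V"
      unfolding eventually_inf_principal eventually_at_infinity by blast
    define K where "K = cball 0 b - A"
    have K: "compact K" "closed K" unfolding K_def using A(1) by (auto intro: compact_diff closed_Diff)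
    have "openin riemann_sphere (insert None (Some ` (UNIV - K)))"
      unfolding openin_Alexandroff_compactification using K by (intro disjI2 exI[of _ K]) auto
    moreover have "{x \<in> ?S. G x \<in> V} = insert None (Some ` (UNIV - K)) \<inter> ?S"
    proof -
      have "G (Some z) \<in> V \<longleftrightarrow> z \<notin> K" if "z \<in> C" for z
      proof
        assume "G (Some z) \<in> V"
        then have "z \<in> A" using A(2) that by blast
        then show "z \<notin> K" by (simp add: K_def)
      next
        assume "z \<notin> K"
        then consider "z \<in> A" | "b \<le> cmod z" unfolding K_def by fastforce
        then show "G (Some z) \<in> V" using A(2) b that by cases blast+
      qed
      then show ?thesis using True by auto
    qed
    ultimately show ?thesis by blast
  qed
  then show "openin (subtopology riemann_sphere ?S) {x \<in> topspace (subtopology riemann_sphere ?S). G x \<in> V}"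
    unfolding top openin_subtopology by blast
qed auto

lemma left_right_plane_eq:
  assumes "\<rho> \<noteq> 0"
  shows "left_plane \<rho> = {z. 0 < 1 * Im (z / \<rho>)}" "right_plane \<rho> = {z. 0 < - 1 * Im (z / \<rho>)}"
proof -
  have "Im (z / \<rho>) = Im (z * cnj \<rho>) / (cmod \<rho>)\<^sup>2" for z
    by (metis Im_divide_of_real complex_div_cnj of_real_power)
  then show "left_plane \<rho> = {z. 0 < 1 * Im (z / \<rho>)}" "right_plane \<rho> = {z. 0 < - 1 * Im (z / \<rho>)}"
    using assms by (auto simp: left_plane_def right_plane_def zero_less_divide_iff divide_less_0_iff)
qed

lemma smooth_on_cong:
  assumes "open S" "\<And>x. x \<in> S \<Longrightarrow> g x = h x" "smooth_on S g"
  shows "smooth_on S h"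
  using assms(3) Ck_on_cong[OF assms(1,2)] by (simp add: smooth_on_def)

lemma pre_X_subset_banach_X:
  assumes "U \<noteq> {}" "\<Phi> \<in> pre_X U" shows "\<Phi> \<in> banach_X U"
proof -
  have "field_norm U (field_diff \<Phi> \<Phi>) = 0"
    using assms(1) by (simp add: field_norm_def field_diff_def max_norm_def case_prod_unfold)
  then show ?thesis using assms(2) unfolding banach_X_def pre_X_def by force
qed

context rotated_iteration begin

text \<open>The limit which defines the values on the rays is the value of the extension.\<close>

lemma Lim_step_off_rays:
  assumes \<Phi>: "regular \<Phi>" and a: "a \<in> U" and eq: "\<And>\<zeta>. \<Theta> a \<theta> \<zeta> = \<Phi> (real_point (a, \<theta>)) \<zeta>"
    and d: "d \<in> {\<rho>, - \<rho>}" and sg: "s = 1 \<or> s = - 1" and side: "side s d = \<sigma> d" and z: "z \<in> ray d"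
  shows "Lim (at z within {z. 0 < s * Im (z / \<rho>)}) (\<lambda>z. step_off_rays U Z \<rho> f R \<Theta> a \<theta> (Some z))
    = rotated_step \<Phi> (real_point (a, \<theta>)) (Some z)"
proof -
  let ?H = "{z. 0 < s * Im (z / \<rho>)}"
  let ?p = "real_point (a, \<theta>)"
  have p: "?p \<in> params" using a by (simp add: real_point_params)
  obtain t where t: "t > 0" "z = of_real t * d" using z by (auto simp: ray_def)
  have zero: "Im (z / \<rho>) = 0" using t(2) d \<rho> by auto
  show ?thesis
  proof (rule tendsto_Lim)
    have "z islimpt ?H" unfolding islimpt_approachable
    proof (intro allI impI)
      fix e :: real assume e: "0 < e"
      define v where "v = of_real (e / (2 * cmod \<rho>)) * (\<i> * of_real s) * \<rho>"
      have "Im ((z + v) / \<rho>) = Im (z / \<rho>) + e / (2 * cmod \<rho>) * s"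
        using \<rho> by (simp add: add_divide_distrib v_def)
      then have "0 < s * Im ((z + v) / \<rho>)"
        using sg e \<rho> zero by (auto simp: zero_less_mult_iff)
      moreover have "cmod v = e / 2" using sg \<rho> e by (auto simp: v_def norm_mult norm_divide)
      ultimately show "\<exists>x'\<in>?H. x' \<noteq> z \<and> dist x' z < e"
        using e by (intro bexI[of _ "z + v"]) (auto simp: dist_norm)
    qed
    then show "\<not> trivial_limit (at z within ?H)" by (simp add: trivial_limit_within)
    have "((\<lambda>z. extension s \<Phi> ?p (Some z)) \<longlongrightarrow> extension s \<Phi> ?p (Some z)) (at z within {z. 0 \<le> s * Im (z / \<rho>)})"
      using extension_continuous(1)[OF \<Phi> p sg] zero by (simp add: continuous_on_def)
    then have "((\<lambda>z. extension s \<Phi> ?p (Some z)) \<longlongrightarrow> extension s \<Phi> ?p (Some z)) (at z within ?H)"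
      by (rule tendsto_within_subset) auto
    moreover have "\<forall>\<^sub>F w in at z within ?H. extension s \<Phi> ?p (Some w) = step_off_rays U Z \<rho> f R \<Theta> a \<theta> (Some w)"
      unfolding eventually_at_filter
    proof (rule always_eventually, intro allI impI)
      fix w assume "w \<in> ?H"
      then have w: "0 < s * Im (w / \<rho>)" by simp
      then have "off_ray \<rho> (Some w)" "off_ray (- \<rho>) (Some w)" using \<rho> by (auto simp: off_ray_def)
      then have "step_off_rays U Z \<rho> f R \<Theta> a \<theta> (Some w) = rotated_step \<Phi> ?p (Some w)"
        by (rule step_off_rays_eq[where \<Theta> = \<Theta>, OF \<Phi> a eq])
      moreover have "extension s \<Phi> ?p (Some w) = rotated_step \<Phi> ?p (Some w)"
        by (rule extension_eq[OF \<Phi> p sg]) (use w in auto)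
      ultimately show "extension s \<Phi> ?p (Some w) = step_off_rays U Z \<rho> f R \<Theta> a \<theta> (Some w)" by simp
    qed
    ultimately have "((\<lambda>z. step_off_rays U Z \<rho> f R \<Theta> a \<theta> (Some z)) \<longlongrightarrow> extension s \<Phi> ?p (Some z)) (at z within ?H)"
      by (rule Lim_transform_eventually)
    then show "((\<lambda>z. step_off_rays U Z \<rho> f R \<Theta> a \<theta> (Some z)) \<longlongrightarrow> rotated_step \<Phi> ?p (Some z)) (at z within ?H)"
      by (simp add: extension_on_ray[OF d side z])
  qed
qed

lemma step_eq:
  assumes \<Phi>: "regular \<Phi>" and a: "a \<in> U" and eq: "\<And>\<zeta>. \<Theta> a \<theta> \<zeta> = \<Phi> (real_point (a, \<theta>)) \<zeta>"
  shows "step U Z \<rho> f {z. 0 < \<sigma> \<rho> * Im (z / \<rho>)} {z. 0 < - \<sigma> (- \<rho>) * Im (z / \<rho>)} R \<Theta> a \<theta> \<zeta>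
    = rotated_step \<Phi> (real_point (a, \<theta>)) \<zeta>"
proof -
  have off: "off_ray d \<zeta>" if "\<zeta> \<notin> Some ` ray d" for d
    using that by (auto simp: off_ray_def ray_def)
  have plus: "side (\<sigma> \<rho>) \<rho> = \<sigma> \<rho>" "side (- \<sigma> (- \<rho>)) (- \<rho>) = \<sigma> (- \<rho>)"
    using rho_neq(1) by (auto simp: side_def)
  have sg: "\<sigma> \<rho> = 1 \<or> \<sigma> \<rho> = - 1" "- \<sigma> (- \<rho>) = 1 \<or> - \<sigma> (- \<rho>) = - 1"
    using \<sigma>[of \<rho>] \<sigma>[of "- \<rho>"] by auto
  consider (plus) z where "\<zeta> = Some z" "z \<in> ray \<rho>" | (minus) z where "\<zeta> = Some z" "z \<in> ray (- \<rho>)" "z \<notin> ray \<rho>"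
    | (neither) "\<zeta> \<notin> Some ` ray \<rho>" "\<zeta> \<notin> Some ` ray (- \<rho>)" by blast
  then show ?thesis
  proof cases
    case (plus z)
    then show ?thesis
      using Lim_step_off_rays[where \<Theta> = \<Theta>, OF \<Phi> a eq _ sg(1) \<open>side (\<sigma> \<rho>) \<rho> = \<sigma> \<rho>\<close>] by (simp add: step_def)
  next
    case (minus z)
    have "\<zeta> \<notin> Some ` ray \<rho>" "\<zeta> \<in> Some ` ray (- \<rho>)" using minus by auto
    then show ?thesis
      using Lim_step_off_rays[where \<Theta> = \<Theta>, OF \<Phi> a eq _ sg(2) \<open>side (- \<sigma> (- \<rho>)) (- \<rho>) = \<sigma> (- \<rho>)\<close> minus(2)] minus(1)
      by (simp add: step_def)
  next
    case neither
    then show ?thesis using step_off_rays_eq[where \<Theta> = \<Theta>, OF \<Phi> a eq off off]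
      by (simp add: step_def)
  qed
qed

lemma Theta_iter_eq:
  assumes "a \<in> U"
  shows "Theta_iter U Z \<rho> f {z. 0 < \<sigma> \<rho> * Im (z / \<rho>)} {z. 0 < - \<sigma> (- \<rho>) * Im (z / \<rho>)} R n a \<theta> \<zeta>
    = approx n (real_point (a, \<theta>)) \<zeta>"
proof (induction n arbitrary: \<zeta>)
  case 0
  then show ?case by (simp add: angles_def angle_field_def)
next
  case (Suc n)
  let ?\<Theta> = "Theta_iter U Z \<rho> f {z. 0 < \<sigma> \<rho> * Im (z / \<rho>)} {z. 0 < - \<sigma> (- \<rho>) * Im (z / \<rho>)} R n"
  show ?case using step_eq[where \<Theta> = ?\<Theta>, OF regular_approx assms Suc] by simp
qed

definition real_field :: "(complex ^ 4 \<Rightarrow> complex option \<Rightarrow> complex \<times> complex) \<Rightarrow> phi_fun" where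
  "real_field \<Phi> a \<theta> \<zeta> = \<Phi> (real_point (a, \<theta>)) \<zeta>"

lemma smooth_real_point:
  assumes "line_holo params F" "line_holo params G"
  shows "smooth_on (U \<times> UNIV) (\<lambda>x. (F (real_point x), G (real_point x)))"
  by (rule line_holo_smooth[OF open_Times[OF U open_UNIV] open_params bounded_linear_real_point _ assms])
     (use real_point_params in auto)

lemma field_smooth_real_field:
  assumes "regular \<Phi>" shows "field_smooth U (real_field \<Phi>)"
  unfolding field_smooth_def
proof
  fix \<zeta>
  have "smooth_on (U \<times> UNIV) (\<lambda>x. (fst (\<Phi> (real_point x) \<zeta>), snd (\<Phi> (real_point x) \<zeta>)))"
    by (intro smooth_real_point regularD(2)[OF assms]) auto
  then show "smooth_on (U \<times> UNIV) (\<lambda>(a, \<theta>). real_field \<Phi> a \<theta> \<zeta>)"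
    by (simp add: real_field_def case_prod_unfold)
qed

text \<open>After subtraction of the angles, the fields at hand are themselves smooth, bounded and periodic, so that no
  approximation is needed to see that they belong to the completion.\<close>

lemma real_field_in_banach_X:
  assumes \<Phi>: "regular \<Phi>" and ne: "U \<noteq> {}"
    and bound: "\<And>p \<zeta>. p \<in> params \<Longrightarrow> cmod (fst (\<Phi> p \<zeta>) - p $ 3) \<le> 1 \<and> cmod (snd (\<Phi> p \<zeta>) - p $ 4) \<le> 1"
    and shift: "\<And>k l p p' \<zeta>. shifted k l p p' \<Longrightarrow> p \<in> params \<Longrightarrow> p' \<in> params \<Longrightarrow>
      \<Phi> p' \<zeta> = \<Phi> p \<zeta> + (of_real (2 * pi * k), of_real (2 * pi * l))"
    and \<Theta>: "\<And>a \<theta> \<zeta>. a \<in> U \<Longrightarrow> \<Theta> a \<theta> \<zeta> = real_field \<Phi> a \<theta> \<zeta>"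
  shows "field_diff \<Theta> angles \<in> banach_X U"
proof -
  have diff: "field_diff \<Theta> angles a \<theta> \<zeta> = (fst (\<Phi> (real_point (a, \<theta>)) \<zeta>) - real_point (a, \<theta>) $ 3,
      snd (\<Phi> (real_point (a, \<theta>)) \<zeta>) - real_point (a, \<theta>) $ 4)" if "a \<in> U" for a \<theta> \<zeta>
    using \<Theta>[OF that] by (simp add: field_diff_def angles_def real_field_def minus_prod_def)
  have "field_bounded U (field_diff \<Theta> angles)"
    unfolding field_bounded_def using bound[OF real_point_params]
    by (intro exI[of _ 1]) (auto simp: diff max_norm_def simp del: real_point_nth)
  moreover have "field_periodic U (field_diff \<Theta> angles)"
    unfolding field_periodic_def
  proof (intro ballI allI)
    fix a x y \<zeta> assume a: "a \<in> U"
    have "shifted 1 0 (real_point (a, x, y)) (real_point (a, x + 2 * pi, y))"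
      "shifted 0 1 (real_point (a, x, y)) (real_point (a, x, y + 2 * pi))" by (auto simp: shifted_def)
    then show "field_diff \<Theta> angles a (x + 2 * pi, y) \<zeta> = field_diff \<Theta> angles a (x, y) \<zeta> \<and>
        field_diff \<Theta> angles a (x, y + 2 * pi) \<zeta> = field_diff \<Theta> angles a (x, y) \<zeta>"
      using a by (simp add: diff shift real_point_params)
  qed
  moreover have "field_smooth U (field_diff \<Theta> angles)"
    unfolding field_smooth_def
  proof (intro allI)
    fix \<zeta>
    have "smooth_on (U \<times> UNIV) (\<lambda>x. (fst (\<Phi> (real_point x) \<zeta>) - real_point x $ 3, snd (\<Phi> (real_point x) \<zeta>) - real_point x $ 4))"
      by (intro smooth_real_point line_holo_diff coord_line_holo regularD(2)[OF \<Phi>]) auto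
    then show "smooth_on (U \<times> UNIV) (\<lambda>(a, \<theta>). field_diff \<Theta> angles a \<theta> \<zeta>)"
      by (rule smooth_on_cong[rotated 2]) (use U diff in \<open>auto intro: open_Times\<close>)
  qed
  ultimately show ?thesis using ne by (intro pre_X_subset_banach_X) (auto simp: pre_X_def)
qed

lemma limit_up_to_rays:
  assumes a: "a \<in> U" and sg: "s = 1 \<or> s = - 1"
  shows "holomorphic_up_to_rays {z. 0 < s * Im (z / \<rho>)} (real_field limit a \<theta>)"
proof -
  let ?P = "{z. 0 < s * Im (z / \<rho>)}" and ?C = "{z. 0 \<le> s * Im (z / \<rho>)}"
  let ?p = "real_point (a, \<theta>)"
  have p: "?p \<in> params" using a by (simp add: real_point_params)
  have fixed: "real_field limit a \<theta> = rotated_step limit ?p"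
    by (rule ext) (simp add: real_field_def limit_fixed[OF p])
  have "closed ?C" by (intro closed_Collect_le continuous_intros) (use \<rho> in auto)
  then have cl: "closure ?P \<subseteq> ?C" by (intro closure_minimal) auto
  have "continuous_map (subtopology riemann_sphere (insert None (Some ` closure ?P))) euclidean (extension s limit ?p)"
  proof (rule continuous_map_sphere)
    show "continuous_on (closure ?P) (\<lambda>z. extension s limit ?p (Some z))"
      by (rule continuous_on_subset[OF extension_continuous(1)[OF regular_limit p sg] cl])
    show "((\<lambda>z. extension s limit ?p (Some z)) \<longlongrightarrow> extension s limit ?p None) (inf at_infinity (principal (closure ?P)))"
      by (rule tendsto_mono[OF _ extension_continuous(2)[OF regular_limit p sg]]) (use cl in \<open>intro inf_mono; simp\<close>)
  qed
  moreover have "\<forall>\<zeta> \<in> insert None (insert (Some 0) (Some ` ?P)). extension s limit ?p \<zeta> = real_field limit a \<theta> \<zeta>"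
    unfolding fixed using extension_eq[OF regular_limit p sg] by auto
  moreover have "(\<lambda>z. fst (real_field limit a \<theta> (Some z))) holomorphic_on ?P"
    "(\<lambda>z. snd (real_field limit a \<theta> (Some z))) holomorphic_on ?P"
    unfolding fixed by (intro rotated_step_holomorphic[OF regular_limit p sg]; simp)+
  ultimately show ?thesis unfolding holomorphic_up_to_rays_def by blast
qed

lemma iteration_converges:
  assumes ne: "U \<noteq> {}"
    and H: "H\<^sub>p = {z. 0 < \<sigma> \<rho> * Im (z / \<rho>)}" "H\<^sub>m = {z. 0 < - \<sigma> (- \<rho>) * Im (z / \<rho>)}"
  shows "converges_in_X U (Theta_iter U Z \<rho> f H\<^sub>p H\<^sub>m R) (real_field limit)"
proof -
  let ?T = "Theta_iter U Z \<rho> f H\<^sub>p H\<^sub>m R"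
  have T: "?T n a \<theta> \<zeta> = real_field (approx n) a \<theta> \<zeta>" if "a \<in> U" for n a \<theta> \<zeta>
    unfolding H real_field_def by (rule Theta_iter_eq[OF that])
  have near: "cmod (fst (approx n p \<zeta>) - p $ 3) \<le> 1 \<and> cmod (snd (approx n p \<zeta>) - p $ 4) \<le> 1"
    if "p \<in> params" for n p \<zeta>
    using rotated_step_near_angles[OF regular_approx that, of "n - 1" \<zeta>]
    by (cases n) (auto simp: angle_field_def)
  have near_lim: "cmod (fst (limit p \<zeta>) - p $ 3) \<le> 1 \<and> cmod (snd (limit p \<zeta>) - p $ 4) \<le> 1"
    if "p \<in> params" for p \<zeta>
    using rotated_step_near_angles[OF regular_limit that, of \<zeta>] by (simp add: limit_fixed[OF that])
  have bound: "max_norm (field_diff (?T n) (real_field limit) a \<theta> \<zeta>) \<le> (1 / 2) ^ n" if a: "a \<in> U" for n a \<theta> \<zeta>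
    using approx_limit(1)[OF real_point_params, of "(a, \<theta>)" fst n \<zeta>] approx_limit(1)[OF real_point_params, of "(a, \<theta>)" snd n \<zeta>] a
    by (simp add: field_diff_def T real_field_def max_norm_def)
  have norm_le: "field_norm U (field_diff (?T n) (real_field limit)) \<le> (1 / 2) ^ n" for n
    unfolding field_norm_def by (rule cSUP_least) (use ne bound in auto)
  have norm_ge: "0 \<le> field_norm U (field_diff (?T n) (real_field limit))" for n
  proof -
    obtain a where a: "a \<in> U" using ne by blast
    have "0 \<le> max_norm (field_diff (?T n) (real_field limit) a (0, 0) None)" by (simp add: max_norm_def le_max_iff_disj)
    also have "\<dots> \<le> field_norm U (field_diff (?T n) (real_field limit))"
    proof -
      have "bdd_above ((\<lambda>(a, \<theta>, \<zeta>). max_norm (field_diff (?T n) (real_field limit) a \<theta> \<zeta>)) ` (U \<times> UNIV \<times> UNIV))"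
        using bound by (intro bdd_aboveI2[where M = "(1 / 2) ^ n"]) auto
      from cSUP_upper[OF _ this, of "(a, (0, 0), None)"] a show ?thesis by (simp add: field_norm_def)
    qed
    finally show ?thesis .
  qed
  have "(\<lambda>n. field_norm U (field_diff (?T n) (real_field limit))) \<longlonglongrightarrow> 0"
  proof (rule Lim_null_comparison)
    show "\<forall>\<^sub>F n in sequentially. norm (field_norm U (field_diff (?T n) (real_field limit))) \<le> (1 / 2) ^ n"
    proof (rule always_eventually, rule allI)
      show "norm (field_norm U (field_diff (?T n) (real_field limit))) \<le> (1 / 2) ^ n" for n
        using norm_le[of n] norm_ge[of n] by (simp only: real_norm_def abs_of_nonneg)
    qed
    show "(\<lambda>n. (1 / 2 :: real) ^ n) \<longlonglongrightarrow> 0" by (rule LIMSEQ_power_zero) simp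
  qed
  moreover have "field_diff (?T n) angles \<in> banach_X U" for n
    by (rule real_field_in_banach_X[OF regular_approx ne near approx_shifted T])
  moreover have "field_diff (real_field limit) angles \<in> banach_X U"
    by (rule real_field_in_banach_X[OF regular_limit ne near_lim limit_shifted refl])
  ultimately show ?thesis by (simp add: converges_in_X_def)
qed

end

theorem theorem3p6:
  fixes U :: "complex set" and Z :: "charge \<Rightarrow> complex \<Rightarrow> complex" and nrm :: "charge \<Rightarrow> real"
    and \<Omega> :: "charge \<Rightarrow> int" and \<kappa> :: real and \<rho> a\<^sub>0 :: complex
    and f :: "charge \<Rightarrow> charge \<Rightarrow> rat" and c \<delta> :: real
    and H\<^sub>p H\<^sub>m :: "complex set"
  assumes "rh_data U Z nrm \<Omega> \<kappa> \<rho> a\<^sub>0 f c \<delta>"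
    and "H\<^sub>p \<in> {left_plane \<rho>, right_plane \<rho>}"
    and "H\<^sub>m \<in> {left_plane \<rho>, right_plane \<rho>}"
  shows "\<exists>R\<^sub>0>0. \<forall>R\<ge>R\<^sub>0. \<exists>\<Theta>.
    converges_in_X U (Theta_iter U Z \<rho> f H\<^sub>p H\<^sub>m R) \<Theta> \<and>
    (\<forall>a\<in>U. \<forall>\<theta>. \<forall>P\<in>{left_plane \<rho>, right_plane \<rho>}. holomorphic_up_to_rays P (\<Theta> a \<theta>)) \<and>
    field_smooth U \<Theta>"
proof -
  interpret rh_data U Z nrm \<Omega> \<kappa> \<rho> a\<^sub>0 f c \<delta> by fact
  have ne: "U \<noteq> {}" using U(2) by auto
  note planes = left_right_plane_eq[OF \<rho>_nonzero]
  obtain tp where tp: "tp = 1 \<or> tp = (- 1 :: real)" "H\<^sub>p = {z. 0 < tp * Im (z / \<rho>)}"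
    using assms(2) unfolding planes by blast
  obtain tm where tm: "tm = 1 \<or> tm = (- 1 :: real)" "H\<^sub>m = {z. 0 < tm * Im (z / \<rho>)}"
    using assms(3) unfolding planes by blast
  define \<sigma> where "\<sigma> d = (if d = \<rho> then tp else - tm)" for d
  have neq: "- \<rho> \<noteq> \<rho>" using \<rho>_nonzero by (simp add: eq_neg_iff_add_eq_0 neg_eq_iff_add_eq_0)
  obtain \<epsilon> C z\<^sub>0 where pos: "0 < \<epsilon>" "0 < C" "0 < z\<^sub>0" and act:
    "\<And>d \<gamma> \<gamma>' a. d \<in> {\<rho>, - \<rho>} \<Longrightarrow> a \<in> U \<Longrightarrow> \<gamma>' \<in> positive_charges U Z d \<Longrightarrow> f \<gamma> \<gamma>' \<noteq> 0 \<Longrightarrow>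
        Re (Z \<gamma>' a * cnj d) \<le> - \<epsilon> * cmod d * cmod (Z \<gamma>' a) \<and>
        real_of_int \<bar>fst \<gamma>'\<bar> + real_of_int \<bar>snd \<gamma>'\<bar> \<le> C * cmod (Z \<gamma>' a) \<and> z\<^sub>0 \<le> cmod (Z \<gamma>' a)"
    using active_charge_bounds by blast
  \<comment> \<open>The slope of the rotation is half of the opening \<open>\<epsilon>\<close> which the rays of the charges leave at the boundary.\<close>
  define m where "m = min 1 (\<epsilon> / 2)"
  have m: "0 < m" "m \<le> 1" "2 * m \<le> \<epsilon>" using pos by (auto simp: m_def)
  \<comment> \<open>With this bound for the sum over charges, each of the four ray contributions is at most \<open>1\<close>.\<close>
  define \<tau> where "\<tau> = 1 / (20 / m + 4 * pi)"
  have den: "0 < 20 / m + 4 * pi" using m pi_gt_zero by (intro add_pos_pos) auto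
  obtain L\<^sub>0 where L\<^sub>0: "\<forall>L\<ge>L\<^sub>0. \<forall>d\<in>{\<rho>, - \<rho>}. \<forall>\<gamma>\<in>{gamma1, gamma2}. \<forall>a\<in>U.
     (\<lambda>\<gamma>'. \<bar>real_of_rat (f \<gamma> \<gamma>')\<bar> * exp (- L * cmod (Z \<gamma>' a))) summable_on positive_charges U Z d \<and>
     (\<Sum>\<^sub>\<infinity>\<gamma>'\<in>positive_charges U Z d. \<bar>real_of_rat (f \<gamma> \<gamma>')\<bar> * exp (- L * cmod (Z \<gamma>' a))) \<le> \<tau>"
    using active_sum_small[of \<tau>] den by (auto simp: \<tau>_def)
  \<comment> \<open>\<open>L \<ge> C\<close> is what absorbs the Lipschitz constant of the exponentials.\<close>
  define L where "L = max L\<^sub>0 C"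
  define R\<^sub>0 where "R\<^sub>0 = 4 / (pi * m) * (2 * L + 2 * C + 2 / z\<^sub>0)"
  have L: "C \<le> L" "0 < L" using pos by (auto simp: L_def)
  show ?thesis
  proof (intro exI[of _ R\<^sub>0] conjI allI impI)
    show "0 < R\<^sub>0" using pos L m by (simp add: R\<^sub>0_def add_pos_pos)
    fix R assume R: "R\<^sub>0 \<le> R"
    have "pi * m / 4 * R\<^sub>0 \<le> pi * m / 4 * R" by (rule mult_left_mono[OF R]) (use m in simp)
    moreover have "pi * m / 4 * R\<^sub>0 = 2 * L + 2 * C + 2 / z\<^sub>0" using m by (simp add: R\<^sub>0_def)
    moreover have "pi * R * m / 4 = pi * m / 4 * R" by simp
    ultimately have R': "2 * L + 2 * C + 2 / z\<^sub>0 \<le> pi * R * m / 4" by linarith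
    moreover have "0 < 2 / z\<^sub>0" using pos by simp
    ultimately have R1: "2 * L + 2 * C \<le> pi * R * m / 4" and "2 / z\<^sub>0 \<le> pi * R * m / 4"
      using L pos by linarith+
    then have R2: "2 \<le> pi * R * m / 4 * z\<^sub>0" using pos by (simp add: divide_le_eq)
    interpret rotated_iteration U Z f \<rho> \<sigma> m C z\<^sub>0 L \<tau> R
    proof
      show "(20 / m + 4 * pi) * \<tau> \<le> 1" "0 \<le> \<tau>" using den by (auto simp: \<tau>_def)
      show "Z \<gamma> a = of_int (fst \<gamma>) * Z gamma1 a + of_int (snd \<gamma>) * Z gamma2 a" if "a \<in> U" for a \<gamma>
        by (rule Z_linear[OF that])
      show "\<sigma> d = 1 \<or> \<sigma> d = - 1" if "d \<in> {\<rho>, - \<rho>}" for d using tp(1) tm(1) by (auto simp: \<sigma>_def)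
      fix d a \<gamma>' \<gamma>
      assume *: "d \<in> {\<rho>, - \<rho>}" "a \<in> U" "\<gamma>' \<in> positive_charges U Z d" "f \<gamma> \<gamma>' \<noteq> 0"
      have "2 * m * (cmod d * cmod (Z \<gamma>' a)) \<le> \<epsilon> * (cmod d * cmod (Z \<gamma>' a))"
        by (rule mult_right_mono[OF m(3)]) simp
      then show "Re (Z \<gamma>' a * cnj d) \<le> - (2 * m) * cmod d * cmod (Z \<gamma>' a) \<and>
          real_of_int \<bar>fst \<gamma>'\<bar> + real_of_int \<bar>snd \<gamma>'\<bar> \<le> C * cmod (Z \<gamma>' a) \<and> z\<^sub>0 \<le> cmod (Z \<gamma>' a)"
        using act[OF *] by (simp add: mult.assoc)
    next
      fix d \<gamma> a assume *: "d \<in> {\<rho>, - \<rho>}" "\<gamma> \<in> {gamma1, gamma2}" "a \<in> U"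
      have "L\<^sub>0 \<le> L" by (simp add: L_def)
      from bspec[OF bspec[OF bspec[OF mp[OF spec[OF L\<^sub>0] this] *(1)] *(2)] *(3)]
      show "(\<lambda>\<gamma>'. \<bar>real_of_rat (f \<gamma> \<gamma>')\<bar> * exp (- L * cmod (Z \<gamma>' a))) summable_on positive_charges U Z d \<and>
        (\<Sum>\<^sub>\<infinity>\<gamma>'\<in>positive_charges U Z d. \<bar>real_of_rat (f \<gamma> \<gamma>')\<bar> * exp (- L * cmod (Z \<gamma>' a))) \<le> \<tau>"
        .
    qed (rule U(1) Z_holomorphic \<rho>_nonzero m(1,2) pos(2) L(1) R1 R2)+
    have H: "H\<^sub>p = {z. 0 < \<sigma> \<rho> * Im (z / \<rho>)}" "H\<^sub>m = {z. 0 < - \<sigma> (- \<rho>) * Im (z / \<rho>)}"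
      using tp tm neq by (auto simp: \<sigma>_def)
    show "\<exists>\<Theta>. converges_in_X U (Theta_iter U Z \<rho> f H\<^sub>p H\<^sub>m R) \<Theta> \<and>
      (\<forall>a\<in>U. \<forall>\<theta>. \<forall>P\<in>{left_plane \<rho>, right_plane \<rho>}. holomorphic_up_to_rays P (\<Theta> a \<theta>)) \<and> field_smooth U \<Theta>"
    proof (intro exI[of _ "real_field limit"] conjI ballI allI)
      show "converges_in_X U (Theta_iter U Z \<rho> f H\<^sub>p H\<^sub>m R) (real_field limit)"
        by (rule iteration_converges[OF ne H])
      show "field_smooth U (real_field limit)" by (rule field_smooth_real_field[OF regular_limit])
      fix a \<theta> P assume "a \<in> U" "P \<in> {left_plane \<rho>, right_plane \<rho>}"
      then show "holomorphic_up_to_rays P (real_field limit a \<theta>)"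
        using limit_up_to_rays[of a 1 \<theta>] limit_up_to_rays[of a "- 1" \<theta>] unfolding planes by auto
    qed
  qed
qed

end
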